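(* Let $p$ be a prime, let $G$ be a finite group, and let $R$ be a normal ring satisfying the Standing Hypotheses and the additional hypotheses (1) and (2). Then $$\upsilon_G(\mathrm{Det}(R[G]^\times))\subset pR[C_G].$$
   Context: Standing Hypotheses: $p$ is a prime; $R$ is a Noetherian integral domain of finite Krull dimension with field of fractions $N$ of characteristic zero ($N^c$ an algebraic closure), such that: (i) the natural map $R\to\varprojlim_n R/p^nR$ is an isomorphism; (ii) $R$ is equipped with a $\mathbb{Z}_p$-algebra endomorphism $F$ with $F(r)\equiv r^p \bmod pR$ for all $r\in R$, and $R/(1-F)R$ is torsion free; (iii) $pR$ is a prime ideal of $R$; (iv) $\mathrm{SK}_1(R\otimes_{\mathbb{Z}_p}W)=\{1\}$ for $W$ the valuation ring of any finite unramified extension of $\mathbb{Q}_p$. Additional hypotheses: (1) the $\mathbb{F}_p$-algebra $(R/pR)\otimes_{\mathbb{F}_p}\mathbb{F}_p^c$ contains only finitely many orthogonal idempotents ($\mathbb{F}_p^c$ an algebraic closure of $\mathbb{F}_p$). (2) For any finite non-ramified extension $L$ of $\mathbb{Q}_p$ put $\Delta=\mathrm{Gal}(L/\mathbb{Q}_p)$ and $R_L=R\otimes_{\mathbb{Z}_p}\mathcal{O}_L$ with lift of Frobenius $F$ the tensor product of $F$ on $R$ and the Frobenius of $\mathcal{O}_L$; let $\mathcal{M}(R_L)=\{u\in R_L^\times: F(u)=u^p\}$ and $\Lambda(R_L)=R_L^\times/\mathcal{M}(R_L)$. Then $\Lambda(R_L)$ is a $\mathbb{Z}_p$-module which is $\Delta$-cohomologically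 trivial, and for any $p$-subgroup $\Gamma$ of $\Delta$, $H^1(\Gamma,\mathcal{M}(R_L))=\{1\}$. $C_G$ is the set of conjugacy classes of $G$, $R[C_G]$ the free $R$-module on $C_G$, and $\phi:R[G]\to R[C_G]$ is the $R$-linear map sending a group element to its class. $F$ is extended to $R[G]$ by $F(rg)=F(r)g$. For $x\in R[G]^\times$, $\mathrm{Det}(x)$ is the homomorphism from virtual characters of $G$ to $N^{c\times}$ with $\mathrm{Det}(x)(\chi)=\det(T_\chi(x))$ for $T_\chi$ a representation over $N^c$ with character $\chi$. For a virtual character $\chi$, $(\psi^p\chi)(g)=\chi(g^p)$ and $(\psi^p\mathrm{Det}(x))(\chi)=\mathrm{Det}(x)(\psi^p\chi)$. Put $\Psi(\mathrm{Det}(x))=\psi^p\mathrm{Det}(F(x))$, and define $\upsilon_G(\mathrm{Det}(x))=\phi\circ\log\left(\mathrm{Det}(x)^p/\Psi(\mathrm{Det}(x))\right)$; that is, $\upsilon_G(\mathrm{Det}(x))$ is the element of $N^c[C_G]$ characterized by $$\chi(\upsilon_G(\mathrm{Det}(x)))=\log\left(\frac{\mathrm{Det}(x)(\chi)^p}{\mathrm{Det}(F(x))(\psi^p\chi)}\right)$$ for all characters $\chi$ of $G$, where characters are extended linearly to $N^c[C_G]$ and $\log$ is the $p$-adic logarithm (power series) on elements topologically congruent to $1$. *)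

theory Defs
  imports
    "HOL-Algebra.Algebra"
    "HOL-Algebra.Algebraic_Closure_Type"
    "HOL-Library.Extended_Nat"
    "Jordan_Normal_Form.Determinant"
begin

section \<open>Commutative algebra\<close>

definition krull_dim :: "('a, 'b) ring_scheme \<Rightarrow> enat" where
  "krull_dim R = Sup {enat n | n. \<exists>P. (\<forall>i\<le>n. primeideal (P i) R) \<and> (\<forall>i<n. P i \<subset> P (Suc i))}"

definition integral_over :: "'a::comm_ring_1 set \<Rightarrow> 'a \<Rightarrow> bool" where
  "integral_over S x \<longleftrightarrow>
     (\<exists>q. Polynomial.lead_coeff q = 1 \<and> (\<forall>i. Polynomial.coeff q i \<in> S) \<and> Polynomial.poly q x = 0)"

text \<open>The same notion for the record-based rings, whose polynomials are coefficient lists with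
  the leading coefficient first.\<close>

definition integral_in :: "('a, 'b) ring_scheme \<Rightarrow> 'a set \<Rightarrow> 'a \<Rightarrow> bool" where
  "integral_in K S x \<longleftrightarrow>
     (\<exists>q. q \<noteq> [] \<and> hd q = \<one>\<^bsub>K\<^esub> \<and> set q \<subseteq> S \<and> ring.eval K q x = \<zero>\<^bsub>K\<^esub>)"

text \<open>The inverse limit of the rings \<open>R/a\<^sup>nR\<close>.  The transition maps send \<open>r + a\<^bsup>n+1\<^esup>R\<close> to
  \<open>r + a\<^sup>nR\<close>, so a sequence of cosets is coherent exactly if it is decreasing.\<close>

definition adic_completion :: "('a, 'b) ring_scheme \<Rightarrow> 'a \<Rightarrow> (nat \<Rightarrow> 'a set) ring" where
  "adic_completion R a = (let Q = (\<lambda>n::nat. R Quot (PIdl\<^bsub>R\<^esub> (a [^]\<^bsub>R\<^esub> n))) in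
     \<lparr>carrier = {x. (\<forall>n. x n \<in> carrier (Q n)) \<and> (\<forall>n. x (Suc n) \<subseteq> x n)},
      monoid.mult = (\<lambda>x y n. x n \<otimes>\<^bsub>Q n\<^esub> y n), one = (\<lambda>n. \<one>\<^bsub>Q n\<^esub>),
      ring.zero = (\<lambda>n. \<zero>\<^bsub>Q n\<^esub>), add = (\<lambda>x y n. x n \<oplus>\<^bsub>Q n\<^esub> y n)\<rparr>)"

definition to_adic_completion :: "('a, 'b) ring_scheme \<Rightarrow> 'a \<Rightarrow> 'a \<Rightarrow> nat \<Rightarrow> 'a set" where
  "to_adic_completion R a r = (\<lambda>n. PIdl\<^bsub>R\<^esub> (a [^]\<^bsub>R\<^esub> n) +>\<^bsub>R\<^esub> r)"

definition frac_rel :: "('a, 'b) ring_scheme \<Rightarrow> (('a \<times> 'a) \<times> ('a \<times> 'a)) set" where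
  "frac_rel D = {((a, b), (c, d)). a \<in> carrier D \<and> c \<in> carrier D \<and>
     b \<in> carrier D - {\<zero>\<^bsub>D\<^esub>} \<and> d \<in> carrier D - {\<zero>\<^bsub>D\<^esub>} \<and> a \<otimes>\<^bsub>D\<^esub> d = c \<otimes>\<^bsub>D\<^esub> b}"

definition frac_field :: "('a, 'b) ring_scheme \<Rightarrow> ('a \<times> 'a) set ring" where
  "frac_field D =
     \<lparr>carrier = (carrier D \<times> (carrier D - {\<zero>\<^bsub>D\<^esub>})) // frac_rel D,
      monoid.mult = (\<lambda>U Y. \<Union>(a, b)\<in>U. \<Union>(c, d)\<in>Y. frac_rel D `` {(a \<otimes>\<^bsub>D\<^esub> c, b \<otimes>\<^bsub>D\<^esub> d)}),
      one = frac_rel D `` {(\<one>\<^bsub>D\<^esub>, \<one>\<^bsub>D\<^esub>)},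
      ring.zero = frac_rel D `` {(\<zero>\<^bsub>D\<^esub>, \<one>\<^bsub>D\<^esub>)},
      add = (\<lambda>U Y. \<Union>(a, b)\<in>U. \<Union>(c, d)\<in>Y.
               frac_rel D `` {((a \<otimes>\<^bsub>D\<^esub> d) \<oplus>\<^bsub>D\<^esub> (c \<otimes>\<^bsub>D\<^esub> b), b \<otimes>\<^bsub>D\<^esub> d)})\<rparr>"

text \<open>The monoid ring \<open>R[M]\<close>: finitely supported functions with the convolution product.\<close>

definition monoid_ring :: "('a, 'b) ring_scheme \<Rightarrow> ('m, 'c) monoid_scheme \<Rightarrow> ('m \<Rightarrow> 'a) ring" where
  "monoid_ring R M =
     \<lparr>carrier = {f. (\<forall>x\<in>carrier M. f x \<in> carrier R) \<and> (\<forall>x. x \<notin> carrier M \<longrightarrow> f x = \<zero>\<^bsub>R\<^esub>) \<and>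
                    finite {x. f x \<noteq> \<zero>\<^bsub>R\<^esub>}},
      monoid.mult = (\<lambda>f g x. finsum R (\<lambda>(y, z). f y \<otimes>\<^bsub>R\<^esub> g z)
                       {(y, z). f y \<noteq> \<zero>\<^bsub>R\<^esub> \<and> g z \<noteq> \<zero>\<^bsub>R\<^esub> \<and> y \<otimes>\<^bsub>M\<^esub> z = x}),
      one = (\<lambda>x. if x = \<one>\<^bsub>M\<^esub> then \<one>\<^bsub>R\<^esub> else \<zero>\<^bsub>R\<^esub>),
      ring.zero = (\<lambda>x. \<zero>\<^bsub>R\<^esub>),
      add = (\<lambda>f g x. f x \<oplus>\<^bsub>R\<^esub> g x)\<rparr>"

text \<open>The tensor product of two commutative algebras \<open>f : Z \<rightarrow> A\<close> and \<open>g : Z \<rightarrow> B\<close> is the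
  free abelian group on \<open>A \<times> B\<close> modulo the bilinearity and balancing relations, with
  \<open>(a \<otimes> b)(a' \<otimes> b') = aa' \<otimes> bb'\<close>.  The free abelian group with this product is the monoid ring of
  the multiplicative monoid \<open>A \<times> B\<close> over the integers, and the subgroup generated by the
  relations is stable under multiplication by basis elements, so it equals the ideal they generate.\<close>

abbreviation tensor_free ::
  "('a, 'x) ring_scheme \<Rightarrow> ('b, 'y) ring_scheme \<Rightarrow> ('a \<times> 'b \<Rightarrow> int) ring" where
  "tensor_free A B \<equiv> monoid_ring int_ring (A \<times>\<times> B)"

definition tensor_delta :: "'a \<Rightarrow> 'b \<Rightarrow> 'a \<times> 'b \<Rightarrow> int" where
  "tensor_delta a b = (\<lambda>y. if y = (a, b) then 1 else 0)"

definition tensor_ideal :: "('z, 'w) ring_scheme \<Rightarrow> ('z \<Rightarrow> 'a) \<Rightarrow> ('a, 'x) ring_scheme \<Rightarrow>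
    ('z \<Rightarrow> 'b) \<Rightarrow> ('b, 'y) ring_scheme \<Rightarrow> ('a \<times> 'b \<Rightarrow> int) set" where
  "tensor_ideal Z f A g B = genideal (tensor_free A B)
     ({tensor_delta (a \<oplus>\<^bsub>A\<^esub> a') b
         \<ominus>\<^bsub>tensor_free A B\<^esub> (tensor_delta a b \<oplus>\<^bsub>tensor_free A B\<^esub> tensor_delta a' b)
         | a a' b. a \<in> carrier A \<and> a' \<in> carrier A \<and> b \<in> carrier B} \<union>
      {tensor_delta a (b \<oplus>\<^bsub>B\<^esub> b')
         \<ominus>\<^bsub>tensor_free A B\<^esub> (tensor_delta a b \<oplus>\<^bsub>tensor_free A B\<^esub> tensor_delta a b')
         | a b b'. a \<in> carrier A \<and> b \<in> carrier B \<and> b' \<in> carrier B} \<union>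
      {tensor_delta (f z \<otimes>\<^bsub>A\<^esub> a) b \<ominus>\<^bsub>tensor_free A B\<^esub> tensor_delta a (g z \<otimes>\<^bsub>B\<^esub> b)
         | z a b. z \<in> carrier Z \<and> a \<in> carrier A \<and> b \<in> carrier B})"

definition tensor_alg :: "('z, 'w) ring_scheme \<Rightarrow> ('z \<Rightarrow> 'a) \<Rightarrow> ('a, 'x) ring_scheme \<Rightarrow>
    ('z \<Rightarrow> 'b) \<Rightarrow> ('b, 'y) ring_scheme \<Rightarrow> ('a \<times> 'b \<Rightarrow> int) set ring" where
  "tensor_alg Z f A g B = tensor_free A B Quot tensor_ideal Z f A g B"

definition pure_tensor :: "('z, 'w) ring_scheme \<Rightarrow> ('z \<Rightarrow> 'a) \<Rightarrow> ('a, 'x) ring_scheme \<Rightarrow>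
    ('z \<Rightarrow> 'b) \<Rightarrow> ('b, 'y) ring_scheme \<Rightarrow> 'a \<Rightarrow> 'b \<Rightarrow> ('a \<times> 'b \<Rightarrow> int) set" where
  "pure_tensor Z f A g B a b = tensor_ideal Z f A g B +>\<^bsub>tensor_free A B\<^esub> tensor_delta a b"

text \<open>The endomorphism \<open>\<phi> \<otimes> \<psi>\<close>.\<close>

definition tensor_endo :: "('z, 'w) ring_scheme \<Rightarrow> ('z \<Rightarrow> 'a) \<Rightarrow> ('a, 'x) ring_scheme \<Rightarrow>
    ('z \<Rightarrow> 'b) \<Rightarrow> ('b, 'y) ring_scheme \<Rightarrow> ('a \<Rightarrow> 'a) \<Rightarrow> ('b \<Rightarrow> 'b) \<Rightarrow>
    ('a \<times> 'b \<Rightarrow> int) set \<Rightarrow> ('a \<times> 'b \<Rightarrow> int) set" where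
  "tensor_endo Z f A g B \<phi> \<psi> = (let T = tensor_alg Z f A g B; t = pure_tensor Z f A g B in
     (THE h. h \<in> Ring.ring_hom T T \<and> h \<in> extensional (carrier T) \<and>
        (\<forall>a\<in>carrier A. \<forall>b\<in>carrier B. h (t a b) = t (\<phi> a) (\<psi> b))))"

definition finitely_many_orthogonal_idempotents :: "('a, 'b) ring_scheme \<Rightarrow> bool" where
  "finitely_many_orthogonal_idempotents A \<longleftrightarrow>
     (\<forall>E\<subseteq>carrier A. (\<forall>e\<in>E. e \<otimes>\<^bsub>A\<^esub> e = e) \<and> (\<forall>e\<in>E. \<forall>e'\<in>E. e \<noteq> e' \<longrightarrow> e \<otimes>\<^bsub>A\<^esub> e' = \<zero>\<^bsub>A\<^esub>)
        \<longrightarrow> finite E)"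


section \<open>The group \<open>SK\<^sub>1\<close> of a commutative ring\<close>

text \<open>Infinite matrices that agree with the identity matrix outside a finite square block.\<close>

definition stable_matrices :: "('a, 'b) ring_scheme \<Rightarrow> (nat \<Rightarrow> nat \<Rightarrow> 'a) monoid" where
  "stable_matrices A =
     \<lparr>carrier = {M. (\<forall>i j. M i j \<in> carrier A) \<and>
        (\<exists>n. \<forall>i j. i \<ge> n \<or> j \<ge> n \<longrightarrow> M i j = (if i = j then \<one>\<^bsub>A\<^esub> else \<zero>\<^bsub>A\<^esub>))},
      monoid.mult = (\<lambda>M N i j. finsum A (\<lambda>k. M i k \<otimes>\<^bsub>A\<^esub> N k j)
                       {k. M i k \<noteq> \<zero>\<^bsub>A\<^esub> \<and> N k j \<noteq> \<zero>\<^bsub>A\<^esub>}),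
      one = (\<lambda>i j. if i = j then \<one>\<^bsub>A\<^esub> else \<zero>\<^bsub>A\<^esub>)\<rparr>"

definition GL_stable :: "('a, 'b) ring_scheme \<Rightarrow> (nat \<Rightarrow> nat \<Rightarrow> 'a) monoid" where
  "GL_stable A = units_of (stable_matrices A)"

definition K1 :: "('a, 'b) ring_scheme \<Rightarrow> (nat \<Rightarrow> nat \<Rightarrow> 'a) set monoid" where
  "K1 A = GL_stable A Mod derived (GL_stable A) (carrier (GL_stable A))"

definition block_det :: "('a, 'b) ring_scheme \<Rightarrow> nat \<Rightarrow> (nat \<Rightarrow> nat \<Rightarrow> 'a) \<Rightarrow> 'a" where
  "block_det A n M = finsum A
     (\<lambda>\<pi>. let t = finprod A (\<lambda>i. M i (\<pi> i)) {..<n} in if evenperm \<pi> then t else \<ominus>\<^bsub>A\<^esub> t)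
     {\<pi>. \<pi> permutes {..<n}}"

definition stable_det :: "('a, 'b) ring_scheme \<Rightarrow> (nat \<Rightarrow> nat \<Rightarrow> 'a) \<Rightarrow> 'a" where
  "stable_det A M = (THE d. \<exists>n\<^sub>0. \<forall>n\<ge>n\<^sub>0. block_det A n M = d)"

definition SK1 :: "('a, 'b) ring_scheme \<Rightarrow> (nat \<Rightarrow> nat \<Rightarrow> 'a) set set" where
  "SK1 A = kernel (K1 A) (units_of A) (\<lambda>U. the_elem (stable_det A ` U))"


section \<open>Tate cohomology of a finite group\<close>

text \<open>Here \<open>A\<close> is an abelian group, written multiplicatively, and \<open>\<alpha> g a\<close> is the action of \<open>g\<close> on
  \<open>a\<close>.  The complete standard complex has in degree \<open>n \<ge> 0\<close> the functions \<open>G\<^sup>n \<rightarrow> A\<close>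
  (inhomogeneous cochains), and in degree \<open>- n - 1 < 0\<close> the functions \<open>G\<^sup>n \<rightarrow> A\<close> again, regarded as
  the bar chains \<open>\<Sum> c(g\<^sub>1,\<dots>,g\<^sub>n) [g\<^sub>1|\<dots>|g\<^sub>n]\<close>; the two halves are joined by the norm.\<close>

definition tuples :: "('g, 'm) monoid_scheme \<Rightarrow> nat \<Rightarrow> 'g list set" where
  "tuples G n = {gs. set gs \<subseteq> carrier G \<and> length gs = n}"

definition merge_at :: "('g, 'm) monoid_scheme \<Rightarrow> nat \<Rightarrow> 'g list \<Rightarrow> 'g list" where
  "merge_at G i gs = take i gs @ (gs ! i \<otimes>\<^bsub>G\<^esub> gs ! Suc i) # drop (i + 2) gs"

definition tate_cochains ::
  "('g, 'm) monoid_scheme \<Rightarrow> ('a, 'n) monoid_scheme \<Rightarrow> int \<Rightarrow> ('g list \<Rightarrow> 'a) monoid" where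
  "tate_cochains G A n =
     product_group (tuples G (if 0 \<le> n then nat n else nat (- n - 1))) (\<lambda>_. A)"

definition bar_coboundary :: "('g, 'm) monoid_scheme \<Rightarrow> ('g \<Rightarrow> 'a \<Rightarrow> 'a) \<Rightarrow>
    ('a, 'n) monoid_scheme \<Rightarrow> nat \<Rightarrow> ('g list \<Rightarrow> 'a) \<Rightarrow> 'g list \<Rightarrow> 'a" where
  "bar_coboundary G \<alpha> A n f = (\<lambda>gs\<in>tuples G (Suc n).
     \<alpha> (hd gs) (f (tl gs))
     \<otimes>\<^bsub>A\<^esub> finprod A (\<lambda>i. f (merge_at G i gs) [^]\<^bsub>A\<^esub> ((-1) ^ Suc i :: int)) {..<n}
     \<otimes>\<^bsub>A\<^esub> f (butlast gs) [^]\<^bsub>A\<^esub> ((-1) ^ Suc n :: int))"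

definition norm_map :: "('g, 'm) monoid_scheme \<Rightarrow> ('g \<Rightarrow> 'a \<Rightarrow> 'a) \<Rightarrow>
    ('a, 'n) monoid_scheme \<Rightarrow> ('g list \<Rightarrow> 'a) \<Rightarrow> 'g list \<Rightarrow> 'a" where
  "norm_map G \<alpha> A f = (\<lambda>gs\<in>tuples G 0. finprod A (\<lambda>g. \<alpha> g (f gs)) (carrier G))"

text \<open>The boundary from bar chains of degree \<open>Suc m\<close> to those of degree \<open>m\<close>; the first face of
  \<open>a [g\<^sub>1|\<dots>]\<close> is \<open>g\<^sub>1\<inverse>a [g\<^sub>2|\<dots>]\<close>, as \<open>A\<close> is turned into a right module by \<open>a \<cdot> g = g\<inverse>a\<close>.\<close>

definition bar_boundary :: "('g, 'm) monoid_scheme \<Rightarrow> ('g \<Rightarrow> 'a \<Rightarrow> 'a) \<Rightarrow>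
    ('a, 'n) monoid_scheme \<Rightarrow> nat \<Rightarrow> ('g list \<Rightarrow> 'a) \<Rightarrow> 'g list \<Rightarrow> 'a" where
  "bar_boundary G \<alpha> A m c = (\<lambda>hs\<in>tuples G m. finprod A (\<lambda>gs.
     (if tl gs = hs then \<alpha> (inv\<^bsub>G\<^esub> (hd gs)) (c gs) else \<one>\<^bsub>A\<^esub>)
     \<otimes>\<^bsub>A\<^esub> finprod A (\<lambda>i. if merge_at G i gs = hs
                      then c gs [^]\<^bsub>A\<^esub> ((-1) ^ Suc i :: int) else \<one>\<^bsub>A\<^esub>) {..<m}
     \<otimes>\<^bsub>A\<^esub> (if butlast gs = hs then c gs [^]\<^bsub>A\<^esub> ((-1) ^ Suc m :: int) else \<one>\<^bsub>A\<^esub>))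
     (tuples G (Suc m)))"

definition tate_diff :: "('g, 'm) monoid_scheme \<Rightarrow> ('g \<Rightarrow> 'a \<Rightarrow> 'a) \<Rightarrow>
    ('a, 'n) monoid_scheme \<Rightarrow> int \<Rightarrow> ('g list \<Rightarrow> 'a) \<Rightarrow> 'g list \<Rightarrow> 'a" where
  "tate_diff G \<alpha> A n =
     (if 0 \<le> n then bar_coboundary G \<alpha> A (nat n)
      else if n = -1 then norm_map G \<alpha> A
      else bar_boundary G \<alpha> A (nat (- n - 2)))"

definition tate_cohomology :: "('g, 'm) monoid_scheme \<Rightarrow> ('g \<Rightarrow> 'a \<Rightarrow> 'a) \<Rightarrow>
    ('a, 'n) monoid_scheme \<Rightarrow> int \<Rightarrow> ('g list \<Rightarrow> 'a) set monoid" where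
  "tate_cohomology G \<alpha> A n =
     (tate_cochains G A n)
       \<lparr>carrier := kernel (tate_cochains G A n) (tate_cochains G A (n + 1)) (tate_diff G \<alpha> A n)\<rparr>
     Mod (tate_diff G \<alpha> A (n - 1) ` carrier (tate_cochains G A (n - 1)))"

definition cohomologically_trivial ::
  "('g, 'm) monoid_scheme \<Rightarrow> ('g \<Rightarrow> 'a \<Rightarrow> 'a) \<Rightarrow> ('a, 'n) monoid_scheme \<Rightarrow> bool" where
  "cohomologically_trivial G \<alpha> A \<longleftrightarrow>
     (\<forall>H. subgroup H G \<longrightarrow> (\<forall>n. trivial_group (tate_cohomology (G\<lparr>carrier := H\<rparr>) \<alpha> A n)))"


section \<open>The \<open>p\<close>-adic numbers and their unramified extensions\<close>

type_synonym zp = "nat \<Rightarrow> int set"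
type_synonym qp = "(zp \<times> zp) set"
type_synonym qpc = "(qp list \<times> nat) multiset \<Rightarrow> qp"

definition Zp :: "nat \<Rightarrow> zp ring" where
  "Zp p = adic_completion int_ring (int p)"

definition Qp :: "nat \<Rightarrow> qp ring" where
  "Qp p = frac_field (Zp p)"

text \<open>Every finite extension of \<open>Q\<^sub>p\<close> is isomorphic to a subfield of this algebraic closure.\<close>

definition Qpc :: "nat \<Rightarrow> qpc ring" where
  "Qpc p = field.alg_closure (Qp p)"

definition Qp_in_Qpc :: "nat \<Rightarrow> qpc set" where
  "Qp_in_Qpc p = ring.indexed_const (Qp p) ` carrier (Qp p)"

definition Zp_to_Qpc :: "nat \<Rightarrow> zp \<Rightarrow> qpc" where
  "Zp_to_Qpc p z = ring.indexed_const (Qp p) (frac_rel (Zp p) `` {(z, \<one>\<^bsub>Zp p\<^esub>)})"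

definition val_ring :: "nat \<Rightarrow> qpc set \<Rightarrow> qpc ring" where
  "val_ring p L = (Qpc p)\<lparr>carrier := {x \<in> L. integral_in (Qpc p) (Zp_to_Qpc p ` carrier (Zp p)) x}\<rparr>"

definition p_ideal :: "nat \<Rightarrow> qpc set \<Rightarrow> qpc set" where
  "p_ideal p L = PIdl\<^bsub>val_ring p L\<^esub> (add_pow (val_ring p L) p \<one>\<^bsub>val_ring p L\<^esub>)"

text \<open>Residue fields are finite, so \<open>L\<close> is unramified precisely if \<open>p\<close> generates the maximal ideal
  of its valuation ring.\<close>

definition finite_unramified_ext :: "nat \<Rightarrow> qpc set \<Rightarrow> bool" where
  "finite_unramified_ext p L \<longleftrightarrow>
     subfield L (Qpc p) \<and> Qp_in_Qpc p \<subseteq> L \<and> ring.finite_dimension (Qpc p) (Qp_in_Qpc p) L \<and>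
     maximalideal (p_ideal p L) (val_ring p L)"

definition Gal_Qp :: "nat \<Rightarrow> qpc set \<Rightarrow> (qpc \<Rightarrow> qpc) monoid" where
  "Gal_Qp p L = (BijGroup L)
     \<lparr>carrier := {\<sigma> \<in> Bij L. \<sigma> \<in> Ring.ring_hom ((Qpc p)\<lparr>carrier := L\<rparr>) ((Qpc p)\<lparr>carrier := L\<rparr>) \<and>
                         (\<forall>x\<in>Qp_in_Qpc p. \<sigma> x = x)}\<rparr>"

definition Frob :: "nat \<Rightarrow> qpc set \<Rightarrow> qpc \<Rightarrow> qpc" where
  "Frob p L = (THE \<sigma>. \<sigma> \<in> carrier (Gal_Qp p L) \<and>
     (\<forall>x\<in>carrier (val_ring p L). \<sigma> x \<ominus>\<^bsub>Qpc p\<^esub> x [^]\<^bsub>Qpc p\<^esub> p \<in> p_ideal p L))"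


section \<open>The coefficient ring\<close>

text \<open>The coefficient ring is a type \<open>'r\<close>; its field of fractions \<open>N\<close> is \<open>'r fract\<close> and \<open>N\<^sup>c\<close> is
  \<open>'r fract alg_closure\<close>.\<close>

abbreviation coeff_ring :: "'r::comm_ring_1 ring" where
  "coeff_ring \<equiv> ring_of_type_algebra"

definition to_Nc :: "'r::idom \<Rightarrow> 'r fract alg_closure" where
  "to_Nc r = to_ac (to_fract r)"

definition normal_domain :: "'r::idom itself \<Rightarrow> bool" where
  "normal_domain _ \<longleftrightarrow> (\<forall>x::'r fract. integral_over (range to_fract) x \<longrightarrow> x \<in> range to_fract)"

text \<open>The structure map of a \<open>p\<close>-adically complete ring as an algebra over the \<open>p\<close>-adic integers.\<close>

definition Zp_to :: "nat \<Rightarrow> zp \<Rightarrow> 'r::comm_ring_1" where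
  "Zp_to p z = (THE r. \<forall>n. \<forall>m\<in>z n. of_nat p ^ n dvd r - of_int m)"

definition lift_of_Frobenius :: "nat \<Rightarrow> ('r::comm_ring_1 \<Rightarrow> 'r) \<Rightarrow> bool" where
  "lift_of_Frobenius p F \<longleftrightarrow>
     F \<in> Ring.ring_hom coeff_ring coeff_ring \<and>
     (\<forall>z\<in>carrier (Zp p). F (Zp_to p z) = Zp_to p z) \<and>
     (\<forall>r. of_nat p dvd F r - r ^ p)"

text \<open>Torsion freeness of the \<open>p\<close>-adic module \<open>R/(1-F)R\<close>.\<close>

definition coinvariants_torsion_free :: "nat \<Rightarrow> ('r::comm_ring_1 \<Rightarrow> 'r) \<Rightarrow> bool" where
  "coinvariants_torsion_free p F \<longleftrightarrow>
     (\<forall>z\<in>carrier (Zp p). z \<noteq> \<zero>\<^bsub>Zp p\<^esub> \<longrightarrow>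
        (\<forall>r. Zp_to p z * r \<in> range (\<lambda>s. s - F s) \<longrightarrow> r \<in> range (\<lambda>s. s - F s)))"

text \<open>\<open>(R/pR) \<otimes> F\<^sub>p\<^sup>c\<close> over \<open>F\<^sub>p\<close>.\<close>

definition residue_ring_closure ::
  "nat \<Rightarrow> ('r::comm_ring_1 set \<times> ((int set list \<times> nat) multiset \<Rightarrow> int set) \<Rightarrow> int) set ring" where
  "residue_ring_closure p = (let I = PIdl\<^bsub>coeff_ring\<^esub> (of_nat p :: 'r) in
     tensor_alg (ZFact (int p))
       (\<lambda>U. \<Union>m\<in>U. I +>\<^bsub>coeff_ring\<^esub> of_int m) (coeff_ring Quot I)
       (ring.indexed_const (ZFact (int p))) (field.alg_closure (ZFact (int p))))"

type_synonym 'r rext = "('r \<times> qpc \<Rightarrow> int) set"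

definition R_ext :: "nat \<Rightarrow> qpc set \<Rightarrow> 'r::comm_ring_1 rext ring" where
  "R_ext p L = tensor_alg (Zp p) (Zp_to p) coeff_ring (Zp_to_Qpc p) (val_ring p L)"

definition R_ext_endo ::
  "nat \<Rightarrow> qpc set \<Rightarrow> ('r \<Rightarrow> 'r) \<Rightarrow> (qpc \<Rightarrow> qpc) \<Rightarrow> 'r::comm_ring_1 rext \<Rightarrow> 'r rext" where
  "R_ext_endo p L \<phi> \<psi> =
     tensor_endo (Zp p) (Zp_to p) coeff_ring (Zp_to_Qpc p) (val_ring p L) \<phi> \<psi>"

definition M_units :: "nat \<Rightarrow> ('r::comm_ring_1 \<Rightarrow> 'r) \<Rightarrow> qpc set \<Rightarrow> 'r rext monoid" where
  "M_units p F L = (units_of (R_ext p L))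
     \<lparr>carrier := {u \<in> Units (R_ext p L). R_ext_endo p L F (Frob p L) u = u [^]\<^bsub>R_ext p L\<^esub> p}\<rparr>"

definition Lambda_units :: "nat \<Rightarrow> ('r::comm_ring_1 \<Rightarrow> 'r) \<Rightarrow> qpc set \<Rightarrow> 'r rext set monoid" where
  "Lambda_units p F L = units_of (R_ext p L) Mod carrier (M_units p F L)"

text \<open>An abelian group \<open>A\<close>, written multiplicatively, is a module over \<open>Z\<close>.  For \<open>Lambda_units\<close>
  a module structure over the \<open>p\<close>-adic integers is unique, since \<open>u \<mapsto> F(u)/u\<^sup>p\<close> embeds this group
  in the \<open>p\<close>-adically separated group of units congruent to \<open>1\<close> modulo \<open>p\<close>.\<close>

definition is_module_over :: "('z, 'w) ring_scheme \<Rightarrow> ('a, 'n) monoid_scheme \<Rightarrow> bool" where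
  "is_module_over Z A \<longleftrightarrow>
     (\<exists>s. module Z \<lparr>carrier = carrier A, monoid.mult = monoid.mult A, one = \<one>\<^bsub>A\<^esub>,
                     ring.zero = \<one>\<^bsub>A\<^esub>, add = monoid.mult A, module.smult = s\<rparr>)"

definition unit_cohomology_hyp :: "nat \<Rightarrow> ('r::comm_ring_1 \<Rightarrow> 'r) \<Rightarrow> bool" where
  "unit_cohomology_hyp p F \<longleftrightarrow> (\<forall>L. finite_unramified_ext p L \<longrightarrow>
     is_module_over (Zp p) (Lambda_units p F L) \<and>
     cohomologically_trivial (Gal_Qp p L) (\<lambda>\<sigma> U. R_ext_endo p L id \<sigma> ` U) (Lambda_units p F L) \<and>
     (\<forall>\<Gamma>. subgroup \<Gamma> (Gal_Qp p L) \<and> (\<exists>k. card \<Gamma> = p ^ k) \<longrightarrow>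
        trivial_group (tate_cohomology ((Gal_Qp p L)\<lparr>carrier := \<Gamma>\<rparr>)
          (R_ext_endo p L id) (M_units p F L) 1)))"


section \<open>The \<open>p\<close>-adic logarithm on \<open>N\<^sup>c\<close>\<close>

text \<open>\<open>N\<^sup>c\<close> carries the \<open>p\<close>-adic topology: the multiples by \<open>p\<^sup>k\<close> of the integral closure of the
  coefficient ring form a basis of neighbourhoods of zero.\<close>

definition padic_tendsto ::
  "nat \<Rightarrow> (nat \<Rightarrow> 'r::idom fract alg_closure) \<Rightarrow> 'r fract alg_closure \<Rightarrow> bool" where
  "padic_tendsto p s l \<longleftrightarrow>
     (\<forall>k. \<exists>m. \<forall>n\<ge>m. \<exists>y. integral_over (range to_Nc) y \<and> s n - l = of_nat p ^ k * y)"

definition padic_log :: "nat \<Rightarrow> 'r::idom fract alg_closure \<Rightarrow> 'r fract alg_closure" where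
  "padic_log p z =
     (THE l. padic_tendsto p (\<lambda>n. \<Sum>i=1..n. (-1) ^ (i + 1) / of_nat i * (z - 1) ^ i) l)"


section \<open>Representations, determinants and the group logarithm\<close>

definition representation :: "('g, 'm) monoid_scheme \<Rightarrow> nat \<Rightarrow> ('g \<Rightarrow> 'k::field mat) \<Rightarrow> bool" where
  "representation G n T \<longleftrightarrow>
     (\<forall>g\<in>carrier G. T g \<in> carrier_mat n n) \<and> T \<one>\<^bsub>G\<^esub> = 1\<^sub>m n \<and>
     (\<forall>g\<in>carrier G. \<forall>h\<in>carrier G. T (g \<otimes>\<^bsub>G\<^esub> h) = T g * T h)"

definition char_of :: "('g, 'm) monoid_scheme \<Rightarrow> nat \<Rightarrow> ('g \<Rightarrow> 'k::field mat) \<Rightarrow> 'g \<Rightarrow> 'k" where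
  "char_of G n T g = (if g \<in> carrier G then \<Sum>i<n. T g $$ (i, i) else 0)"

definition characters :: "('g, 'm) monoid_scheme \<Rightarrow> ('g \<Rightarrow> 'k::field) set" where
  "characters G = {char_of G n T | n T. representation G n T}"

definition virtual_characters :: "('g, 'm) monoid_scheme \<Rightarrow> ('g \<Rightarrow> 'k::field) set" where
  "virtual_characters G = {(\<lambda>g. \<chi> g - \<chi>' g) | \<chi> \<chi>'. \<chi> \<in> characters G \<and> \<chi>' \<in> characters G}"

definition rep_ext ::
  "('g, 'm) monoid_scheme \<Rightarrow> nat \<Rightarrow> ('g \<Rightarrow> 'r::idom fract alg_closure mat) \<Rightarrow> ('g \<Rightarrow> 'r) \<Rightarrow>
   'r fract alg_closure mat" where
  "rep_ext G n T x = mat n n (\<lambda>(i, j). \<Sum>g\<in>carrier G. to_Nc (x g) * T g $$ (i, j))"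

text \<open>On a character \<open>\<chi>\<close> of \<open>T\<close> this is \<open>det (T x)\<close>; it is extended multiplicatively to
  virtual characters.\<close>

definition Det :: "('g, 'm) monoid_scheme \<Rightarrow> ('g \<Rightarrow> 'r::idom) \<Rightarrow>
    ('g \<Rightarrow> 'r fract alg_closure) \<Rightarrow> 'r fract alg_closure" where
  "Det G x = (\<lambda>\<chi>\<in>virtual_characters G.
     (THE d. \<exists>n T n' T'. representation G n T \<and> representation G n' T' \<and>
        \<chi> = (\<lambda>g. char_of G n T g - char_of G n' T' g) \<and>
        d = det (rep_ext G n T x) / det (rep_ext G n' T' x)))"

definition adams :: "nat \<Rightarrow> ('g, 'm) monoid_scheme \<Rightarrow> ('g \<Rightarrow> 'k::zero) \<Rightarrow> 'g \<Rightarrow> 'k" where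
  "adams p G \<chi> g = (if g \<in> carrier G then \<chi> (g [^]\<^bsub>G\<^esub> p) else 0)"

definition adams_Det :: "nat \<Rightarrow> ('g, 'm) monoid_scheme \<Rightarrow> (('g \<Rightarrow> 'k::field) \<Rightarrow> 'k) \<Rightarrow>
    ('g \<Rightarrow> 'k) \<Rightarrow> 'k" where
  "adams_Det p G f = (\<lambda>\<chi>\<in>virtual_characters G. f (adams p G \<chi>))"

text \<open>\<open>\<Psi>(Det(x)) = \<psi>\<^sup>p Det(F(x))\<close>, as a function of \<open>Det(x)\<close>; the map \<open>F\<close> acts on the
  coefficients of \<open>x\<close>.\<close>

definition Psi :: "nat \<Rightarrow> ('r::idom \<Rightarrow> 'r) \<Rightarrow> ('g, 'm) monoid_scheme \<Rightarrow>
    (('g \<Rightarrow> 'r fract alg_closure) \<Rightarrow> 'r fract alg_closure) \<Rightarrow>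
    ('g \<Rightarrow> 'r fract alg_closure) \<Rightarrow> 'r fract alg_closure" where
  "Psi p F G f = (THE h. \<exists>x\<in>Units (monoid_ring coeff_ring G).
     f = Det G x \<and> h = adams_Det p G (Det G (\<lambda>g. F (x g))))"

definition conj_class :: "('g, 'm) monoid_scheme \<Rightarrow> 'g \<Rightarrow> 'g set" where
  "conj_class G g = {h \<otimes>\<^bsub>G\<^esub> g \<otimes>\<^bsub>G\<^esub> inv\<^bsub>G\<^esub> h | h. h \<in> carrier G}"

definition conj_classes :: "('g, 'm) monoid_scheme \<Rightarrow> 'g set set" where
  "conj_classes G = conj_class G ` carrier G"

text \<open>The elements of \<open>N\<^sup>c[C]\<close> with all coefficients in \<open>S\<close>, for a finite set \<open>C\<close>.\<close>

definition class_module :: "'k::zero set \<Rightarrow> 'c set \<Rightarrow> ('c \<Rightarrow> 'k) set" where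
  "class_module S C = {v. (\<forall>c\<in>C. v c \<in> S) \<and> (\<forall>c. c \<notin> C \<longrightarrow> v c = 0)}"

definition char_ext :: "('g, 'm) monoid_scheme \<Rightarrow> ('g \<Rightarrow> 'k::field) \<Rightarrow> ('g set \<Rightarrow> 'k) \<Rightarrow> 'k" where
  "char_ext G \<chi> v = (\<Sum>c\<in>conj_classes G. v c * the_elem (\<chi> ` c))"

definition upsilon :: "nat \<Rightarrow> ('r::idom \<Rightarrow> 'r) \<Rightarrow> ('g, 'm) monoid_scheme \<Rightarrow>
    (('g \<Rightarrow> 'r fract alg_closure) \<Rightarrow> 'r fract alg_closure) \<Rightarrow> 'g set \<Rightarrow> 'r fract alg_closure" where
  "upsilon p F G f = (THE v. v \<in> class_module UNIV (conj_classes G) \<and>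
     (\<forall>\<chi>\<in>characters G. char_ext G \<chi> v = padic_log p (f \<chi> ^ p / Psi p F G f \<chi>)))"

end

theory Submission
  imports Defs "Jordan_Normal_Form.Char_Poly" "HOL-Library.Function_Algebras" "HOL-Number_Theory.Cong"
begin

text \<open>Fix a unit \<open>x\<close> of \<open>R[G]\<close> and put \<open>y = 1 - x\<close>.  The values of the group logarithm on characters are
  \<open>p\<close>-adic logarithms of determinants, from which the divisibility by \<open>p\<close> of each class component
  cannot be read off.  The proof replaces \<open>x\<close> by the family \<open>1 - t y\<close> over \<open>R[[t]]\<close>, which is \<open>x\<close> at
  \<open>t = 1\<close>, and extends \<open>F\<close> by \<open>t \<mapsto> t\<^sup>p\<close>.  Over \<open>R[[t]]\<close> all logarithms are formal and all
  class components can be computed; it then remains to evaluate at \<open>t = 1\<close>.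

  \<^emph>\<open>Counting words.\<close>  Let \<open>\<Phi>\<close> apply \<open>F\<close> to coefficients, raise group elements to the \<open>p\<close>-th
  power and send \<open>t\<close> to \<open>t\<^sup>p\<close>, and let \<open>[z]\<close> be the image of \<open>z\<close> in \<open>R[C\<^sub>G]\<close>.  The power
  \<open>y\<^sup>N\<close> is a weighted sum over the words of length \<open>N\<close> in \<open>G\<close>, and neither the weight of a word nor
  the class of its product changes under rotation.  If \<open>N = p\<^sup>k m\<close>, \<open>k > 0\<close> and \<open>p\<close> does not divide
  \<open>m\<close>, then rotation by \<open>m\<close> permutes the words in orbits of length \<open>p\<^sup>k\<close>, apart from the words that
  are \<open>p\<close>-th powers of words of length \<open>N/p\<close>.  Together with the congruence for \<open>F\<close> this yields
  \<open>[y\<^sup>N] \<equiv> \<Phi>[y\<^bsup>N/p\<^esup>]\<close> modulo \<open>p\<^sup>k\<close> (lemma \<open>power_sum_congruence\<close>).  Therefore the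
  class components \<open>V\<^sub>c\<close> of \<open>p log (1 - t y) - \<Phi> (log (1 - t y))\<close> have coefficients in \<open>pR\<close>
  (lemma \<open>class_series\<close>).

  \<^emph>\<open>Determinants.\<close>  For a representation \<open>T\<close> with character \<open>\<chi>\<close> the logarithm of
  \<open>det (1 - t T(y))\<close> is obtained by applying \<open>\<chi>\<close> to \<open>log (1 - t y)\<close> (lemma \<open>char_series\<close>).  Hence
  this determinant depends only on \<open>\<chi>\<close>, additively.  Because \<open>\<psi>\<^sup>p \<chi>\<close> is a virtual
  character (theorem \<open>adams_virtual\<close>), there is a series \<open>u\<^sub>\<chi>\<close> with value
  \<open>Det(x)(\<chi>)\<^sup>p / Det(F(x))(\<psi>\<^sup>p \<chi>)\<close> at \<open>t = 1\<close>, and its logarithm is the sum of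
  the \<open>\<chi>(c) V\<^sub>c\<close>.  Since \<open>p\<close> divides \<open>p\<^sup>i/i!\<close> for \<open>i > 0\<close>, the exponential shows that
  \<open>u\<^sub>\<chi>\<close> is congruent to 1 modulo \<open>p\<close> (lemma \<open>fps_log_divisible\<close>).

  \<^emph>\<open>Evaluation.\<close>  A power series need not have a value at \<open>t = 1\<close>.  The series \<open>u\<^sub>\<chi>\<close> are
  rational functions that have one (predicate \<open>rational_at_1\<close>): the denominators \<open>1 - \<lambda> t\<^sup>e\<close>
  involve the eigenvalues \<open>\<lambda>\<close> of \<open>y\<close> or of \<open>F(y)\<close>, which are roots of one monic polynomial \<open>q\<close> over
  \<open>R\<close> whose value \<open>q(1)\<close> is a unit, the determinant of \<open>x\<close> or of \<open>F(x)\<close> on \<open>R[G]\<close> (lemma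
  \<open>common_annihilator\<close>).  Logarithms of such series are \<open>p\<close>-adic limits of rational ones
  (predicate \<open>value_at_1\<close>), and evaluation turns the formal into the \<open>p\<close>-adic logarithm
  (lemma \<open>value_at_1_log\<close>).  A combination of characters with integral coefficients isolates a multiple
  of \<open>V\<^sub>c\<close> (lemma \<open>class_separation\<close>).  So \<open>V\<^sub>c/p\<close> is also a limit of rational series
  (lemma \<open>approx_divide\<close>); it has coefficients in \<open>R\<close>, and as \<open>R\<close> is normal and complete its value at
  \<open>t = 1\<close> lies in \<open>R\<close> (lemma \<open>value_at_1_descent\<close>).  The values of the \<open>V\<^sub>c\<close>, elements of \<open>pR\<close>,
  satisfy the equations that characterize the group logarithm of \<open>Det(x)\<close>.

  \<^emph>\<open>Dependence on the determinant.\<close>  That \<open>\<Psi>\<close> is a function of \<open>Det(x)\<close> is seen by extending \<open>F\<close> to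
  an endomorphism \<open>\<sigma>\<close> of \<open>N\<^sup>c\<close>.  A power \<open>\<sigma>\<^bsup>k+1\<^esup>\<close> fixes the values of all
  characters, and consequently \<open>Det(F(x))(\<chi>) = \<sigma>(Det(x)(\<sigma>\<^sup>k \<chi>))\<close>
  (lemma \<open>det_F_conjugate\<close>).\<close>

section \<open>Eigenvalues\<close>

definition mtrace :: "'k::comm_ring_1 mat \<Rightarrow> 'k" where
  "mtrace A = (\<Sum>i<dim_row A. A $$ (i, i))"

lemma mtrace_mult_comm:
  assumes "A \<in> carrier_mat n m" "B \<in> carrier_mat m n"
  shows "mtrace (A * B) = mtrace (B * A)"
proof -
  have "mtrace (A * B) = (\<Sum>i<n. \<Sum>j<m. A $$ (i, j) * B $$ (j, i))"
    using assms by (simp add: mtrace_def scalar_prod_def atLeast0LessThan)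
  also have "\<dots> = (\<Sum>j<m. \<Sum>i<n. B $$ (j, i) * A $$ (i, j))"
    by (subst sum.swap) (simp add: mult.commute)
  also have "\<dots> = mtrace (B * A)"
    using assms by (simp add: mtrace_def scalar_prod_def atLeast0LessThan)
  finally show ?thesis .
qed

lemma mtrace_similar:
  assumes "similar_mat_wit A B P Q"
  shows "mtrace A = mtrace B"
proof -
  define n where "n = dim_row A"
  note w = similar_mat_witD[OF n_def assms]
  have "mtrace A = mtrace (P * (B * Q))"
    using w by (simp add: assoc_mult_mat[of P n n B n Q n])
  also have "\<dots> = mtrace (B * Q * P)"
    using w by (intro mtrace_mult_comm) auto
  also have "B * Q * P = B"
    using w by (simp add: assoc_mult_mat[of B n n Q n P n])
  finally show ?thesis .
qed

lemma invertible_mat_with_first_col: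
  fixes v :: "'k::field vec"
  assumes v: "v \<in> carrier_vec (Suc n)" "v \<noteq> 0\<^sub>v (Suc n)"
  obtains W W' where "W \<in> carrier_mat (Suc n) (Suc n)" "W' \<in> carrier_mat (Suc n) (Suc n)"
    "W * W' = 1\<^sub>m (Suc n)" "W' * W = 1\<^sub>m (Suc n)" "col W 0 = v"
proof -
  obtain k where k: "k < Suc n" "v $ k \<noteq> 0"
    using v by (metis carrier_vecD eq_vecI index_zero_vec(1) index_zero_vec(2))
  \<comment> \<open>The columns are \<open>v\<close> and all unit vectors but the \<open>k\<close>-th one, where \<open>v\<^sub>k \<noteq> 0\<close>.\<close>
  define W where "W = mat (Suc n) (Suc n) (\<lambda>(i, j). if j = 0 then v $ i
    else if j = k then (if i = 0 then 1 else 0) else if i = j then 1 else 0)"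
  have W: "W \<in> carrier_mat (Suc n) (Suc n)" by (simp add: W_def)
  have "det W \<noteq> 0"
  proof
    assume "det W = 0"
    then obtain u where u: "u \<in> carrier_vec (Suc n)" "u \<noteq> 0\<^sub>v (Suc n)" "W *\<^sub>v u = 0\<^sub>v (Suc n)"
      using det_0_iff_vec_prod_zero_field[OF W] by blast
    have row: "(\<Sum>j<Suc n. W $$ (i, j) * u $ j) = 0" if "i < Suc n" for i
    proof -
      have "(W *\<^sub>v u) $ i = (\<Sum>j<Suc n. W $$ (i, j) * u $ j)"
        using that u(1) by (simp add: W_def scalar_prod_def atLeast0LessThan)
      thus ?thesis using u(3) that by simp
    qed
    have "(\<Sum>j<Suc n. W $$ (k, j) * u $ j) = (\<Sum>j<Suc n. if j = 0 then v $ k * u $ 0 else 0)"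
      using k by (intro sum.cong) (auto simp: W_def)
    hence u0: "u $ 0 = 0" using row[OF k(1)] k(2) by (simp add: sum.delta del: sum.lessThan_Suc)
    have "u $ j = 0" if j: "j < Suc n" "j \<noteq> 0" for j
    proof -
      define i where "i = (if j = k then 0 else j)"
      have "(\<Sum>l<Suc n. W $$ (i, l) * u $ l) = (\<Sum>l<Suc n. if l = j then u $ j else 0)"
        using j u0 k by (intro sum.cong) (auto simp: W_def i_def)
      thus ?thesis using row[of i] j k by (simp add: i_def sum.delta del: sum.lessThan_Suc)
    qed
    hence "u $ i = 0" if "i < Suc n" for i using u0 that by (cases "i = 0") auto
    hence "u = 0\<^sub>v (Suc n)" using u(1) by (intro eq_vecI) auto
    with u(2) show False by simp
  qed
  from det_non_zero_imp_unit[OF W this, unfolded Units_def, of "()"]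
  obtain W' where W': "W' \<in> carrier_mat (Suc n) (Suc n)" "W' * W = 1\<^sub>m (Suc n)" "W * W' = 1\<^sub>m (Suc n)"
    by (auto simp: ring_mat_def)
  moreover have "col W 0 = v" using v(1) by (intro eq_vecI) (auto simp: W_def)
  ultimately show thesis using that W by blast
qed

lemma block_triangular_pow:
  fixes A1 :: "'k::comm_ring_1 mat"
  assumes "A1 \<in> carrier_mat 1 1" "A2 \<in> carrier_mat 1 n" "A3 \<in> carrier_mat n n"
  shows "\<exists>U \<in> carrier_mat 1 n. four_block_mat A1 A2 (0\<^sub>m n 1) A3 ^\<^sub>m m =
           four_block_mat (A1 ^\<^sub>m m) U (0\<^sub>m n 1) (A3 ^\<^sub>m m)"
proof (induction m)
  case 0
  show ?case using assms by (intro bexI[of _ "0\<^sub>m 1 n"]) (auto intro!: eq_matI)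
next
  case (Suc m)
  then obtain U where U: "U \<in> carrier_mat 1 n"
    "four_block_mat A1 A2 (0\<^sub>m n 1) A3 ^\<^sub>m m = four_block_mat (A1 ^\<^sub>m m) U (0\<^sub>m n 1) (A3 ^\<^sub>m m)"
    by blast
  have "four_block_mat A1 A2 (0\<^sub>m n 1) A3 ^\<^sub>m Suc m =
     four_block_mat (A1 ^\<^sub>m m) U (0\<^sub>m n 1) (A3 ^\<^sub>m m) * four_block_mat A1 A2 (0\<^sub>m n 1) A3"
    by (simp only: U(2) pow_mat.simps)
  also have "\<dots> = four_block_mat (A1 ^\<^sub>m m * A1 + U * 0\<^sub>m n 1) (A1 ^\<^sub>m m * A2 + U * A3)
      (0\<^sub>m n 1 * A1 + (A3 ^\<^sub>m m) * 0\<^sub>m n 1) (0\<^sub>m n 1 * A2 + (A3 ^\<^sub>m m) * A3)"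
    using assms U(1)
    by (intro mult_four_block_mat[of _ 1 1 _ n _ n _ _ 1 _ n]) (auto simp: pow_carrier_mat)
  also have "U * 0\<^sub>m n 1 = 0\<^sub>m 1 1" using U(1) by simp
  also have "(A3 ^\<^sub>m m) * 0\<^sub>m n 1 = 0\<^sub>m n 1" using assms by (simp add: pow_carrier_mat)
  also have "0\<^sub>m n 1 * A1 = 0\<^sub>m n 1" using assms by simp
  also have "0\<^sub>m n 1 * A2 = 0\<^sub>m n n" using assms by simp
  also have "A1 ^\<^sub>m m * A1 + 0\<^sub>m 1 1 = A1 ^\<^sub>m Suc m"
    using right_add_zero_mat[OF mult_carrier_mat[OF pow_carrier_mat[OF assms(1)] assms(1)]]
    by (simp only: pow_mat.simps)
  also have "0\<^sub>m n n + A3 ^\<^sub>m m * A3 = A3 ^\<^sub>m Suc m"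
    using left_add_zero_mat[OF mult_carrier_mat[OF pow_carrier_mat[OF assms(3)] assms(3)]]
    by (simp only: pow_mat.simps)
  finally have *: "four_block_mat A1 A2 (0\<^sub>m n 1) A3 ^\<^sub>m Suc m =
     four_block_mat (A1 ^\<^sub>m Suc m) (A1 ^\<^sub>m m * A2 + U * A3) (0\<^sub>m n 1 + 0\<^sub>m n 1) (A3 ^\<^sub>m Suc m)" .
  have "A1 ^\<^sub>m m * A2 + U * A3 \<in> carrier_mat 1 n"
    using assms U(1) by (simp add: pow_carrier_mat)
  thus ?case using * by (auto intro!: bexI[of _ "A1 ^\<^sub>m m * A2 + U * A3"])
qed

text \<open>In a basis whose first vector is an eigenvector the matrix is block triangular, and powers of block
  triangular matrices have the powers of the diagonal blocks on the diagonal.  Hence the eigenvalues,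
  listed with multiplicities, also give the traces of all powers.\<close>

lemma eigenvalue_list:
  fixes A :: "'k::alg_closed_field mat"
  assumes "A \<in> carrier_mat n n"
  shows "\<exists>es. length es = n \<and> char_poly A = (\<Prod>e\<leftarrow>es. [:- e, 1:]) \<and>
           (\<forall>m. mtrace (A ^\<^sub>m m) = (\<Sum>e\<leftarrow>es. e ^ m))"
  using assms
proof (induction n arbitrary: A)
  case 0
  hence "char_poly A = 1"
    using degree_monic_char_poly[OF 0] by (metis degree_eq_zeroE lead_coeff_pCons(2) one_pCons pCons_0_0 degree_0)
  moreover have "mtrace (A ^\<^sub>m m) = 0" for m
  proof -
    have "dim_row A = 0" using 0 by auto
    thus ?thesis by (simp add: mtrace_def)
  qed
  ultimately show ?case by (intro exI[of _ "[]"]) auto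
next
  case (Suc n A)
  note A = Suc.prems
  have "Polynomial.degree (char_poly A) > 0" using degree_monic_char_poly[OF A] by simp
  then obtain e where "poly (char_poly A) e = 0" using alg_closed_imp_poly_has_root by blast
  hence "eigenvalue A e" using eigenvalue_root_char_poly[OF A] by simp
  then obtain v where v: "v \<in> carrier_vec (Suc n)" "v \<noteq> 0\<^sub>v (Suc n)" "A *\<^sub>v v = e \<cdot>\<^sub>v v"
    using A by (auto simp: eigenvalue_def eigenvector_def)
  obtain W W' where W: "W \<in> carrier_mat (Suc n) (Suc n)" "W' \<in> carrier_mat (Suc n) (Suc n)"
    "W * W' = 1\<^sub>m (Suc n)" "W' * W = 1\<^sub>m (Suc n)" "col W 0 = v"
    using invertible_mat_with_first_col[OF v(1,2)] by blast
  define B where "B = W' * A * W"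
  have B: "B \<in> carrier_mat (Suc n) (Suc n)" using W A by (simp add: B_def)
  have simBA: "similar_mat_wit B A W' W"
    by (rule similar_mat_witI[OF W(4,3) _ B A W(2,1)]) (simp add: B_def)
  have colB: "B $$ (i, 0) = (if i = 0 then e else 0)" if "i < Suc n" for i
  proof -
    have "col B 0 = W' * A *\<^sub>v col W 0"
      unfolding B_def using W A by (intro col_mult2[of _ "Suc n" "Suc n" _ "Suc n"]) auto
    also have "\<dots> = W' *\<^sub>v (A *\<^sub>v v)"
      using W A v by (simp add: assoc_mult_mat_vec[of W' "Suc n" "Suc n" A "Suc n"])
    also have "\<dots> = e \<cdot>\<^sub>v (W' *\<^sub>v v)"
      using W v by (simp add: mult_mat_vec[of W' "Suc n" "Suc n"])
    also have "W' *\<^sub>v v = col (W' * W) 0"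
      using W by (subst col_mult2[of _ "Suc n" "Suc n" _ "Suc n"]) auto
    also have "\<dots> = col (1\<^sub>m (Suc n)) 0" by (simp add: W)
    finally have "col B 0 $ i = (e \<cdot>\<^sub>v col (1\<^sub>m (Suc n)) 0) $ i" by simp
    thus ?thesis using that B by (auto simp: col_def)
  qed
  obtain A1 A2 A0 A3 where split: "split_block B 1 1 = (A1, A2, A0, A3)"
    by (cases "split_block B 1 1") auto
  have "dim_row B = 1 + n" "dim_col B = 1 + n" using B by auto
  note blk = split_block[OF split this]
  have A1: "A1 = mat 1 1 (\<lambda>_. e)"
    using split colB[of 0] B by (auto simp: split_block_def Let_def)
  have A0: "A0 = 0\<^sub>m n 1"
    using split colB B by (auto simp: split_block_def Let_def intro!: eq_matI)
  have Bb: "B = four_block_mat A1 A2 (0\<^sub>m n 1) A3" using blk(5) A0 by simp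
  obtain es where es: "length es = n" "char_poly A3 = (\<Prod>e\<leftarrow>es. [:- e, 1:])"
    "\<And>m. mtrace (A3 ^\<^sub>m m) = (\<Sum>e\<leftarrow>es. e ^ m)"
    using Suc.IH[OF blk(4)] by blast
  have "char_poly A = char_poly B"
    using char_poly_similar simBA similar_mat_def by metis
  also have "\<dots> = char_poly A1 * char_poly A3"
    unfolding Bb by (rule char_poly_four_block_zeros_col[OF blk(1,2,4)])
  also have "char_poly A1 = [:- e, 1:]"
    by (simp add: A1 char_poly_defs det_def sign_def)
  finally have cp: "char_poly A = (\<Prod>e\<leftarrow>e # es. [:- e, 1:])" by (simp add: es(2))
  have A1pow: "A1 ^\<^sub>m m = mat 1 1 (\<lambda>_. e ^ m)" for m
    by (induction m) (auto simp: A1 scalar_prod_def intro!: eq_matI)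
  have "mtrace (A ^\<^sub>m m) = (\<Sum>e\<leftarrow>e # es. e ^ m)" for m
  proof -
    obtain U where U: "U \<in> carrier_mat 1 n"
      "B ^\<^sub>m m = four_block_mat (A1 ^\<^sub>m m) U (0\<^sub>m n 1) (A3 ^\<^sub>m m)"
      using block_triangular_pow[OF blk(1,2,4), of m] unfolding Bb by blast
    have c3: "A3 ^\<^sub>m m \<in> carrier_mat n n" using blk(4) by (rule pow_carrier_mat)
    have "mtrace (A ^\<^sub>m m) = mtrace (B ^\<^sub>m m)"
      using mtrace_similar[OF similar_mat_wit_pow[OF simBA]] by simp
    also have "\<dots> = e ^ m + mtrace (A3 ^\<^sub>m m)"
    proof -
      have "mtrace (B ^\<^sub>m m) = (\<Sum>i<Suc n. four_block_mat (mat 1 1 (\<lambda>_. e ^ m)) U (0\<^sub>m n 1) (A3 ^\<^sub>m m) $$ (i, i))"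
        using c3 unfolding U(2) mtrace_def A1pow by (intro sum.cong) auto
      also have "\<dots> = e ^ m + (\<Sum>i<n. (A3 ^\<^sub>m m) $$ (i, i))"
        unfolding sum.lessThan_Suc_shift using c3 carrier_matD[OF blk(4)] by (intro arg_cong2[where f = "(+)"] sum.cong) auto
      finally show ?thesis using carrier_matD[OF blk(4)] by (simp add: mtrace_def)
    qed
    finally show ?thesis by (simp add: es(3))
  qed
  with cp es(1) show ?case by (intro exI[of _ "e # es"]) auto
qed

section \<open>Representations with an arbitrary finite index set\<close>

text \<open>Rows and columns are indexed by any finite set, such as a set of words or the group itself; only the
  entries with indices in \<open>I\<close> are significant.\<close>

definition rep_on :: "('g, 'm) monoid_scheme \<Rightarrow> 'i set \<Rightarrow> ('g \<Rightarrow> 'i \<Rightarrow> 'i \<Rightarrow> 'k::field) \<Rightarrow> bool" where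
  "rep_on G I \<rho> \<longleftrightarrow> finite I \<and>
     (\<forall>i\<in>I. \<forall>j\<in>I. \<rho> \<one>\<^bsub>G\<^esub> i j = (if i = j then 1 else 0)) \<and>
     (\<forall>g\<in>carrier G. \<forall>h\<in>carrier G. \<forall>i\<in>I. \<forall>j\<in>I.
        \<rho> (g \<otimes>\<^bsub>G\<^esub> h) i j = (\<Sum>k\<in>I. \<rho> g i k * \<rho> h k j))"

lemma rep_on_imp_representation:
  fixes \<rho> :: "'g \<Rightarrow> 'i \<Rightarrow> 'i \<Rightarrow> 'k::field"
  assumes "rep_on G I \<rho>"
  shows "\<exists>n T. representation G n T \<and> (\<forall>g\<in>carrier G. char_of G n T g = (\<Sum>i\<in>I. \<rho> g i i))"
proof -
  have fin: "finite I" using assms by (simp add: rep_on_def)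
  define n where "n = card I"
  obtain f where f: "bij_betw f {..<n} I"
    using ex_bij_betw_nat_finite[OF fin] by (auto simp: n_def atLeast0LessThan)
  have fI: "f i \<in> I" if "i < n" for i using f that by (auto simp: bij_betw_def)
  have finj: "f i = f j \<longleftrightarrow> i = j" if "i < n" "j < n" for i j
    using f that by (auto simp: bij_betw_def inj_on_def)
  have fsum: "(\<Sum>k\<in>I. h k) = (\<Sum>k<n. h (f k))" for h :: "'i \<Rightarrow> 'k"
    by (rule sum.reindex_bij_betw[OF f, symmetric])
  define T where "T g = mat n n (\<lambda>(i, j). \<rho> g (f i) (f j))" for g
  have "representation G n T"
    unfolding representation_def
  proof (intro conjI ballI)
    show "T \<one>\<^bsub>G\<^esub> = 1\<^sub>m n"
      using assms fI finj by (intro eq_matI) (auto simp: T_def rep_on_def)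
    show "T (g \<otimes>\<^bsub>G\<^esub> h) = T g * T h" if "g \<in> carrier G" "h \<in> carrier G" for g h
      using assms fI that
      by (intro eq_matI) (auto simp: T_def rep_on_def scalar_prod_def fsum atLeast0LessThan)
  qed (simp add: T_def)
  moreover have "char_of G n T g = (\<Sum>i\<in>I. \<rho> g i i)" if "g \<in> carrier G" for g
    using that by (simp add: char_of_def T_def fsum)
  ultimately show ?thesis by blast
qed

lemma vector_space_functions: "vector_space (\<lambda>(c::'k::field) (f::'i \<Rightarrow> 'k) i. c * f i)"
  by unfold_locales (auto simp: fun_eq_iff algebra_simps plus_fun_def)

text \<open>An idempotent \<open>E\<close> is the identity on its image, which is spanned by the columns of \<open>E\<close>.  With a basis
  \<open>B\<close> of columns, \<open>E\<close> is the inclusion of the image after the coordinate map \<open>r\<close>, and the composition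
  in the other order is the identity of the image.\<close>

lemma idempotent_factorization:
  fixes E :: "'i \<Rightarrow> 'i \<Rightarrow> 'k::field"
  assumes fin: "finite I"
    and idem: "\<And>i j. i \<in> I \<Longrightarrow> j \<in> I \<Longrightarrow> (\<Sum>k\<in>I. E i k * E k j) = E i j"
  obtains B :: "('i \<Rightarrow> 'k) set" and r :: "('i \<Rightarrow> 'k) \<Rightarrow> 'i \<Rightarrow> 'k" where "finite B"
    "\<And>i j. i \<in> I \<Longrightarrow> j \<in> I \<Longrightarrow> E i j = (\<Sum>b\<in>B. b i * r b j)"
    "\<And>b b'. b \<in> B \<Longrightarrow> b' \<in> B \<Longrightarrow> (\<Sum>j\<in>I. r b j * b' j) = (if b = b' then 1 else 0)"
proof -
  interpret vs: vector_space "\<lambda>(c::'k) (f::'i \<Rightarrow> 'k) i. c * f i"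
    by (rule vector_space_functions)
  define cl where "cl j = (\<lambda>i. if i \<in> I then E i j else 0)" for j
  obtain B where B: "B \<subseteq> cl ` I" "vs.independent B" "cl ` I \<subseteq> vs.span B"
    using vs.maximal_independent_subset[of "cl ` I"] by blast
  have finB: "finite B" using B(1) fin finite_subset by blast
  define r where "r b j = vs.representation B (cl j) b" for b j
  have sumf: "(\<Sum>b\<in>S. (\<lambda>i. f b i)) i = (\<Sum>b\<in>S. f b i)" for S :: "('i \<Rightarrow> 'k) set" and f i
    by (induction S rule: infinite_finite_induct) (auto simp: plus_fun_def zero_fun_def)
  have expand: "cl j i = (\<Sum>b\<in>B. r b j * b i)" if "j \<in> I" for i j
  proof -
    have "cl j = (\<Sum>b\<in>B. (\<lambda>i. r b j * b i))"
      unfolding r_def using B that finB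
      by (subst vs.sum_representation_eq[where B = B and basis = B]) auto
    thus ?thesis by (simp add: sumf)
  qed
  have fixB: "(\<Sum>j\<in>I. E i j * b j) = b i" if "b \<in> B" "i \<in> I" for b i
  proof -
    obtain l where l: "l \<in> I" "b = cl l" using B(1) \<open>b \<in> B\<close> by auto
    have "(\<Sum>j\<in>I. E i j * b j) = (\<Sum>j\<in>I. E i j * E j l)"
      using l by (intro sum.cong) (auto simp: cl_def)
    thus ?thesis using idem[OF that(2) l(1)] l that by (simp add: cl_def)
  qed
  have dual: "(\<Sum>j\<in>I. r b j * b' j) = (if b = b' then 1 else 0)" if "b \<in> B" "b' \<in> B" for b b'
  proof -
    define c where "c a = (\<Sum>j\<in>I. r a j * b' j) - (if a = b' then 1 else 0)" for a
    have "(\<Sum>a\<in>B. (\<lambda>i. c a * a i)) = (\<lambda>_. 0)"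
    proof
      fix i
      have b'0: "a i = 0" if "a \<in> B" "i \<notin> I" for a using B(1) that by (auto simp: cl_def)
      have "(\<Sum>a\<in>B. (\<lambda>i. c a * a i)) i = (\<Sum>a\<in>B. c a * a i)" by (rule sumf)
      also have "\<dots> = 0"
      proof (cases "i \<in> I")
        case True
        have "(\<Sum>a\<in>B. c a * a i) = (\<Sum>a\<in>B. \<Sum>j\<in>I. r a j * b' j * a i) - (\<Sum>a\<in>B. (if a = b' then 1 else 0) * a i)"
          by (simp add: c_def left_diff_distrib sum_subtractf sum_distrib_right)
        also have "(\<Sum>a\<in>B. (if a = b' then 1 else 0) * a i) = b' i"
          using that finB by (simp add: if_distrib[of "\<lambda>x. x * _"] sum.delta cong: if_cong)
        also have "(\<Sum>a\<in>B. \<Sum>j\<in>I. r a j * b' j * a i) = (\<Sum>j\<in>I. (\<Sum>a\<in>B. r a j * a i) * b' j)"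
          by (subst sum.swap) (simp add: sum_distrib_left sum_distrib_right mult_ac)
        also have "\<dots> = (\<Sum>j\<in>I. E i j * b' j)"
          using expand True by (intro sum.cong) (auto simp flip: expand simp: cl_def)
        finally show ?thesis using fixB[OF that(2) True] by simp
      qed (simp add: b'0)
      finally show "(\<Sum>a\<in>B. (\<lambda>i. c a * a i)) i = 0" .
    qed
    hence "c b = 0"
      using B(2) finB that vs.independentD[of B B "c" b] by (auto simp: zero_fun_def)
    thus ?thesis by (simp add: c_def)
  qed
  show thesis
  proof (rule that[OF finB _ dual])
    show "E i j = (\<Sum>b\<in>B. b i * r b j)" if "i \<in> I" "j \<in> I" for i j
      using expand[OF that(2), of i] that by (simp add: cl_def mult.commute)
  qed
qed

text \<open>The image of an idempotent \<open>E\<close> that commutes with the action is a subrepresentation, on which the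
  trace of \<open>g\<close> is the trace of \<open>E \<rho>(g)\<close>.\<close>

lemma idempotent_rep:
  assumes "rep_on G I \<rho>"
    and idem: "\<And>i j. i \<in> I \<Longrightarrow> j \<in> I \<Longrightarrow> (\<Sum>k\<in>I. E i k * E k j) = E i j"
    and comm: "\<And>g i j. g \<in> carrier G \<Longrightarrow> i \<in> I \<Longrightarrow> j \<in> I \<Longrightarrow>
      (\<Sum>k\<in>I. E i k * \<rho> g k j) = (\<Sum>k\<in>I. \<rho> g i k * E k j)"
    and G: "monoid G"
  shows "\<exists>n T. representation G n T \<and>
           (\<forall>g\<in>carrier G. char_of G n T g = (\<Sum>i\<in>I. \<Sum>k\<in>I. E i k * \<rho> g k i))"
proof -
  interpret monoid G by (rule G)
  have fin: "finite I" using assms(1) by (simp add: rep_on_def)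
  obtain B r where B: "finite B"
    "\<And>i j. i \<in> I \<Longrightarrow> j \<in> I \<Longrightarrow> E i j = (\<Sum>b\<in>B. b i * r b j)"
    "\<And>b b'. b \<in> B \<Longrightarrow> b' \<in> B \<Longrightarrow> (\<Sum>j\<in>I. r b j * b' j) = (if b = b' then 1 else 0)"
    using idempotent_factorization[OF fin idem] by blast
  define \<tau> where "\<tau> g b b' = (\<Sum>i\<in>I. \<Sum>j\<in>I. r b i * \<rho> g i j * b' j)" for g b b'
  have Eb: "(\<Sum>j\<in>I. E i j * b j) = b i" if "b \<in> B" "i \<in> I" for b i
  proof -
    have "(\<Sum>j\<in>I. E i j * b j) = (\<Sum>j\<in>I. \<Sum>a\<in>B. a i * (r a j * b j))"
      using that by (intro sum.cong refl) (simp add: B(2) sum_distrib_right mult.assoc)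
    also have "\<dots> = (\<Sum>a\<in>B. a i * (\<Sum>j\<in>I. r a j * b j))"
      by (subst sum.swap) (simp add: sum_distrib_left)
    also have "\<dots> = (\<Sum>a\<in>B. if a = b then a i else 0)"
      using B(3) that by (intro sum.cong) auto
    finally show ?thesis using B(1) that by simp
  qed
  have one: "\<rho> \<one>\<^bsub>G\<^esub> i j = (if i = j then 1 else 0)" if "i \<in> I" "j \<in> I" for i j
    using assms(1) that by (simp add: rep_on_def)
  have mult: "\<rho> (g \<otimes>\<^bsub>G\<^esub> h) i j = (\<Sum>k\<in>I. \<rho> g i k * \<rho> h k j)"
    if "g \<in> carrier G" "h \<in> carrier G" "i \<in> I" "j \<in> I" for g h i j
    using assms(1) that by (simp add: rep_on_def)
  have "rep_on G B \<tau>"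
    unfolding rep_on_def
  proof (intro conjI ballI)
    show "finite B" by (rule B(1))
    fix b b' assume b: "b \<in> B" "b' \<in> B"
    have "\<tau> \<one>\<^bsub>G\<^esub> b b' = (\<Sum>i\<in>I. \<Sum>j\<in>I. if j = i then r b i * b' i else 0)"
      unfolding \<tau>_def using one by (intro sum.cong refl) auto
    also have "\<dots> = (\<Sum>i\<in>I. r b i * b' i)" using fin by simp
    finally show "\<tau> \<one>\<^bsub>G\<^esub> b b' = (if b = b' then 1 else 0)" using B(3) b by simp
    fix g h assume gh: "g \<in> carrier G" "h \<in> carrier G"
    have "(\<Sum>a\<in>B. \<tau> g b a * \<tau> h a b') =
        (\<Sum>a\<in>B. \<Sum>i\<in>I. \<Sum>k\<in>I. \<Sum>j\<in>I. \<Sum>l\<in>I. r b i * \<rho> g i j * (a j * r a k) * (\<rho> h k l * b' l))"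
      unfolding \<tau>_def sum_product
      by (intro sum.cong refl) (simp add: sum_distrib_left sum_distrib_right mult_ac)
    also have "\<dots> = (\<Sum>i\<in>I. \<Sum>k\<in>I. \<Sum>j\<in>I. \<Sum>l\<in>I. \<Sum>a\<in>B. r b i * \<rho> g i j * (a j * r a k) * (\<rho> h k l * b' l))"
      by (subst sum.swap, rule sum.cong[OF refl], subst sum.swap, rule sum.cong[OF refl],
          subst sum.swap, rule sum.cong[OF refl], subst sum.swap, rule refl)
    also have "\<dots> = (\<Sum>i\<in>I. \<Sum>k\<in>I. \<Sum>j\<in>I. \<Sum>l\<in>I. r b i * \<rho> g i j * E j k * (\<rho> h k l * b' l))"
      using B(2) by (intro sum.cong refl) (simp add: sum_distrib_left sum_distrib_right)
    also have "\<dots> = (\<Sum>i\<in>I. \<Sum>j\<in>I. \<Sum>k\<in>I. \<Sum>l\<in>I. r b i * \<rho> g i j * E j k * (\<rho> h k l * b' l))"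
      by (intro sum.cong refl sum.swap)
    also have "\<dots> = (\<Sum>i\<in>I. \<Sum>j\<in>I. \<Sum>l\<in>I. r b i * \<rho> g i j * (\<Sum>k\<in>I. E j k * \<rho> h k l) * b' l)"
      by (rule sum.cong[OF refl], rule sum.cong[OF refl], rule trans[OF sum.swap])
         (simp add: sum_distrib_left sum_distrib_right mult_ac)
    also have "\<dots> = (\<Sum>i\<in>I. \<Sum>j\<in>I. \<Sum>l\<in>I. r b i * \<rho> g i j * (\<Sum>k\<in>I. \<rho> h j k * E k l) * b' l)"
      using comm gh by (intro sum.cong refl) simp
    also have "\<dots> = (\<Sum>i\<in>I. \<Sum>j\<in>I. r b i * \<rho> g i j * (\<Sum>l\<in>I. \<Sum>k\<in>I. \<rho> h j k * (E k l * b' l)))"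
      by (simp add: sum_distrib_left sum_distrib_right mult_ac)
    also have "\<dots> = (\<Sum>i\<in>I. \<Sum>j\<in>I. r b i * \<rho> g i j * (\<Sum>k\<in>I. \<rho> h j k * (\<Sum>l\<in>I. E k l * b' l)))"
      by (rule sum.cong[OF refl], rule sum.cong[OF refl], rule arg_cong[where f = "\<lambda>x. _ * x"],
          rule trans[OF sum.swap]) (simp add: sum_distrib_left)
    also have "\<dots> = (\<Sum>i\<in>I. \<Sum>j\<in>I. r b i * \<rho> g i j * (\<Sum>k\<in>I. \<rho> h j k * b' k))"
      using Eb b by simp
    also have "\<dots> = (\<Sum>i\<in>I. \<Sum>k\<in>I. r b i * (\<Sum>j\<in>I. \<rho> g i j * \<rho> h j k) * b' k)"
      by (rule sum.cong[OF refl], simp only: sum_distrib_left sum_distrib_right, rule trans[OF sum.swap])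
         (simp add: mult_ac)
    also have "\<dots> = \<tau> (g \<otimes>\<^bsub>G\<^esub> h) b b'"
      unfolding \<tau>_def using mult gh by (intro sum.cong refl) simp
    finally show "\<tau> (g \<otimes>\<^bsub>G\<^esub> h) b b' = (\<Sum>a\<in>B. \<tau> g b a * \<tau> h a b')" by simp
  qed
  then obtain n T where T: "representation G n T"
    "\<And>g. g \<in> carrier G \<Longrightarrow> char_of G n T g = (\<Sum>b\<in>B. \<tau> g b b)"
    using rep_on_imp_representation by blast
  have "(\<Sum>b\<in>B. \<tau> g b b) = (\<Sum>i\<in>I. \<Sum>k\<in>I. E i k * \<rho> g k i)" for g
  proof -
    have "(\<Sum>b\<in>B. \<tau> g b b) = (\<Sum>i\<in>I. \<Sum>j\<in>I. \<Sum>b\<in>B. r b i * \<rho> g i j * b j)"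
      unfolding \<tau>_def
      by (subst sum.swap, rule sum.cong[OF refl], subst sum.swap, rule refl)
    also have "\<dots> = (\<Sum>i\<in>I. \<Sum>j\<in>I. E j i * \<rho> g i j)"
      using B(2) by (intro sum.cong refl) (simp add: sum_distrib_left sum_distrib_right mult_ac)
    also have "\<dots> = (\<Sum>j\<in>I. \<Sum>i\<in>I. E j i * \<rho> g i j)" by (rule sum.swap)
    finally show ?thesis .
  qed
  with T show ?thesis by auto
qed

text \<open>A permutation \<open>s\<close> of the index set that leaves the matrix entries invariant commutes with the action.
  Its isotypic part for an \<open>n\<close>-th root of unity \<open>w\<close> is the image of the idempotent
  \<open>n\<inverse> (\<Sum>t<n. w\<^sup>t s\<^sup>t)\<close>.  This will be used for the rotation of tensor factors and
  for right translations of the group.\<close>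

lemma cyclic_isotypic_rep:
  fixes \<rho> :: "'g \<Rightarrow> 'i \<Rightarrow> 'i \<Rightarrow> 'k::field_char_0"
  assumes rep: "rep_on G I \<rho>" and G: "monoid G"
    and s: "\<And>i. i \<in> I \<Longrightarrow> s i \<in> I" "\<And>i. i \<in> I \<Longrightarrow> (s ^^ n) i = i" and n: "n > 0"
    and inv: "\<And>g i j. g \<in> carrier G \<Longrightarrow> i \<in> I \<Longrightarrow> j \<in> I \<Longrightarrow> \<rho> g (s i) (s j) = \<rho> g i j"
    and w: "w ^ n = 1"
  shows "\<exists>m T. representation G m T \<and> (\<forall>g\<in>carrier G. char_of G m T g =
           (\<Sum>t<n. w ^ t * (\<Sum>i\<in>I. \<rho> g ((s ^^ t) i) i)) / of_nat n)"
proof -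
  have fin: "finite I" using rep by (simp add: rep_on_def)
  have sI: "(s ^^ t) i \<in> I" if "i \<in> I" for t i using that by (induction t) (auto simp: s)
  have invt: "\<rho> g ((s ^^ t) i) ((s ^^ t) j) = \<rho> g i j" if "g \<in> carrier G" "i \<in> I" "j \<in> I" for g t i j
    using that by (induction t) (auto simp: inv sI)
  have smul: "(s ^^ (n * q)) i = i" if "i \<in> I" for q i
    using that by (induction q) (auto simp: funpow_add s(2))
  have smod: "(s ^^ (t mod n)) i = (s ^^ t) i" if "i \<in> I" for t i
  proof -
    have "(s ^^ t) i = (s ^^ (t mod n + n * (t div n))) i" by simp
    thus ?thesis using smul[OF that] by (simp only: funpow_add o_def)
  qed
  have wmod: "w ^ (t mod n) = w ^ t" for t
  proof -
    have "w ^ t = w ^ (t mod n + n * (t div n))" by simp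
    also have "\<dots> = w ^ (t mod n)" by (simp only: power_add power_mult w power_one mult_1_right)
    finally show ?thesis ..
  qed
  define N where "N = (of_nat n :: 'k)"
  have N: "N \<noteq> 0" using n by (simp add: N_def)
  define E where "E i j = (\<Sum>t<n. w ^ t * (if j = (s ^^ t) i then 1 else 0)) / N" for i j
  have Esum: "(\<Sum>k\<in>I. E i k * f k) = (\<Sum>t<n. w ^ t * f ((s ^^ t) i)) / N" if "i \<in> I" for i and f :: "'i \<Rightarrow> 'k"
  proof -
    have "(\<Sum>k\<in>I. E i k * f k) = (\<Sum>k\<in>I. \<Sum>t<n. if k = (s ^^ t) i then w ^ t * f k / N else 0)"
      unfolding E_def by (intro sum.cong refl) (auto simp: sum_divide_distrib sum_distrib_right intro!: sum.cong)
    also have "\<dots> = (\<Sum>t<n. \<Sum>k\<in>I. if k = (s ^^ t) i then w ^ t * f k / N else 0)" by (rule sum.swap)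
    also have "\<dots> = (\<Sum>t<n. w ^ t * f ((s ^^ t) i) / N)"
      using fin sI[OF that] by (intro sum.cong refl) simp
    finally show ?thesis by (simp add: sum_divide_distrib)
  qed
  have shift: "(\<Sum>t<n. f ((t + u) mod n)) = (\<Sum>t<n. f t)" for u and f :: "nat \<Rightarrow> 'k"
  proof (rule sum.reindex_bij_betw)
    have "inj_on (\<lambda>t. (t + u) mod n) {..<n}"
    proof (rule inj_onI)
      fix a b assume ab: "a \<in> {..<n}" "b \<in> {..<n}" "(a + u) mod n = (b + u) mod n"
      have "a mod n = b mod n" using ab(3) cong_add_rcancel_nat[of a u b n] by (simp add: cong_def)
      thus "a = b" using ab by simp
    qed
    moreover have "(\<lambda>t. (t + u) mod n) ` {..<n} \<subseteq> {..<n}" using n by auto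
    ultimately show "bij_betw (\<lambda>t. (t + u) mod n) {..<n} {..<n}"
      by (metis bij_betw_def endo_inj_surj finite_lessThan)
  qed
  have Eshift: "w ^ u * E ((s ^^ u) i) j = E i j" if "i \<in> I" for u i j
  proof -
    have "w ^ u * E ((s ^^ u) i) j = (\<Sum>t<n. w ^ (t + u) * (if j = (s ^^ (t + u)) i then 1 else 0)) / N"
      unfolding E_def by (simp add: funpow_add power_add sum_distrib_left mult_ac)
    also have "\<dots> = (\<Sum>t<n. w ^ ((t + u) mod n) * (if j = (s ^^ ((t + u) mod n)) i then 1 else 0)) / N"
      using smod[OF that] by (simp add: wmod)
    also have "\<dots> = E i j"
      unfolding E_def
      by (rule arg_cong[where f = "\<lambda>x. x / N"],
          rule shift[of "\<lambda>t. w ^ t * (if j = (s ^^ t) i then 1 else 0)"])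
    finally show ?thesis .
  qed
  have idem: "(\<Sum>k\<in>I. E i k * E k j) = E i j" if "i \<in> I" "j \<in> I" for i j
    using N n by (simp add: Esum that Eshift N_def)
  have comm: "(\<Sum>k\<in>I. E i k * \<rho> g k j) = (\<Sum>k\<in>I. \<rho> g i k * E k j)"
    if g: "g \<in> carrier G" and ij: "i \<in> I" "j \<in> I" for g i j
  proof -
    have bij: "bij_betw (s ^^ t) I I" for t
    proof -
      have "inj_on (s ^^ t) I"
      proof (rule inj_onI)
        fix a b assume ab: "a \<in> I" "b \<in> I" "(s ^^ t) a = (s ^^ t) b"
        have "(s ^^ ((n - 1) * t + t)) a = (s ^^ ((n - 1) * t + t)) b" using ab(3) by (simp add: funpow_add)
        moreover have "(n - 1) * t + t = n * t" using n by (simp add: mult_eq_if)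
        ultimately show "a = b" using smul ab by simp
      qed
      moreover have "(s ^^ t) ` I \<subseteq> I" using sI by auto
      ultimately show ?thesis by (metis bij_betw_def endo_inj_surj fin)
    qed
    have "(\<Sum>k\<in>I. \<rho> g i k * E k j) = (\<Sum>k\<in>I. \<Sum>t<n. if j = (s ^^ t) k then w ^ t * \<rho> g i k / N else 0)"
      unfolding E_def by (intro sum.cong refl) (auto simp: sum_divide_distrib sum_distrib_left intro!: sum.cong)
    also have "\<dots> = (\<Sum>t<n. \<Sum>k\<in>I. if j = (s ^^ t) k then w ^ t * \<rho> g i k / N else 0)" by (rule sum.swap)
    also have "\<dots> = (\<Sum>t<n. \<Sum>k\<in>I. if j = (s ^^ t) k then w ^ t * \<rho> g ((s ^^ t) i) ((s ^^ t) k) / N else 0)"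
      using invt g ij by (intro sum.cong refl) auto
    also have "\<dots> = (\<Sum>t<n. \<Sum>k\<in>I. if j = k then w ^ t * \<rho> g ((s ^^ t) i) k / N else 0)"
      (is "(\<Sum>t<n. ?l t) = (\<Sum>t<n. ?r t)")
    proof (rule sum.cong[OF refl])
      fix t
      show "?l t = ?r t"
        by (rule sum.reindex_bij_betw[OF bij[of t], of "\<lambda>k. if j = k then w ^ t * \<rho> g ((s ^^ t) i) k / N else 0"])
    qed
    also have "\<dots> = (\<Sum>t<n. w ^ t * \<rho> g ((s ^^ t) i) j / N)" using fin ij by simp
    finally show ?thesis by (simp add: Esum ij sum_divide_distrib)
  qed
  obtain m T where T: "representation G m T"
    "\<And>g. g \<in> carrier G \<Longrightarrow> char_of G m T g = (\<Sum>i\<in>I. \<Sum>k\<in>I. E i k * \<rho> g k i)"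
    using idempotent_rep[OF rep idem comm G] by blast
  have "(\<Sum>i\<in>I. \<Sum>k\<in>I. E i k * \<rho> g k i) = (\<Sum>t<n. w ^ t * (\<Sum>i\<in>I. \<rho> g ((s ^^ t) i) i)) / N" for g
  proof -
    have "(\<Sum>i\<in>I. \<Sum>k\<in>I. E i k * \<rho> g k i) = (\<Sum>i\<in>I. (\<Sum>t<n. w ^ t * \<rho> g ((s ^^ t) i) i) / N)"
      by (intro sum.cong refl Esum)
    also have "\<dots> = (\<Sum>i\<in>I. (\<Sum>t<n. w ^ t * \<rho> g ((s ^^ t) i) i)) / N" by (simp add: sum_divide_distrib)
    also have "(\<Sum>i\<in>I. (\<Sum>t<n. w ^ t * \<rho> g ((s ^^ t) i) i)) = (\<Sum>t<n. w ^ t * (\<Sum>i\<in>I. \<rho> g ((s ^^ t) i) i))"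
      by (subst sum.swap) (simp add: sum_distrib_left)
    finally show ?thesis .
  qed
  with T show ?thesis unfolding N_def by auto
qed

section \<open>Formal logarithms\<close>

text \<open>The series \<open>fps_ln 1\<close> is \<open>log (1 + t)\<close>.\<close>

definition fps_log :: "'k::field_char_0 fps \<Rightarrow> 'k fps" where
  "fps_log u = fps_ln 1 oo (u - 1)"

lemma fps_log_nth0 [simp]: "fps_nth (fps_log u) 0 = 0"
  by (simp add: fps_log_def)

lemma fps_log_deriv:
  assumes "fps_nth u 0 = 1"
  shows "fps_deriv (fps_log u) = fps_deriv u * inverse u"
proof -
  have 0: "fps_nth (u - 1) 0 = 0" using assms by simp
  have "(inverse (1 + fps_X) oo (u - 1)) = inverse ((1 + fps_X) oo (u - 1))"
    by (rule fps_inverse_compose[OF 0]) simp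
  also have "(1 + fps_X) oo (u - 1) = u"
    using 0 by (simp add: fps_compose_add_distrib)
  finally show ?thesis
    using 0 by (simp add: fps_log_def fps_compose_deriv fps_ln_deriv mult.commute)
qed

lemma fps_deriv_nth0_cong:
  fixes f g :: "'k::field_char_0 fps"
  assumes "fps_deriv f = fps_deriv g" "fps_nth f 0 = fps_nth g 0"
  shows "f = g"
  using assms fps_deriv_eq_iff[of f g] by simp

text \<open>Both sides have the same logarithmic derivative and no constant term.\<close>

lemma fps_log_mult:
  assumes "fps_nth u 0 = 1" "fps_nth v 0 = 1"
  shows "fps_log (u * v) = fps_log u + fps_log v"
proof (rule fps_deriv_nth0_cong)
  have inv: "u * inverse u = 1" "v * inverse v = 1"
    using assms inverse_mult_eq_1'[of u] inverse_mult_eq_1'[of v] by simp_all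
  have uv: "fps_nth (u * v) 0 = 1" using assms by simp
  have "fps_deriv (fps_log (u * v)) = (fps_deriv u * v + u * fps_deriv v) * (inverse u * inverse v)"
    using fps_log_deriv[OF uv] by (simp add: fps_inverse_mult add.commute)
  also have "\<dots> = fps_deriv u * inverse u * (v * inverse v) + fps_deriv v * inverse v * (u * inverse u)"
    by (simp add: algebra_simps)
  also have "\<dots> = fps_deriv (fps_log u + fps_log v)"
    using assms by (simp add: fps_log_deriv inv)
  finally show "fps_deriv (fps_log (u * v)) = fps_deriv (fps_log u + fps_log v)" .
qed simp

lemma fps_log_1 [simp]: "fps_log 1 = 0"
  by (simp add: fps_log_def)

lemma fps_log_power: "fps_nth u 0 = 1 \<Longrightarrow> fps_log (u ^ n) = of_nat n * fps_log u"
  by (induction n) (auto simp: fps_log_mult fps_power_zeroth algebra_simps)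

lemma fps_log_prod_list:
  "(\<And>x. x \<in> set xs \<Longrightarrow> fps_nth (f x) 0 = 1) \<Longrightarrow> fps_nth (\<Prod>x\<leftarrow>xs. f x) 0 = 1 \<and>
     fps_log (\<Prod>x\<leftarrow>xs. f x) = (\<Sum>x\<leftarrow>xs. fps_log (f x))"
  by (induction xs) (auto simp: fps_log_mult)

lemma fps_log_inverse:
  assumes "fps_nth u 0 = 1"
  shows "fps_log (inverse u) = - fps_log u"
proof -
  have "fps_log (u * inverse u) = fps_log u + fps_log (inverse u)"
    using assms by (intro fps_log_mult) auto
  moreover have "u * inverse u = 1" using assms inverse_mult_eq_1'[of u] by simp
  ultimately show ?thesis by (simp add: eq_neg_iff_add_eq_0 add.commute)
qed

lemma fps_exp_log:
  assumes "fps_nth u 0 = 1"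
  shows "fps_exp 1 oo fps_log u = u"
proof -
  define e where "e = fps_exp 1 oo fps_log u"
  have "fps_deriv e = e * (fps_deriv u * inverse u)"
    using assms by (simp add: e_def fps_compose_deriv fps_log_deriv)
  hence "fps_deriv (e * inverse u) = e * fps_deriv u * (inverse u * inverse u) - e * fps_deriv u * (inverse u)\<^sup>2"
    using assms by (simp add: fps_inverse_deriv algebra_simps)
  hence d: "fps_deriv (e * inverse u) = fps_deriv 1" by (simp add: power2_eq_square)
  have "fps_nth (e * inverse u) 0 = fps_nth 1 0"
    using assms by (simp add: e_def)
  from fps_deriv_nth0_cong[OF d this] have "e * inverse u = 1" .
  hence "e * (inverse u * u) = u" by (metis mult.assoc mult_1)
  thus ?thesis using assms inverse_mult_eq_1[of u] by (simp add: e_def)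
qed

lemma fps_log_inj:
  assumes "fps_nth u 0 = 1" "fps_nth v 0 = 1" "fps_log u = fps_log v"
  shows "u = v"
  using assms fps_exp_log by metis

lemma fps_log_1_minus_nth:
  fixes c :: "'k::field_char_0"
  assumes e: "e > 0"
  shows "fps_nth (fps_log (1 - fps_const c * fps_X ^ e)) N =
    (if N > 0 \<and> e dvd N then - (c ^ (N div e)) / of_nat (N div e) else 0)"
proof -
  have pw: "fps_nth ((- (fps_const c * fps_X ^ e)) ^ i) N = (if N = e * i then (- c) ^ i else 0)" for i
  proof -
    have "(- (fps_const c * fps_X ^ e)) ^ i = fps_const ((- c) ^ i) * fps_X ^ (e * i)"
    proof -
      have "- (fps_const c * fps_X ^ e) = fps_const (- c) * fps_X ^ e" by (simp flip: fps_const_neg)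
      thus ?thesis by (simp only: power_mult_distrib fps_const_power power_mult)
    qed
    thus ?thesis by (simp only: fps_mult_left_const_nth fps_X_power_nth) simp
  qed
  have "fps_nth (fps_log (1 - fps_const c * fps_X ^ e)) N =
      (\<Sum>i=0..N. fps_nth (fps_ln 1) i * (fps_nth ((- (fps_const c * fps_X ^ e)) ^ i) N))"
    by (simp add: fps_log_def fps_compose_nth)
  also have "\<dots> = (\<Sum>i=0..N. if e dvd N \<and> i = N div e then fps_nth (fps_ln 1) i * (- c) ^ i else 0)"
    using e by (intro sum.cong refl) (auto simp: pw)
  also have "\<dots> = (if e dvd N then fps_nth (fps_ln 1) (N div e) * (- c) ^ (N div e) else 0)"
    by (auto simp: sum.delta)
  also have "\<dots> = (if N > 0 \<and> e dvd N then - (c ^ (N div e)) / of_nat (N div e) else 0)"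
  proof (cases "N > 0 \<and> e dvd N")
    case True
    hence "N div e \<noteq> 0" using e by (auto elim!: dvdE)
    then obtain m where m: "N div e = Suc m" using not0_implies_Suc by blast
    have "(-1 :: 'k) ^ m * (- c) ^ Suc m = - (c ^ Suc m)"
      by (subst power_minus) simp
    thus ?thesis using True by (simp add: m fps_ln_nth field_simps)
  qed auto
  finally show ?thesis .
qed

text \<open>The truncation after \<open>n\<close> terms is needed for elements, where it defines the \<open>p\<close>-adic logarithm, and
  for series, where it approximates the formal logarithm.\<close>

definition log_partial :: "nat \<Rightarrow> 'a::field \<Rightarrow> 'a" where
  "log_partial n z = (\<Sum>i=1..n. (-1) ^ (i + 1) / of_nat i * (z - 1) ^ i)"

definition fps_log_partial :: "nat \<Rightarrow> 'k::field_char_0 fps \<Rightarrow> 'k fps" where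
  "fps_log_partial n u = (\<Sum>i=1..n. fps_const ((-1) ^ (i + 1) / of_nat i) * (u - 1) ^ i)"

text \<open>The sum is finite because \<open>(u - 1)\<^sup>i\<close> starts in degree \<open>i\<close> or later.  Only indices \<open>i > n\<close>
  remain, and for these the terms will be \<open>p\<close>-adically small.\<close>

lemma fps_log_tail:
  assumes "fps_nth u 0 = 1"
  shows "fps_nth (fps_log u - fps_log_partial n u) N =
    (\<Sum>i=Suc n..max n N. (-1) ^ (i + 1) / of_nat i * (fps_nth ((u - 1) ^ i) N))"
proof -
  define M where "M = max n N"
  define f where "f i = (-1) ^ (i + 1) / of_nat i * (fps_nth ((u - 1) ^ i) N)" for i
  have "fps_nth (fps_log u) N = (\<Sum>i=0..N. fps_nth (fps_ln 1) i * (fps_nth ((u - 1) ^ i) N))"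
    by (simp add: fps_log_def fps_compose_nth)
  also have "\<dots> = (\<Sum>i=0..M. fps_nth (fps_ln 1) i * (fps_nth ((u - 1) ^ i) N))"
    using assms by (intro sum.mono_neutral_left) (auto simp: M_def startsby_zero_power_prefix)
  also have "\<dots> = (\<Sum>i=1..M. f i)"
    by (intro sum.mono_neutral_cong_right)
       (auto simp: fps_ln_nth f_def minus_one_power_iff Suc_le_eq)
  also have "\<dots> = (\<Sum>i=1..n. f i) + (\<Sum>i=Suc n..M. f i)"
  proof -
    have "sum f {1..n + (M - n)} = sum f {1..n} + sum f {n + 1..n + (M - n)}"
      by (rule sum.ub_add_nat) simp
    thus ?thesis by (simp add: M_def)
  qed
  finally show ?thesis
    by (simp add: fps_log_partial_def fps_sum_nth f_def M_def)
qed

section \<open>Prime to \<open>p\<close> parts of factorials and denominators\<close>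

text \<open>The factors of \<open>k!\<close> that \<open>p\<close> divides are \<open>p, 2p, \<dots>, (k div p) p\<close>.\<close>

lemma fact_prime_part:
  assumes p: "Factorial_Ring.prime (p::nat)"
  shows "\<exists>c. coprime c p \<and> fact k = p ^ (k div p) * fact (k div p) * (c::nat)"
proof (induction k)
  case (Suc k)
  then obtain c where c: "coprime c p" "fact k = p ^ (k div p) * fact (k div p) * c" by blast
  have p0: "p > 0" using p prime_gt_0_nat by blast
  show ?case
  proof (cases "p dvd Suc k")
    case True
    then obtain m where m: "Suc k = p * m" by blast
    obtain m' where m': "m = Suc m'" using m by (cases m) auto
    have d1: "k div p = m'"
      by (rule div_nat_eqI) (use m m' p0 in auto)
    have d2: "Suc k div p = Suc m'" unfolding m m' using p0 by simp
    have f: "fact k = p ^ m' * fact m' * c" using c(2) by (simp only: d1)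
    have "fact (Suc k) = Suc k * fact k" by (simp only: fact_Suc of_nat_id)
    also have "\<dots> = (p * Suc m') * (p ^ m' * fact m' * c)" by (simp only: f m m')
    also have "\<dots> = p ^ Suc m' * fact (Suc m') * c" by (simp only: fact_Suc of_nat_id power_Suc mult_ac)
    finally have "fact (Suc k) = p ^ (Suc k div p) * fact (Suc k div p) * c" by (simp only: d2)
    thus ?thesis using c(1) by blast
  next
    case False
    hence cop: "coprime (Suc k) p" using p by (simp add: prime_imp_coprime coprime_commute)
    have "Suc k div p = k div p" using False
      by (simp add: div_Suc dvd_eq_mod_eq_0)
    hence "fact (Suc k) = p ^ (Suc k div p) * fact (Suc k div p) * (c * Suc k)"
      using c(2) by (simp only: fact_Suc of_nat_id mult_ac)
    moreover have "coprime (c * Suc k) p" using c(1) cop by (simp del: mult_Suc_right)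
    ultimately show ?thesis by blast
  qed
qed (auto intro!: exI[of _ 1])

text \<open>In terms of valuations \<open>v(k!) \<le> k - 1\<close>, because \<open>v(k!) = q + v(q!)\<close> with \<open>q = k div p \<le> k/2\<close>.
  The equation between natural numbers becomes the integrality of \<open>p\<^bsup>k-1\<^esup>/k!\<close> in every
  ring in which numbers prime to \<open>p\<close> are invertible.\<close>

lemma fact_dvd_prime_power:
  assumes p: "Factorial_Ring.prime (p::nat)" and "k > 0"
  shows "\<exists>b c. coprime c p \<and> fact k * b = (c::nat) * p ^ (k - 1)"
  using \<open>k > 0\<close>
proof (induction k rule: less_induct)
  case (less k)
  obtain c where c: "coprime c p" "fact k = p ^ (k div p) * fact (k div p) * (c::nat)"
    using fact_prime_part[OF p] by blast
  show ?case
  proof (cases "k div p = 0")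
    case True
    hence "fact k * p ^ (k - 1) = c * p ^ (k - 1)" using c(2) by simp
    thus ?thesis using c(1) by blast
  next
    case False
    have p2: "p \<ge> 2" using p by (rule prime_ge_2_nat)
    define q where "q = k div p"
    have q: "q > 0" "q < k" using False p2 less.prems by (auto simp: q_def)
    obtain b c' where bc: "coprime c' p" "fact q * b = c' * p ^ (q - 1)"
      using less.IH[OF q(2,1)] by blast
    have "2 * q \<le> p * q" using p2 by simp
    also have "\<dots> \<le> k" by (simp add: q_def)
    finally have le: "q + (q - 1) \<le> k - 1" by simp
    have "fact k * (b * p ^ (k - 1 - (q + (q - 1)))) =
       p ^ q * c * (fact q * b) * p ^ (k - 1 - (q + (q - 1)))"
      using c(2) by (simp add: q_def)
    also have "\<dots> = c * c' * (p ^ q * p ^ (q - 1) * p ^ (k - 1 - (q + (q - 1))))"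
      unfolding bc(2) by (simp add: mult_ac)
    also have "p ^ q * p ^ (q - 1) * p ^ (k - 1 - (q + (q - 1))) = p ^ (k - 1)"
      by (simp only: power_add[symmetric] le_add_diff_inverse[OF le])
    finally have "fact k * (b * p ^ (k - 1 - (q + (q - 1)))) = c * c' * p ^ (k - 1)" .
    moreover have "coprime (c * c') p" using c(1) bc(1) by simp
    ultimately show ?thesis by blast
  qed
qed

text \<open>The valuation \<open>v\<close> of \<open>i\<close> satisfies \<open>2 v \<le> p\<^sup>v \<le> i\<close>; so \<open>v + k \<le> i\<close> if also
  \<open>2 k \<le> i\<close>.\<close>

lemma index_dvd_prime_power:
  assumes p: "Factorial_Ring.prime (p::nat)" and i: "i \<ge> 2 * k" "i > 0"
  shows "\<exists>b c. coprime c p \<and> i * (b * p ^ k) = (c::nat) * p ^ i"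
proof -
  obtain v c where vc: "i = p ^ v * c" "\<not> p dvd c"
    using i p by (metis multiplicity_decompose' not_prime_unit neq0_conv)
  have c: "coprime c p" using prime_imp_coprime[OF p vc(2)] by (simp add: coprime_commute)
  have c0: "c > 0" using vc i by (cases c) auto
  have "2 * v \<le> 2 ^ v"
  proof (induction v)
    case (Suc v)
    show ?case
    proof (cases v)
      case (Suc w)
      have "(2::nat) \<le> 2 ^ v" unfolding Suc by simp
      thus ?thesis using \<open>2 * v \<le> 2 ^ v\<close> by simp
    qed simp
  qed simp
  also have "2 ^ v \<le> p ^ v" using prime_ge_2_nat[OF p] by (rule power_mono) simp
  also have "p ^ v \<le> i" using vc c0 by simp
  finally have "v + k \<le> i" using i by simp
  define e where "e = i - (v + k)"
  have ie: "v + k + e = i" using \<open>v + k \<le> i\<close> by (simp add: e_def)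
  have "p ^ v * c * (p ^ e * p ^ k) = c * p ^ (v + k + e)" by (simp add: power_add mult_ac)
  hence "i * (p ^ e * p ^ k) = c * p ^ i" by (simp only: vc(1)[symmetric] ie)
  thus ?thesis using c by blast
qed

section \<open>Congruences between class sums of powers\<close>

definition words :: "'a set \<Rightarrow> nat \<Rightarrow> 'a list set" where
  "words A n = {xs. set xs \<subseteq> A \<and> length xs = n}"

lemma finite_words [simp]: "finite A \<Longrightarrow> finite (words A n)"
  unfolding words_def by (rule finite_lists_length_eq)

lemma words_0 [simp]: "words A 0 = {[]}"
  by (auto simp: words_def)

lemma sum_words_Suc:
  "(\<Sum>xs\<in>words A (Suc n). f xs) = (\<Sum>x\<in>A. \<Sum>xs\<in>words A n. f (x # xs))"
proof -
  have "words A (Suc n) = (\<lambda>(x, xs). x # xs) ` (A \<times> words A n)"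
    by (auto simp: words_def length_Suc_conv image_iff)
  moreover have "inj_on (\<lambda>(x, xs). x # xs) (A \<times> words A n)" by (auto simp: inj_on_def)
  ultimately have "(\<Sum>xs\<in>words A (Suc n). f xs) = (\<Sum>(x, xs)\<in>A \<times> words A n. f (x # xs))"
    by (simp add: sum.reindex case_prod_unfold)
  thus ?thesis by (simp add: sum.cartesian_product)
qed

definition word_prod :: "('g, 'm) monoid_scheme \<Rightarrow> 'g list \<Rightarrow> 'g" where
  "word_prod G xs = foldr (\<lambda>x y. x \<otimes>\<^bsub>G\<^esub> y) xs \<one>\<^bsub>G\<^esub>"

lemma word_prod_simps [simp]:
  "word_prod G [] = \<one>\<^bsub>G\<^esub>" "word_prod G (x # xs) = x \<otimes>\<^bsub>G\<^esub> word_prod G xs"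
  by (simp_all add: word_prod_def)

lemma (in monoid) word_prod_closed [simp]: "set xs \<subseteq> carrier G \<Longrightarrow> word_prod G xs \<in> carrier G"
  by (induction xs) auto

lemma (in monoid) word_prod_append:
  "set xs \<subseteq> carrier G \<Longrightarrow> set ys \<subseteq> carrier G \<Longrightarrow>
     word_prod G (xs @ ys) = word_prod G xs \<otimes> word_prod G ys"
  by (induction xs) (auto simp: m_assoc)

lemma set_concat_replicate: "set (concat (replicate n zs)) \<subseteq> set zs"
  by (induction n) auto

lemma (in monoid) word_prod_replicate:
  assumes "set zs \<subseteq> carrier G"
  shows "word_prod G (concat (replicate n zs)) = word_prod G zs [^] n"
proof (induction n)
  case (Suc n)
  have "set (concat (replicate n zs)) \<subseteq> carrier G" by (rule order_trans[OF set_concat_replicate assms])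
  hence "word_prod G (concat (replicate (Suc n) zs)) = word_prod G zs \<otimes> word_prod G zs [^] n"
    using assms Suc by (simp add: word_prod_append)
  thus ?case using nat_pow_Suc2[OF word_prod_closed[OF assms], of n] by (simp only:)
qed simp

lemma prod_list_replicate:
  fixes y :: "'g \<Rightarrow> 'r::comm_monoid_mult"
  shows "prod_list (map y (concat (replicate n zs))) = prod_list (map y zs) ^ n"
  by (induction n) auto

lemma prod_list_rotate:
  fixes y :: "'g \<Rightarrow> 'r::comm_monoid_mult"
  shows "prod_list (map y (rotate n zs)) = prod_list (map y zs)"
proof -
  define q where "q = n mod length zs"
  have "prod_list (map y (rotate n zs)) = prod_list (map y (drop q zs)) * prod_list (map y (take q zs))"
    by (simp add: rotate_drop_take q_def)
  also have "\<dots> = prod_list (map y (take q zs @ drop q zs))"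
    by (simp only: map_append prod_list.append mult.commute)
  finally show ?thesis by simp
qed

subsection \<open>Free orbits of a cyclic group of prime power order\<close>

lemma funpow_fixed_mult: "(s ^^ n) x = x \<Longrightarrow> (s ^^ (n * q)) x = x"
  by (induction q) (auto simp: funpow_add)

text \<open>The length of an orbit of \<open>s\<close> divides \<open>p\<^sup>k\<close> but not \<open>p\<^bsup>k-1\<^esup>\<close>, so it is \<open>p\<^sup>k\<close>.
  The induction removes one orbit at a time.\<close>

lemma sum_free_orbits:
  fixes f :: "'a \<Rightarrow> 'r::comm_ring_1"
  assumes p: "Factorial_Ring.prime (p::nat)" and k: "k > 0" and "finite S"
    and "\<And>x. x \<in> S \<Longrightarrow> s x \<in> S"
    and "\<And>x. x \<in> S \<Longrightarrow> (s ^^ (p ^ k)) x = x"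
    and "\<And>x. x \<in> S \<Longrightarrow> (s ^^ (p ^ (k - 1))) x \<noteq> x"
    and "\<And>x. x \<in> S \<Longrightarrow> f (s x) = f x"
  shows "of_nat (p ^ k) dvd (\<Sum>x\<in>S. f x)"
  using assms(3-)
proof (induction S rule: finite_psubset_induct)
  case (psubset S)
  note inS = psubset.prems(1) and per = psubset.prems(2) and free = psubset.prems(3) and inv = psubset.prems(4)
  show ?case
  proof (cases "S = {}")
    case False
    then obtain x where x: "x \<in> S" by blast
    define n where "n = p ^ k"
    have n: "n > 0" using p by (simp add: n_def prime_gt_0_nat)
    have orbS: "(s ^^ i) x \<in> S" for i using x inS by (induction i) auto
    have f_orb: "f ((s ^^ i) x) = f x" for i using orbS inv by (induction i) auto
    define T where "T = (\<lambda>i. (s ^^ i) x) ` {..<n}"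
    have no: "(s ^^ d) x \<noteq> x" if d: "0 < d" "d < n" for d
    proof
      assume fx: "(s ^^ d) x = x"
      obtain a b where ab: "d * a = n * b + gcd d n" using bezout_nat[of d n] d by auto
      have "(s ^^ (n * b + gcd d n)) x = x" using funpow_fixed_mult[OF fx, of a] ab by simp
      hence "(s ^^ (gcd d n + n * b)) x = x" by (simp add: add.commute)
      hence g: "(s ^^ gcd d n) x = x"
        using funpow_fixed_mult[of n s x b] per[OF x] by (simp add: funpow_add n_def)
      obtain e where e: "e \<le> k" "gcd d n = p ^ e"
        using divides_primepow_nat[OF p, of "gcd d n" k] by (auto simp: n_def)
      have "gcd d n \<le> d" using d by (simp add: dvd_imp_le)
      hence "p ^ e < n" using e(2) d by linarith
      hence "e \<noteq> k" by (auto simp: n_def)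
      hence "e \<le> k - 1" using e by simp
      hence "p ^ (k - 1) = p ^ e * p ^ (k - 1 - e)"
        by (simp only: power_add[symmetric] le_add_diff_inverse)
      hence "(s ^^ (p ^ (k - 1))) x = x" using funpow_fixed_mult[OF g, of "p ^ (k - 1 - e)"] e by simp
      thus False using free[OF x] by simp
    qed
    have return: "(s ^^ (n - i)) ((s ^^ i) x) = x" if "i < n" for i
    proof -
      have "(s ^^ (n - i + i)) x = x" using that per[OF x] by (simp add: n_def)
      thus ?thesis by (simp only: funpow_add o_def)
    qed
    have inj: "inj_on (\<lambda>i. (s ^^ i) x) {..<n}"
    proof (rule linorder_inj_onI')
      fix i j assume ij: "i \<in> {..<n}" "j \<in> {..<n}" "i < j"
      show "(s ^^ i) x \<noteq> (s ^^ j) x"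
      proof
        assume eq: "(s ^^ i) x = (s ^^ j) x"
        have "x = (s ^^ (n - i)) ((s ^^ j) x)" using return[of i] ij eq by simp
        also have "\<dots> = (s ^^ (n - i + j)) x" by (simp only: funpow_add o_def)
        also have "n - i + j = (j - i) + n" using ij by simp
        also have "(s ^^ ((j - i) + n)) x = (s ^^ (j - i)) x"
          using per[OF x] by (simp add: funpow_add n_def)
        finally have "(s ^^ (j - i)) x = x" by simp
        moreover have "j - i < n" "0 < j - i" using ij by auto
        ultimately show False using no by blast
      qed
    qed
    have TS: "T \<subseteq> S" using orbS by (auto simp: T_def)
    have sumT: "(\<Sum>x\<in>T. f x) = of_nat n * f x"
      unfolding T_def by (subst sum.reindex[OF inj]) (simp add: f_orb)
    have xT: "x \<in> T" unfolding T_def using n by (intro image_eqI[of _ _ 0]) auto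
    have sub: "S - T \<subset> S" using x xT by blast
    have stay: "s z \<in> S - T" if z: "z \<in> S - T" for z
    proof
      show "s z \<in> S" using z inS by blast
      show "s z \<notin> T"
      proof
        assume "s z \<in> T"
        then obtain i where i: "s z = (s ^^ i) x" "i < n" by (auto simp: T_def)
        have "z = (s ^^ (n - 1 + 1)) z" using per z n by (simp add: n_def)
        also have "\<dots> = (s ^^ (n - 1)) (s z)" by (simp only: funpow_add o_def) simp
        also have "\<dots> = (s ^^ (n - 1 + i)) x" by (simp only: i(1) funpow_add o_def)
        finally have zi: "z = (s ^^ (n - 1 + i)) x" .
        have "z \<in> T"
        proof (cases "i = 0")
          case True
          thus ?thesis unfolding T_def zi using n by (intro image_eqI[of _ _ "n - 1"]) auto
        next
          case False
          hence "n - 1 + i = (i - 1) + n" using n by simp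
          hence "z = (s ^^ (i - 1)) x" using zi per[OF x] by (simp add: funpow_add n_def)
          thus ?thesis unfolding T_def using i by (intro image_eqI[of _ _ "i - 1"]) auto
        qed
        thus False using z by simp
      qed
    qed
    have "of_nat (p ^ k) dvd (\<Sum>x\<in>S - T. f x)"
      by (rule psubset.IH[OF sub]) (use stay per free inv in auto)
    moreover have "(\<Sum>x\<in>S. f x) = (\<Sum>x\<in>S - T. f x) + (\<Sum>x\<in>T. f x)"
      using TS psubset.hyps by (subst sum.subset_diff[of T S]) auto
    ultimately show ?thesis using sumT by (simp add: n_def)
  qed simp
qed

text \<open>In \<open>a\<^sup>p - b\<^sup>p = (a - b) (\<Sum>i<p. b\<^bsup>p-1-i\<^esup> a\<^sup>i)\<close> the second factor is
  congruent to \<open>p b\<^bsup>p-1\<^esup>\<close> modulo \<open>p\<close>.\<close>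

lemma dvd_power_prime_diff:
  fixes a b :: "'r::comm_ring_1"
  assumes p: "Factorial_Ring.prime (p::nat)" and j: "of_nat p ^ Suc j dvd a - b"
  shows "of_nat p ^ Suc (Suc j) dvd a ^ p - b ^ p"
proof -
  have pb: "of_nat p dvd a - b" using j dvd_mult_left by (metis power_Suc)
  have "of_nat p dvd (\<Sum>i<p. b ^ (p - Suc i) * a ^ i)"
  proof -
    have d: "of_nat p dvd a ^ i - b ^ i" for i
      using pb power_diff_sumr2[of a i b] by simp
    have "of_nat p dvd (\<Sum>i<p. b ^ (p - Suc i) * (a ^ i - b ^ i))"
      by (intro dvd_sum dvd_mult d)
    moreover have "(\<Sum>i<p. b ^ (p - Suc i) * b ^ i) = (\<Sum>i<p. b ^ (p - 1))"
      by (intro sum.cong refl) (simp flip: power_add)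
    moreover have "of_nat p dvd (\<Sum>i<p. b ^ (p - 1))" by simp
    ultimately have "of_nat p dvd (\<Sum>i<p. b ^ (p - Suc i) * (a ^ i - b ^ i)) +
        (\<Sum>i<p. b ^ (p - Suc i) * b ^ i)" by (metis dvd_add)
    thus ?thesis by (simp add: sum_subtractf right_diff_distrib)
  qed
  hence "of_nat p ^ Suc j * of_nat p dvd (a - b) * (\<Sum>i<p. b ^ (p - Suc i) * a ^ i)"
    using j by (rule mult_dvd_mono[rotated])
  moreover have "(a - b) * (\<Sum>i<p. b ^ (p - Suc i) * a ^ i) = a ^ p - b ^ p"
    by (simp add: power_diff_sumr2)
  ultimately show ?thesis by (simp add: mult_ac)
qed

lemma dvd_power_prime_power_diff:
  fixes a b :: "'r::comm_ring_1"
  assumes p: "Factorial_Ring.prime (p::nat)" and j: "of_nat p dvd a - b"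
  shows "of_nat p ^ Suc e dvd a ^ (p ^ e) - b ^ (p ^ e)"
proof (induction e)
  case (Suc e)
  have "of_nat p ^ Suc (Suc e) dvd (a ^ (p ^ e)) ^ p - (b ^ (p ^ e)) ^ p"
    by (rule dvd_power_prime_diff[OF p Suc])
  thus ?case by (simp add: mult.commute flip: power_mult)
qed (use j in simp)

subsection \<open>Periodic words\<close>

lemma rotate_replicate:
  "rotate (length zs) (concat (replicate n zs)) = concat (replicate n zs)"
proof (cases n)
  case (Suc m)
  have "concat (replicate m zs) @ zs = zs @ concat (replicate m zs)" for m
    by (induction m) auto
  thus ?thesis by (simp add: Suc rotate_append)
qed simp

lemma periodic_list:
  "length xs = n * q \<Longrightarrow> (\<And>i. i + q < length xs \<Longrightarrow> xs ! (i + q) = xs ! i) \<Longrightarrow>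
     xs = concat (replicate n (take q xs))"
proof (induction n arbitrary: xs)
  case (Suc n)
  define ys where "ys = drop q xs"
  have len: "length ys = n * q" using Suc.prems(1) by (simp add: ys_def)
  have ys: "ys = concat (replicate n (take q ys))"
  proof (rule Suc.IH[OF len])
    fix i assume "i + q < length ys"
    hence "i + q + q < length xs" using len Suc.prems(1) by simp
    thus "ys ! (i + q) = ys ! i"
      using Suc.prems(2)[of "i + q"] by (simp add: ys_def add_ac)
  qed
  have "xs = take q xs @ ys" by (simp add: ys_def)
  also have "ys = concat (replicate n (take q xs))"
  proof (cases n)
    case 0
    thus ?thesis using len by simp
  next
    case (Suc m)
    have "take q ys = take q xs"
    proof (rule nth_equalityI)
      fix i assume "i < length (take q ys)"
      hence "i < q" "i + q < length xs" using len Suc.prems(1) by (auto simp: ys_def)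
      thus "take q ys ! i = take q xs ! i"
        using Suc.prems(2)[of i] by (simp add: ys_def add_ac)
    qed (use len Suc \<open>length xs = Suc n * q\<close> in simp)
    thus ?thesis using ys by simp
  qed
  finally show ?case by simp
qed simp

lemma rotate_fixed_imp_periodic:
  assumes "length xs = n * q" "rotate q xs = xs"
  shows "xs = concat (replicate n (take q xs))"
proof (rule periodic_list[OF assms(1)])
  fix i assume i: "i + q < length xs"
  have "rotate q xs ! i = xs ! ((q + i) mod length xs)"
    using i by (intro nth_rotate) auto
  thus "xs ! (i + q) = xs ! i" using i assms(2) by (simp add: add.commute)
qed

lemma periodic_words:
  "{xs \<in> words A (n * q). rotate q xs = xs} = (\<lambda>zs. concat (replicate n zs)) ` words A q"
  if "n > 0"
proof (intro equalityI subsetI)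
  fix xs assume "xs \<in> {xs \<in> words A (n * q). rotate q xs = xs}"
  hence xs: "set xs \<subseteq> A" "length xs = n * q" "rotate q xs = xs" by (auto simp: words_def)
  have "set (take q xs) \<subseteq> A" using xs(1) set_take_subset by fast
  moreover have "length (take q xs) = q" using xs(2) that by (cases n) auto
  ultimately have "take q xs \<in> words A q" by (simp add: words_def)
  thus "xs \<in> (\<lambda>zs. concat (replicate n zs)) ` words A q"
    using rotate_fixed_imp_periodic[OF xs(2,3)] by blast
next
  fix xs assume "xs \<in> (\<lambda>zs. concat (replicate n zs)) ` words A q"
  then obtain zs where zs: "set zs \<subseteq> A" "length zs = q" "xs = concat (replicate n zs)"
    by (auto simp: words_def)
  have "length xs = n * q" unfolding zs(3) zs(2)[symmetric] by (induction n) auto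
  moreover have "set xs \<subseteq> A" using set_concat_replicate zs by fast
  moreover have "rotate q xs = xs" unfolding zs(3) zs(2)[symmetric] by (rule rotate_replicate)
  ultimately show "xs \<in> {xs \<in> words A (n * q). rotate q xs = xs}" by (simp add: words_def)
qed

lemma inj_on_concat_replicate:
  assumes "n > 0"
  shows "inj_on (\<lambda>zs. concat (replicate n zs)) (words A q)"
proof (rule inj_onI)
  fix zs ws assume zw: "zs \<in> words A q" "ws \<in> words A q"
    "concat (replicate n zs) = concat (replicate n ws)"
  obtain m where "n = Suc m" using assms by (cases n) auto
  thus "zs = ws" using zw by (simp add: words_def)
qed

text \<open>Rotation replaces a product \<open>ab\<close> by its conjugate \<open>ba\<close>.\<close>

lemma (in group) class_function_pow_rotate:
  fixes h :: "'a \<Rightarrow> 'r"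
  assumes h: "\<And>a b. a \<in> carrier G \<Longrightarrow> b \<in> carrier G \<Longrightarrow> h (a \<otimes> b) = h (b \<otimes> a)"
    and xs: "set xs \<subseteq> carrier G"
  shows "h (word_prod G (rotate m xs) [^] (n::nat)) = h (word_prod G xs [^] n)"
proof -
  have ab: "h ((a \<otimes> b) [^] n) = h ((b \<otimes> a) [^] n)" if a: "a \<in> carrier G" and b: "b \<in> carrier G" for a b
  proof -
    have comm: "(a \<otimes> b) [^] n \<otimes> a = a \<otimes> (b \<otimes> a) [^] n"
    proof (induction n)
      case (Suc n)
      have "(a \<otimes> b) [^] Suc n \<otimes> a = (a \<otimes> b) [^] n \<otimes> a \<otimes> (b \<otimes> a)"
        using a b by (simp add: m_assoc)
      also have "\<dots> = a \<otimes> (b \<otimes> a) [^] Suc n" using a b Suc by (simp add: m_assoc)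
      finally show ?case .
    qed (use a in simp)
    have "(a \<otimes> b) [^] n = a \<otimes> ((b \<otimes> a) [^] n \<otimes> inv a)"
      using comm a b by (metis inv_closed inv_solve_right m_assoc m_closed nat_pow_closed)
    hence "h ((a \<otimes> b) [^] n) = h (((b \<otimes> a) [^] n \<otimes> inv a) \<otimes> a)" using h a b by simp
    also have "((b \<otimes> a) [^] n \<otimes> inv a) \<otimes> a = (b \<otimes> a) [^] n" using a b by (simp add: m_assoc)
    finally show ?thesis .
  qed
  define q where "q = m mod length xs"
  have "set (take q xs) \<subseteq> carrier G" "set (drop q xs) \<subseteq> carrier G"
    using xs set_take_subset set_drop_subset by fast+
  moreover have "rotate m xs = drop q xs @ take q xs" by (simp add: rotate_drop_take q_def)
  moreover have "xs = take q xs @ drop q xs" by simp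
  ultimately show ?thesis using ab by (metis word_prod_append word_prod_closed)
qed

text \<open>The element of the group ring with coefficients \<open>y\<close> has as its \<open>n\<close>-th power the sum of all words of
  length \<open>n\<close>, weighted by the products of coefficients.  The class function \<open>h\<close> maps such sums to the
  base ring; it will be the indicator function of a conjugacy class.\<close>

locale frobenius_lift_words = group G for G (structure) +
  fixes p :: nat and F :: "'r::comm_ring_1 \<Rightarrow> 'r" and y :: "'a \<Rightarrow> 'r" and h :: "'a \<Rightarrow> 'r"
  assumes fin: "finite (carrier G)" and p: "Factorial_Ring.prime p"
    and F: "\<And>r. of_nat p dvd F r - r ^ p" and F_power: "\<And>r n. F (r ^ n) = F r ^ n"
    and h: "\<And>a b. a \<in> carrier G \<Longrightarrow> b \<in> carrier G \<Longrightarrow> h (a \<otimes> b) = h (b \<otimes> a)"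
begin

definition wt :: "'a list \<Rightarrow> 'r" where "wt xs = prod_list (map y xs)"

text \<open>Rotation by \<open>m\<close> generates an action of the cyclic group of order \<open>p\<^bsup>k+1\<^esup>\<close> on the words of
  length \<open>p\<^bsup>k+1\<^esup> m\<close>; it is free on the words that rotation by \<open>p\<^sup>k m\<close> moves.\<close>

lemma sum_nonperiodic:
  fixes f :: "'a list \<Rightarrow> 'r"
  assumes inv: "\<And>xs. xs \<in> words (carrier G) (p ^ Suc k * m) \<Longrightarrow> f (rotate m xs) = f xs"
  shows "of_nat (p ^ Suc k) dvd
    (\<Sum>xs\<in>words (carrier G) (p ^ Suc k * m) - {xs \<in> words (carrier G) (p * (p ^ k * m)). rotate (p ^ k * m) xs = xs}. f xs)"
proof (rule sum_free_orbits[OF p, where s = "rotate m"])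
  have it: "(rotate m ^^ i) xs = rotate (i * m) xs" for i and xs :: "'a list"
    by (induction i) (auto simp: rotate_rotate)
  let ?S = "words (carrier G) (p ^ Suc k * m) - {xs \<in> words (carrier G) (p * (p ^ k * m)). rotate (p ^ k * m) xs = xs}"
  fix xs assume xs: "xs \<in> ?S"
  have len: "length xs = p ^ Suc k * m" using xs by (simp add: words_def)
  show "(rotate m ^^ (p ^ Suc k)) xs = xs" unfolding it using len by (simp add: rotate_id)
  have ne: "rotate (p ^ k * m) xs \<noteq> xs" using xs by (auto simp: mult.assoc)
  thus "(rotate m ^^ (p ^ (Suc k - 1))) xs \<noteq> xs" unfolding it by simp
  have "rotate (p ^ k * m) (rotate m xs) \<noteq> rotate m xs"
  proof
    assume "rotate (p ^ k * m) (rotate m xs) = rotate m xs"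
    hence "rotate m (rotate (p ^ k * m) xs) = rotate m xs" by (simp add: rotate_rotate add.commute)
    hence "rotate (length xs * m - m) (rotate m (rotate (p ^ k * m) xs)) = rotate (length xs * m - m) (rotate m xs)" by simp
    moreover have "rotate (length xs * m - m) (rotate m zs) = zs" if "length zs = length xs" for zs :: "'a list"
    proof (cases "length xs")
      case (Suc l)
      hence "rotate (length xs * m - m) (rotate m zs) = rotate (length zs * m) zs" using that by (simp add: rotate_rotate add.commute)
      thus ?thesis by (simp add: rotate_id)
    qed (use that in simp)
    ultimately show False using ne by simp
  qed
  thus "rotate m xs \<in> ?S" using xs by (auto simp: words_def)
  show "f (rotate m xs) = f xs" using inv xs by blast
qed (use fin in auto)

lemma periodic_words_sum:
  "(\<Sum>xs\<in>{xs \<in> words (carrier G) (p * q). rotate q xs = xs}. f xs) =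
     (\<Sum>zs\<in>words (carrier G) q. f (concat (replicate p zs)))"
proof -
  have "p > 0" using p by (rule prime_gt_0_nat)
  thus ?thesis
    by (simp only: periodic_words sum.reindex[OF inj_on_concat_replicate] o_def)
qed

lemma sum_words_split:
  fixes f :: "'a list \<Rightarrow> 'r"
  assumes "N = p * q"
  shows "(\<Sum>xs\<in>words (carrier G) N. f xs) =
    (\<Sum>xs\<in>words (carrier G) N - {xs \<in> words (carrier G) (p * q). rotate q xs = xs}. f xs) +
    (\<Sum>zs\<in>words (carrier G) q. f (concat (replicate p zs)))"
  unfolding periodic_words_sum[symmetric] using fin assms
  by (intro sum.subset_diff) auto

text \<open>For \<open>a\<close> the weight of a word, \<open>a\<^bsup>p^(e+1)\<^esup> - F(a)\<^bsup>p^e\<^esup>\<close> is divisible by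
  \<open>p\<^bsup>e+1\<^esup>\<close>, and summation over free orbits of rotations contributes the factor
  \<open>p\<^sup>k\<close>.  The periodic words are \<open>p\<close>-th powers of words for which \<open>k\<close> is smaller by 1 and \<open>e\<close> is
  larger by 1, so that the induction hypothesis gives the same exponent for them.\<close>

lemma power_sum_congruence_aux:
  "of_nat (p ^ (k + Suc e)) dvd (\<Sum>xs\<in>words (carrier G) (p ^ k * m).
     (wt xs ^ (p ^ Suc e) - F (wt xs) ^ (p ^ e)) * h (word_prod G xs [^] (p ^ Suc e)))"
proof (induction k arbitrary: e)
  case 0
  have "of_nat p ^ Suc e dvd wt xs ^ (p ^ Suc e) - F (wt xs) ^ (p ^ e)" for xs
  proof -
    have "of_nat p dvd wt xs ^ p - F (wt xs)" using F[of "wt xs"] by (metis dvd_minus_iff minus_diff_eq)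
    from dvd_power_prime_power_diff[OF p this, of e] show ?thesis by (simp flip: power_mult)
  qed
  thus ?case by (intro dvd_sum dvd_mult2) simp
next
  case (Suc k)
  let ?D = "\<lambda>e a. a ^ (p ^ Suc e) - F a ^ (p ^ e)"
  have "\<exists>c. ?D e a = of_nat p ^ Suc e * c" for a
  proof -
    have "of_nat p dvd a ^ p - F a" using F[of a] by (metis dvd_minus_iff minus_diff_eq)
    from dvd_power_prime_power_diff[OF p this, of e] show ?thesis by (simp add: dvd_def flip: power_mult)
  qed
  then obtain C where C: "\<And>a. ?D e a = of_nat p ^ Suc e * C a" by metis
  let ?S = "words (carrier G) (p ^ Suc k * m) - {xs \<in> words (carrier G) (p * (p ^ k * m)). rotate (p ^ k * m) xs = xs}"
  let ?hp = "\<lambda>xs. h (word_prod G xs [^] (p ^ Suc e))"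
  have "of_nat (p ^ Suc k) dvd (\<Sum>xs\<in>?S. C (wt xs) * ?hp xs)"
  proof (rule sum_nonperiodic)
    fix xs assume "xs \<in> words (carrier G) (p ^ Suc k * m)"
    hence "set xs \<subseteq> carrier G" by (simp add: words_def)
    thus "C (wt (rotate m xs)) * ?hp (rotate m xs) = C (wt xs) * ?hp xs"
      using class_function_pow_rotate[of h, OF h] by (simp add: wt_def prod_list_rotate)
  qed
  hence "of_nat p ^ Suc e * of_nat (p ^ Suc k) dvd of_nat p ^ Suc e * (\<Sum>xs\<in>?S. C (wt xs) * ?hp xs)"
    by (rule mult_dvd_mono[OF dvd_refl])
  moreover have "of_nat p ^ Suc e * (\<Sum>xs\<in>?S. C (wt xs) * ?hp xs) = (\<Sum>xs\<in>?S. ?D e (wt xs) * ?hp xs)"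
    unfolding C by (simp add: sum_distrib_left mult.assoc)
  moreover have "of_nat p ^ Suc e * of_nat (p ^ Suc k) = (of_nat (p ^ (Suc k + Suc e)) :: 'r)"
    by (simp add: power_add mult_ac)
  ultimately have 1: "of_nat (p ^ (Suc k + Suc e)) dvd (\<Sum>xs\<in>?S. ?D e (wt xs) * ?hp xs)" by simp
  have "(\<Sum>zs\<in>words (carrier G) (p ^ k * m). ?D e (wt (concat (replicate p zs))) * ?hp (concat (replicate p zs)))
      = (\<Sum>zs\<in>words (carrier G) (p ^ k * m). (wt zs ^ (p ^ Suc (Suc e)) - F (wt (concat (replicate p zs))) ^ (p ^ e)) * h (word_prod G zs [^] (p ^ Suc (Suc e))))"
    by (intro sum.cong refl)
       (auto simp: words_def wt_def prod_list_replicate word_prod_replicate nat_pow_pow simp flip: power_mult)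
  also have "\<dots> = (\<Sum>zs\<in>words (carrier G) (p ^ k * m). ?D (Suc e) (wt zs) * h (word_prod G zs [^] (p ^ Suc (Suc e))))"
    by (simp add: wt_def prod_list_replicate F_power flip: power_mult)
  finally have 2: "of_nat (p ^ (Suc k + Suc e)) dvd
     (\<Sum>zs\<in>words (carrier G) (p ^ k * m). ?D e (wt (concat (replicate p zs))) * ?hp (concat (replicate p zs)))"
    using Suc.IH[of "Suc e"] by simp
  show ?case
    using sum_words_split[of "p ^ Suc k * m" "p ^ k * m" "\<lambda>xs. ?D e (wt xs) * ?hp xs"] 1 2
    by (simp only: power_Suc mult.assoc simp_thms dvd_add)
qed

text \<open>The second sum is obtained from the \<open>p\<^sup>k m\<close>-th power by the map that applies \<open>F\<close> to coefficients
  and raises group elements to the \<open>p\<close>-th power.  The nonperiodic words contribute multiples of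
  \<open>p\<^bsup>k+1\<^esup>\<close> to the first sum; a periodic word, the \<open>p\<close>-th power of a word of weight \<open>a\<close>,
  contributes \<open>a\<^sup>p\<close> in place of \<open>F(a)\<close>, and the differences are summed in the preceding lemma.\<close>

lemma power_sum_congruence:
  "of_nat (p ^ Suc k) dvd
     (\<Sum>xs\<in>words (carrier G) (p ^ Suc k * m). wt xs * h (word_prod G xs)) -
     (\<Sum>zs\<in>words (carrier G) (p ^ k * m). F (wt zs) * h (word_prod G zs [^] p))"
proof -
  let ?f = "\<lambda>xs. wt xs * h (word_prod G xs)"
  let ?S = "words (carrier G) (p ^ Suc k * m) - {xs \<in> words (carrier G) (p * (p ^ k * m)). rotate (p ^ k * m) xs = xs}"
  have 1: "of_nat (p ^ Suc k) dvd (\<Sum>xs\<in>?S. ?f xs)"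
  proof (rule sum_nonperiodic)
    fix xs assume "xs \<in> words (carrier G) (p ^ Suc k * m)"
    hence xs: "set xs \<subseteq> carrier G" by (simp add: words_def)
    have "h (word_prod G (rotate m xs) [^] (1::nat)) = h (word_prod G xs [^] (1::nat))"
      using class_function_pow_rotate[of h xs m 1] h xs by blast
    thus "?f (rotate m xs) = ?f xs" using xs by (simp add: wt_def prod_list_rotate)
  qed
  have 2: "(\<Sum>zs\<in>words (carrier G) (p ^ k * m). ?f (concat (replicate p zs)))
      = (\<Sum>zs\<in>words (carrier G) (p ^ k * m). wt zs ^ p * h (word_prod G zs [^] p))"
    by (intro sum.cong refl) (auto simp: words_def wt_def prod_list_replicate word_prod_replicate)
  have 3: "of_nat (p ^ Suc k) dvd (\<Sum>zs\<in>words (carrier G) (p ^ k * m).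
      (wt zs ^ p - F (wt zs)) * h (word_prod G zs [^] p))"
    using power_sum_congruence_aux[of k 0 m] by simp
  have "(\<Sum>xs\<in>words (carrier G) (p ^ Suc k * m). ?f xs) -
     (\<Sum>zs\<in>words (carrier G) (p ^ k * m). F (wt zs) * h (word_prod G zs [^] p)) =
     (\<Sum>xs\<in>?S. ?f xs) + (\<Sum>zs\<in>words (carrier G) (p ^ k * m).
      (wt zs ^ p - F (wt zs)) * h (word_prod G zs [^] p))"
    using sum_words_split[of "p ^ Suc k * m" "p ^ k * m" ?f] 2
    by (simp add: left_diff_distrib sum_subtractf mult.assoc)
  thus ?thesis using dvd_add[OF 1 3] by (simp only:)
qed

end

section \<open>Extension of homomorphisms into an algebraically closed field\<close>

text \<open>A homomorphism from a subring of a field to the field, given by its graph, for which extension is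
  inclusion.  The last condition makes the graph single valued.\<close>

definition subring_graph :: "('k::field \<times> 'k) set \<Rightarrow> bool" where
  "subring_graph \<Gamma> \<longleftrightarrow> (1, 1) \<in> \<Gamma> \<and>
     (\<forall>a b c d. (a, b) \<in> \<Gamma> \<longrightarrow> (c, d) \<in> \<Gamma> \<longrightarrow> (a + c, b + d) \<in> \<Gamma> \<and> (a - c, b - d) \<in> \<Gamma> \<and> (a * c, b * d) \<in> \<Gamma>) \<and>
     (\<forall>b. (0, b) \<in> \<Gamma> \<longrightarrow> b = 0)"

lemma subring_graphD:
  assumes "subring_graph \<Gamma>"
  shows "(1, 1) \<in> \<Gamma>" "(0, 0) \<in> \<Gamma>"
    "(a, b) \<in> \<Gamma> \<Longrightarrow> (c, d) \<in> \<Gamma> \<Longrightarrow> (a + c, b + d) \<in> \<Gamma>"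
    "(a, b) \<in> \<Gamma> \<Longrightarrow> (c, d) \<in> \<Gamma> \<Longrightarrow> (a - c, b - d) \<in> \<Gamma>"
    "(a, b) \<in> \<Gamma> \<Longrightarrow> (c, d) \<in> \<Gamma> \<Longrightarrow> (a * c, b * d) \<in> \<Gamma>"
    "(0, b) \<in> \<Gamma> \<Longrightarrow> b = 0"
proof -
  have 1: "(1, 1) \<in> \<Gamma>" using assms by (simp add: subring_graph_def)
  hence "(1 - 1, 1 - 1) \<in> \<Gamma>" using assms unfolding subring_graph_def by blast
  thus "(0, 0) \<in> \<Gamma>" by simp
qed (use assms in \<open>unfold subring_graph_def, blast+\<close>)

lemma subring_graph_unique:
  assumes "subring_graph \<Gamma>" "(a, b) \<in> \<Gamma>" "(a, c) \<in> \<Gamma>"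
  shows "b = c"
proof -
  have "(a - a, b - c) \<in> \<Gamma>" by (rule subring_graphD(4)[OF assms])
  hence "b - c = 0" using subring_graphD(6)[OF assms(1), of "b - c"] by simp
  thus ?thesis by simp
qed

lemma subring_graph_sum:
  assumes "subring_graph \<Gamma>" "\<And>i. i \<in> I \<Longrightarrow> (f i, g i) \<in> \<Gamma>"
  shows "(\<Sum>i\<in>I. f i, \<Sum>i\<in>I. g i) \<in> \<Gamma>"
  using assms(2)
  by (induction I rule: infinite_finite_induct) (auto intro: subring_graphD[OF assms(1)])

text \<open>The polynomial \<open>Q\<close> arises from \<open>P\<close> by the homomorphism with graph \<open>\<Gamma>\<close> on the coefficients.\<close>

definition lifts :: "('k::field \<times> 'k) set \<Rightarrow> 'k poly \<Rightarrow> 'k poly \<Rightarrow> bool" where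
  "lifts \<Gamma> P Q \<longleftrightarrow> (\<forall>i. (Polynomial.coeff P i, Polynomial.coeff Q i) \<in> \<Gamma>)"

lemma lifts_0:
  assumes "subring_graph \<Gamma>" "lifts \<Gamma> 0 Q"
  shows "Q = 0"
  using assms subring_graphD(6)[OF assms(1)] by (intro poly_eqI) (simp add: lifts_def)

lemma lifts_eval:
  assumes "subring_graph \<Gamma>" "(a, b) \<in> \<Gamma>" "lifts \<Gamma> P Q"
  shows "(poly P a, poly Q b) \<in> \<Gamma>"
  using assms(3)
proof (induction P arbitrary: Q)
  case 0
  have "Q = 0" using lifts_0[OF assms(1)] 0 by blast
  thus ?case using subring_graphD(2)[OF assms(1)] by simp
next
  case (pCons c P)
  obtain d Q' where Q: "Q = pCons d Q'" by (cases Q)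
  have "(c, d) \<in> \<Gamma>" using pCons.prems[unfolded lifts_def, rule_format, of 0] by (simp add: Q)
  moreover have "lifts \<Gamma> P Q'"
    unfolding lifts_def
  proof
    fix i show "(Polynomial.coeff P i, Polynomial.coeff Q' i) \<in> \<Gamma>"
      using pCons.prems[unfolded lifts_def, rule_format, of "Suc i"] by (simp add: Q)
  qed
  hence "(a * poly P a, b * poly Q' b) \<in> \<Gamma>"
    using pCons.IH assms subring_graphD(5) by blast
  ultimately show ?case using subring_graphD(3)[OF assms(1)] by (simp add: Q)
qed

lemma lifts_exists:
  assumes "subring_graph \<Gamma>" "\<And>i. Polynomial.coeff P i \<in> Domain \<Gamma>"
  shows "\<exists>Q. lifts \<Gamma> P Q"
proof -
  define s where "s x = (if x = 0 then 0 else SOME y. (x, y) \<in> \<Gamma>)" for x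
  have "(x, s x) \<in> \<Gamma>" if "x \<in> Domain \<Gamma>" for x
    using that subring_graphD(2)[OF assms(1)] by (auto simp: s_def intro: someI)
  hence "lifts \<Gamma> P (map_poly s P)"
    using assms(2) by (simp add: lifts_def coeff_map_poly s_def)
  thus ?thesis ..
qed

lemma lifts_add: "subring_graph \<Gamma> \<Longrightarrow> lifts \<Gamma> P Q \<Longrightarrow> lifts \<Gamma> P' Q' \<Longrightarrow> lifts \<Gamma> (P + P') (Q + Q')"
  by (simp add: lifts_def subring_graphD(3))

lemma lifts_diff: "subring_graph \<Gamma> \<Longrightarrow> lifts \<Gamma> P Q \<Longrightarrow> lifts \<Gamma> P' Q' \<Longrightarrow> lifts \<Gamma> (P - P') (Q - Q')"
  by (simp add: lifts_def subring_graphD(4))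

lemma lifts_mult: "subring_graph \<Gamma> \<Longrightarrow> lifts \<Gamma> P Q \<Longrightarrow> lifts \<Gamma> P' Q' \<Longrightarrow> lifts \<Gamma> (P * P') (Q * Q')"
  unfolding lifts_def coeff_mult by (intro allI subring_graph_sum subring_graphD(5)) auto

lemma lifts_monom: "subring_graph \<Gamma> \<Longrightarrow> (c, d) \<in> \<Gamma> \<Longrightarrow> lifts \<Gamma> (Polynomial.monom c n) (Polynomial.monom d n)"
  by (simp add: lifts_def subring_graphD(2))

text \<open>The condition on inverses makes the domain of \<open>\<Gamma>0\<close> a field; everything is algebraic over it.\<close>

locale hom_graph =
  fixes \<Gamma>0 :: "('k::alg_closed_field \<times> 'k) set"
  assumes base: "subring_graph \<Gamma>0"
    and base_inverse: "\<And>a b. (a, b) \<in> \<Gamma>0 \<Longrightarrow> a \<noteq> 0 \<Longrightarrow> (inverse a, inverse b) \<in> \<Gamma>0"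
    and algebraic: "\<And>x. \<exists>P. P \<noteq> 0 \<and> (\<forall>i. Polynomial.coeff P i \<in> Domain \<Gamma>0) \<and> poly P x = 0"
begin

text \<open>After division by a power of \<open>a\<close>, the algebraic equation of \<open>a\<close> over the field has a nonzero constant
  term \<open>c\<close>.  The equation \<open>c + a Q(a) = 0\<close> shows that \<open>a\<inverse> = - Q(a) c\<inverse>\<close>, and its image
  under the homomorphism shows the same for \<open>b\<close>.\<close>

lemma graph_inverse:
  assumes \<Gamma>: "subring_graph \<Gamma>" "\<Gamma>0 \<subseteq> \<Gamma>" and ab: "(a, b) \<in> \<Gamma>" "a \<noteq> 0"
  shows "(inverse a, inverse b) \<in> \<Gamma>"
proof -
  have ex: "\<exists>c Q. c \<noteq> 0 \<and> (\<forall>i. Polynomial.coeff (pCons c Q) i \<in> Domain \<Gamma>0) \<and> poly (pCons c Q) a = 0"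
    if "P \<noteq> 0" "\<forall>i. Polynomial.coeff P i \<in> Domain \<Gamma>0" "poly P a = 0" for P
    using that
  proof (induction P)
    case (pCons c P)
    show ?case
    proof (cases "c = 0")
      case True
      have "Polynomial.coeff P i \<in> Domain \<Gamma>0" for i
        using pCons.prems(2)[rule_format, of "Suc i"] by simp
      moreover have "P \<noteq> 0" using pCons.prems(1) True by simp
      moreover have "poly P a = 0" using pCons.prems(3) True ab(2) by simp
      ultimately show ?thesis using pCons.IH by blast
    next
      case False
      show ?thesis by (intro exI[of _ c] exI[of _ P] conjI False pCons.prems)
    qed
  qed simp
  obtain P where "P \<noteq> 0" "\<forall>i. Polynomial.coeff P i \<in> Domain \<Gamma>0" "poly P a = 0"
    using algebraic[of a] by blast
  from ex[OF this] obtain c Q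
    where cQ: "c \<noteq> 0" "\<And>i. Polynomial.coeff (pCons c Q) i \<in> Domain \<Gamma>0" "poly (pCons c Q) a = 0"
    by blast
  obtain d Q' where dQ: "lifts \<Gamma>0 (pCons c Q) (pCons d Q')"
    using lifts_exists[OF base cQ(2)] by (metis pCons_cases)
  have cd: "(c, d) \<in> \<Gamma>0" using dQ[unfolded lifts_def, rule_format, of 0] by simp
  have "(c * inverse c, d * inverse d) \<in> \<Gamma>0"
    using subring_graphD(5)[OF base cd base_inverse[OF cd cQ(1)]] .
  hence "d * inverse d = 1"
    using subring_graph_unique[OF base _ subring_graphD(1)[OF base]] cQ(1) by simp
  hence d: "d \<noteq> 0" by auto
  have lQ: "lifts \<Gamma> Q Q'"
    unfolding lifts_def
  proof
    fix i show "(Polynomial.coeff Q i, Polynomial.coeff Q' i) \<in> \<Gamma>"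
      using dQ[unfolded lifts_def, rule_format, of "Suc i"] \<Gamma>(2) by auto
  qed
  have "lifts \<Gamma> (pCons c Q) (pCons d Q')" using dQ \<Gamma>(2) by (auto simp: lifts_def)
  from lifts_eval[OF \<Gamma>(1) ab(1) this] have z: "d + b * poly Q' b = 0"
    using cQ(3) subring_graphD(6)[OF \<Gamma>(1)] by simp
  have b: "b \<noteq> 0" using z d by auto
  have "(inverse c, inverse d) \<in> \<Gamma>" using base_inverse[OF cd cQ(1)] \<Gamma>(2) by blast
  from subring_graphD(5)[OF \<Gamma>(1) lifts_eval[OF \<Gamma>(1) ab(1) lQ] this]
  have "(0 - poly Q a * inverse c, 0 - poly Q' b * inverse d) \<in> \<Gamma>"
    by (rule subring_graphD(4)[OF \<Gamma>(1) subring_graphD(2)[OF \<Gamma>(1)]])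
  moreover have "0 - poly Q a * inverse c = inverse a"
  proof -
    have "a * poly Q a = - c" using cQ(3) by (simp add: eq_neg_iff_add_eq_0 add.commute)
    thus ?thesis using ab(2) cQ(1) by (simp add: field_simps)
  qed
  moreover have "0 - poly Q' b * inverse d = inverse b"
  proof -
    have "b * poly Q' b = - d" using z by (simp add: eq_neg_iff_add_eq_0 add.commute)
    thus ?thesis using b d by (simp add: field_simps)
  qed
  ultimately show ?thesis by simp
qed

text \<open>If \<open>M\<close> is the minimal polynomial of \<open>\<alpha>\<close> and \<open>\<beta>\<close> is a root of its image under the
  homomorphism, then \<open>\<alpha> \<mapsto> \<beta>\<close> defines an extension.\<close>

lemma graph_extend:
  assumes \<Gamma>: "subring_graph \<Gamma>" "\<Gamma>0 \<subseteq> \<Gamma>"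
  shows "\<exists>\<Gamma>'. subring_graph \<Gamma>' \<and> \<Gamma> \<subseteq> \<Gamma>' \<and> \<alpha> \<in> Domain \<Gamma>'"
proof -
  define A where "A = {P. P \<noteq> 0 \<and> (\<forall>i. Polynomial.coeff P i \<in> Domain \<Gamma>) \<and> poly P \<alpha> = 0}"
  obtain P0 where P0: "P0 \<noteq> 0" "\<forall>i. Polynomial.coeff P0 i \<in> Domain \<Gamma>0" "poly P0 \<alpha> = 0"
    using algebraic[of \<alpha>] by blast
  have "Polynomial.coeff P0 i \<in> Domain \<Gamma>" for i
    by (rule subsetD[OF Domain_mono[OF \<Gamma>(2)] P0(2)[rule_format]])
  hence "P0 \<in> A" using P0(1,3) by (simp add: A_def)
  then obtain M0 where M0: "M0 \<in> A" "\<And>P. P \<in> A \<Longrightarrow> Polynomial.degree M0 \<le> Polynomial.degree P"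
    using ex_has_least_nat[of "\<lambda>P. P \<in> A" P0 Polynomial.degree] by metis
  define M where "M = Polynomial.smult (inverse (Polynomial.lead_coeff M0)) M0"
  have M00: "M0 \<noteq> 0" "\<And>i. Polynomial.coeff M0 i \<in> Domain \<Gamma>" "poly M0 \<alpha> = 0" using M0(1) by (auto simp: A_def)
  have lcM: "Polynomial.lead_coeff M = 1" "poly M \<alpha> = 0" "Polynomial.degree M = Polynomial.degree M0"
    using M00 by (simp_all add: M_def)
  have "Polynomial.coeff M i \<in> Domain \<Gamma>" for i
  proof -
    obtain l where l: "(Polynomial.lead_coeff M0, l) \<in> \<Gamma>" using M00(2) by blast
    obtain c where "(Polynomial.coeff M0 i, c) \<in> \<Gamma>" using M00(2) by blast
    moreover have "(inverse (Polynomial.lead_coeff M0), inverse l) \<in> \<Gamma>"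
      using graph_inverse[OF \<Gamma> l] M00(1) by simp
    ultimately have "(inverse (Polynomial.lead_coeff M0) * Polynomial.coeff M0 i, inverse l * c) \<in> \<Gamma>"
      using subring_graphD(5)[OF \<Gamma>(1)] by blast
    thus ?thesis by (auto simp: M_def)
  qed
  then obtain M' where M': "lifts \<Gamma> M M'" using lifts_exists[OF \<Gamma>(1)] by blast
  define d where "d = Polynomial.degree M"
  have M'd: "Polynomial.coeff M' d = 1"
    using M'[unfolded lifts_def, rule_format, of d] lcM(1) subring_graph_unique[OF \<Gamma>(1) _ subring_graphD(1)[OF \<Gamma>(1)]]
    by (simp add: d_def)
  have d0: "d > 0"
  proof (rule ccontr)
    assume "\<not> d > 0"
    hence "Polynomial.degree M = 0" by (simp add: d_def)
    then obtain c where "M = [:c:]" by (rule degree_eq_zeroE)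
    thus False using lcM(1,2) by simp
  qed
  have "Polynomial.degree M' \<ge> d" using M'd by (intro le_degree) simp
  hence "Polynomial.degree M' > 0" using d0 by simp
  then obtain \<beta> where \<beta>: "poly M' \<beta> = 0" using alg_closed_imp_poly_has_root by blast
  \<comment> \<open>Division by \<open>M\<close>, performed on \<open>P\<close> and on its image \<open>Q\<close> at the same time, so that \<open>M'\<close> divides \<open>Q\<close>.\<close>
  have sv: "poly Q \<beta> = 0" if "lifts \<Gamma> P Q" "poly P \<alpha> = 0" for P Q
    using that
  proof (induction "Polynomial.degree P" arbitrary: P Q rule: less_induct)
    case less
    show ?case
    proof (cases "P = 0")
      case True
      hence "Q = 0" using lifts_0[OF \<Gamma>(1)] less.prems(1) by blast
      thus ?thesis by simp
    next
      case False
      define n where "n = Polynomial.degree P"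
      have "P \<in> A" using False less.prems by (auto simp: A_def lifts_def)
      hence nd: "d \<le> n" using M0(2) lcM(3) by (simp add: d_def n_def)
      define c where "c = Polynomial.coeff P n"
      define c' where "c' = Polynomial.coeff Q n"
      define P' where "P' = P - Polynomial.monom c (n - d) * M"
      define Q' where "Q' = Q - Polynomial.monom c' (n - d) * M'"
      have cc: "(c, c') \<in> \<Gamma>" using less.prems(1) by (simp add: lifts_def c_def c'_def)
      have l: "lifts \<Gamma> P' Q'"
        unfolding P'_def Q'_def
        by (intro lifts_diff lifts_mult lifts_monom \<Gamma>(1) less.prems(1) M' cc)
      have z: "poly P' \<alpha> = 0" using less.prems(2) lcM(2) by (simp add: P'_def)
      have "poly Q' \<beta> = 0"
      proof (cases "P' = 0")
        case True
        hence "Q' = 0" using lifts_0[OF \<Gamma>(1)] l by blast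
        thus ?thesis by simp
      next
        case P'0: False
        have "Polynomial.degree (Polynomial.monom c (n - d) * M) \<le> n - d + d"
          by (rule order_trans[OF degree_mult_le]) (simp add: degree_monom_le d_def add_mono)
        hence "Polynomial.degree P' \<le> n" unfolding P'_def using nd by (intro degree_diff_le) (auto simp: n_def)
        moreover have "Polynomial.coeff P' n = 0"
        proof -
          have "Polynomial.coeff (Polynomial.monom c (n - d) * M) n = c * Polynomial.coeff M (n - (n - d))"
            using nd by (subst coeff_monom_mult) auto
          thus ?thesis using nd lcM(1) by (simp add: P'_def c_def d_def)
        qed
        moreover have "Polynomial.coeff P' (Polynomial.degree P') \<noteq> 0" using P'0 by simp
        ultimately have "Polynomial.degree P' < n" by (metis le_neq_implies_less)
        thus ?thesis using less.hyps l z by (simp add: n_def)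
      qed
      thus ?thesis using \<beta> by (simp add: Q'_def)
    qed
  qed
  define \<Gamma>' where "\<Gamma>' = {(poly P \<alpha>, poly Q \<beta>) | P Q. lifts \<Gamma> P Q}"
  have lc: "lifts \<Gamma> [:a:] [:b:]" if "(a, b) \<in> \<Gamma>" for a b
    using lifts_monom[OF \<Gamma>(1) that, of 0] by (simp add: monom_0)
  have sub: "\<Gamma> \<subseteq> \<Gamma>'"
  proof (rule subrelI)
    fix a b assume "(a, b) \<in> \<Gamma>"
    from lc[OF this] show "(a, b) \<in> \<Gamma>'"
      unfolding \<Gamma>'_def by (intro CollectI exI[of _ "[:a:]"] exI[of _ "[:b:]"]) simp
  qed
  have "subring_graph \<Gamma>'"
    unfolding subring_graph_def
  proof (intro conjI allI impI)
    show "(1, 1) \<in> \<Gamma>'" using sub subring_graphD(1)[OF \<Gamma>(1)] by blast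
    show "b = 0" if "(0, b) \<in> \<Gamma>'" for b using that sv by (auto simp: \<Gamma>'_def)
    fix a b c e assume "(a, b) \<in> \<Gamma>'" "(c, e) \<in> \<Gamma>'"
    then obtain P Q P' Q' where PQ: "lifts \<Gamma> P Q" "a = poly P \<alpha>" "b = poly Q \<beta>"
       "lifts \<Gamma> P' Q'" "c = poly P' \<alpha>" "e = poly Q' \<beta>" by (auto simp: \<Gamma>'_def)
    show "(a + c, b + e) \<in> \<Gamma>'" unfolding \<Gamma>'_def
      by (intro CollectI exI[of _ "P + P'"] exI[of _ "Q + Q'"]) (use PQ lifts_add[OF \<Gamma>(1)] in auto)
    show "(a - c, b - e) \<in> \<Gamma>'" unfolding \<Gamma>'_def
      by (intro CollectI exI[of _ "P - P'"] exI[of _ "Q - Q'"]) (use PQ lifts_diff[OF \<Gamma>(1)] in auto)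
    show "(a * c, b * e) \<in> \<Gamma>'" unfolding \<Gamma>'_def
      by (intro CollectI exI[of _ "P * P'"] exI[of _ "Q * Q'"]) (use PQ lifts_mult[OF \<Gamma>(1)] in auto)
  qed
  moreover have "(\<alpha>, \<beta>) \<in> \<Gamma>'"
    unfolding \<Gamma>'_def
    by (intro CollectI exI[of _ "Polynomial.monom 1 1"])
       (use lifts_monom[OF \<Gamma>(1) subring_graphD(1)[OF \<Gamma>(1)]] in \<open>auto simp: poly_monom\<close>)
  ultimately show ?thesis using sub by blast
qed

text \<open>A maximal extension is defined everywhere.\<close>

theorem hom_extension:
  "\<exists>\<sigma>::'k \<Rightarrow> 'k. \<sigma> 1 = 1 \<and> (\<forall>x y. \<sigma> (x + y) = \<sigma> x + \<sigma> y) \<and> (\<forall>x y. \<sigma> (x * y) = \<sigma> x * \<sigma> y) \<and>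
     (\<forall>(a, b)\<in>\<Gamma>0. \<sigma> a = b)"
proof -
  define A where "A = {\<Gamma>. subring_graph \<Gamma> \<and> \<Gamma>0 \<subseteq> \<Gamma>}"
  have "\<exists>\<Gamma>\<in>A. \<forall>\<Gamma>'\<in>A. \<Gamma> \<subseteq> \<Gamma>' \<longrightarrow> \<Gamma>' = \<Gamma>"
  proof (rule subset_Zorn_nonempty)
    show "A \<noteq> {}" using base by (auto simp: A_def)
    fix C assume C: "C \<noteq> {}" "subset.chain A C"
    have CA: "\<And>\<Gamma>. \<Gamma> \<in> C \<Longrightarrow> subring_graph \<Gamma> \<and> \<Gamma>0 \<subseteq> \<Gamma>"
      using C(2) by (auto simp: subset.chain_def A_def)
    have tot: "\<Gamma> \<subseteq> \<Gamma>' \<or> \<Gamma>' \<subseteq> \<Gamma>" if "\<Gamma> \<in> C" "\<Gamma>' \<in> C" for \<Gamma> \<Gamma>'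
      using C(2) that by (auto simp: subset_chain_def)
    have both: "\<exists>\<Gamma>\<in>C. x \<in> \<Gamma> \<and> y \<in> \<Gamma>" if "x \<in> \<Union>C" "y \<in> \<Union>C" for x y
      using that tot by blast
    have "subring_graph (\<Union>C)"
      unfolding subring_graph_def
    proof (intro conjI allI impI)
      show "(1, 1) \<in> \<Union>C" using C(1) CA subring_graphD(1) by blast
      show "b = 0" if "(0, b) \<in> \<Union>C" for b using that CA subring_graphD(6) by blast
      fix a b c d assume "(a, b) \<in> \<Union>C" "(c, d) \<in> \<Union>C"
      then obtain \<Gamma> where g: "\<Gamma> \<in> C" "(a, b) \<in> \<Gamma>" "(c, d) \<in> \<Gamma>" using both by blast
      show "(a + c, b + d) \<in> \<Union>C" "(a - c, b - d) \<in> \<Union>C" "(a * c, b * d) \<in> \<Union>C"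
        using g CA[OF g(1)] subring_graphD(3-5)[of \<Gamma>] by blast+
    qed
    thus "\<Union>C \<in> A" using C(1) CA by (auto simp: A_def)
  qed
  then obtain \<Gamma> where \<Gamma>: "subring_graph \<Gamma>" "\<Gamma>0 \<subseteq> \<Gamma>"
    and max: "\<And>\<Gamma>'. subring_graph \<Gamma>' \<Longrightarrow> \<Gamma> \<subseteq> \<Gamma>' \<Longrightarrow> \<Gamma>' = \<Gamma>"
    by (auto simp: A_def)
  have "\<exists>y. (x, y) \<in> \<Gamma>" for x
    using graph_extend[OF \<Gamma>, of x] max by (metis DomainE)
  then obtain \<sigma> where \<sigma>: "\<And>x. (x, \<sigma> x) \<in> \<Gamma>" by metis
  have eq: "\<sigma> x = y" if "(x, y) \<in> \<Gamma>" for x y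
    using subring_graph_unique[OF \<Gamma>(1) \<sigma> that] .
  show ?thesis
  proof (intro exI[of _ \<sigma>] conjI allI)
    show "\<sigma> 1 = 1" by (intro eq subring_graphD(1)[OF \<Gamma>(1)])
    show "\<sigma> (x + y) = \<sigma> x + \<sigma> y" "\<sigma> (x * y) = \<sigma> x * \<sigma> y" for x y
      by (intro eq subring_graphD(3,5)[OF \<Gamma>(1)] \<sigma>)+
    show "\<forall>(a, b)\<in>\<Gamma>0. \<sigma> a = b" using \<Gamma>(2) eq by auto
  qed
qed

end

section \<open>Adams operations preserve virtual characters\<close>

lemma prod_sum_words:
  fixes f :: "nat \<Rightarrow> 'a \<Rightarrow> 'k::comm_semiring_1"
  shows "(\<Prod>i<m. \<Sum>a\<in>A. f i a) = (\<Sum>xs\<in>words A m. \<Prod>i<m. f i (xs ! i))"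
proof (induction m arbitrary: f)
  case (Suc m)
  have "(\<Prod>i<Suc m. \<Sum>a\<in>A. f i a) = (\<Sum>a\<in>A. f 0 a) * (\<Prod>i<m. \<Sum>a\<in>A. f (Suc i) a)"
    by (simp only: prod.lessThan_Suc_shift)
  also have "\<dots> = (\<Sum>a\<in>A. f 0 a) * (\<Sum>xs\<in>words A m. \<Prod>i<m. f (Suc i) (xs ! i))"
    by (simp only: Suc.IH)
  also have "\<dots> = (\<Sum>xs\<in>words A (Suc m). \<Prod>i<Suc m. f i (xs ! i))"
    by (simp only: sum_words_Suc prod.lessThan_Suc_shift nth_Cons_0 nth_Cons_Suc sum_product)
  finally show ?case .
qed simp

lemma prod_delta_words:
  assumes "length xs = p" "length ys = p"
  shows "(\<Prod>i<p. if xs ! i = ys ! i then 1 else 0 :: 'k::comm_semiring_1) = (if xs = ys then 1 else 0)"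
proof (cases "xs = ys")
  case False
  then obtain i where "i < p" "xs ! i \<noteq> ys ! i" using assms nth_equalityI by metis
  hence "(\<Prod>i<p. if xs ! i = ys ! i then 1 else 0 :: 'k) = 0"
    by (intro prod_zero) auto
  thus ?thesis using False by simp
qed simp

text \<open>The product of the entries of a matrix along a walk from \<open>x\<close> through \<open>ys\<close> to \<open>b\<close>.  Entries of powers
  of the matrix are sums of these products over walks.\<close>

fun path_weight :: "('a \<Rightarrow> 'a \<Rightarrow> 'k::comm_semiring_1) \<Rightarrow> 'a \<Rightarrow> 'a list \<Rightarrow> 'a \<Rightarrow> 'k" where
  "path_weight M x [] b = M b x"
| "path_weight M x (y # ys) b = path_weight M y ys b * M y x"

lemma path_weight_prod:
  "(\<Prod>j<Suc (length ys). M ((x # ys @ [b]) ! Suc j) ((x # ys @ [b]) ! j)) = path_weight M x ys b"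
proof (induction ys arbitrary: x)
  case (Cons y ys)
  have "(\<Prod>j<Suc (length (y # ys)). M ((x # (y # ys) @ [b]) ! Suc j) ((x # (y # ys) @ [b]) ! j)) =
     M y x * (\<Prod>j<Suc (length ys). M ((y # ys @ [b]) ! Suc j) ((y # ys @ [b]) ! j))"
    by (subst prod.lessThan_Suc_shift) simp
  thus ?case by (simp only: Cons.IH) (simp add: mult.commute)
qed simp

lemma sum_path_weight:
  fixes A :: "'k::comm_ring_1 mat"
  assumes A: "A \<in> carrier_mat n n" and "x < n" "b < n"
  shows "(\<Sum>ys\<in>words {..<n} m. path_weight (\<lambda>i j. A $$ (i, j)) x ys b) = (A ^\<^sub>m Suc m) $$ (b, x)"
  using assms(2)
proof (induction m arbitrary: x)
  case 0
  thus ?case using assms by simp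
next
  case (Suc m)
  have c: "A ^\<^sub>m Suc m \<in> carrier_mat n n" using A by (rule pow_carrier_mat)
  have "(\<Sum>ys\<in>words {..<n} (Suc m). path_weight (\<lambda>i j. A $$ (i, j)) x ys b) =
     (\<Sum>y<n. (A ^\<^sub>m Suc m) $$ (b, y) * A $$ (y, x))"
    unfolding sum_words_Suc path_weight.simps sum_distrib_right[symmetric]
    by (intro sum.cong refl) (simp only: Suc.IH lessThan_iff)
  also have "\<dots> = (A ^\<^sub>m Suc m * A) $$ (b, x)"
    using c A assms Suc.prems by (simp add: scalar_prod_def atLeast0LessThan)
  finally show ?case by simp
qed

text \<open>The trace of the cyclic shift composed with the \<open>p\<close>-th tensor power of \<open>A\<close> is a sum over closed walks
  of length \<open>p\<close>.\<close>

lemma cyclic_sum_mtrace: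
  fixes A :: "'k::comm_ring_1 mat"
  assumes A: "A \<in> carrier_mat n n" and p: "p > 0"
  shows "(\<Sum>xs\<in>words {..<n} p. \<Prod>j<p. A $$ (xs ! (Suc j mod p), xs ! j)) = mtrace (A ^\<^sub>m p)"
proof -
  obtain m where m: "p = Suc m" using p by (cases p) auto
  have c: "A ^\<^sub>m p \<in> carrier_mat n n" using A by (rule pow_carrier_mat)
  have cyc: "(\<Prod>j<p. A $$ ((x # ys) ! (Suc j mod p), (x # ys) ! j)) = path_weight (\<lambda>i j. A $$ (i, j)) x ys x"
    if "length ys = m" for x ys
  proof -
    have "(\<Prod>j<p. A $$ ((x # ys) ! (Suc j mod p), (x # ys) ! j)) =
        (\<Prod>j<Suc (length ys). A $$ ((x # ys @ [x]) ! Suc j, (x # ys @ [x]) ! j))"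
    proof (rule prod.cong)
      fix j assume "j \<in> {..<Suc (length ys)}"
      hence j: "j \<le> m" using that by simp
      have "(x # ys) ! (Suc j mod p) = (x # ys @ [x]) ! Suc j"
        using j that m by (cases "j = m") (auto simp: nth_append)
      moreover have "(x # ys) ! j = (x # ys @ [x]) ! j"
        using j that by (cases j) (auto simp: nth_append)
      ultimately show "A $$ ((x # ys) ! (Suc j mod p), (x # ys) ! j) = A $$ ((x # ys @ [x]) ! Suc j, (x # ys @ [x]) ! j)"
        by simp
    qed (simp add: that m)
    thus ?thesis using path_weight_prod[of "\<lambda>i j. A $$ (i, j)" x ys x] by simp
  qed
  have "(\<Sum>xs\<in>words {..<n} p. \<Prod>j<p. A $$ (xs ! (Suc j mod p), xs ! j)) =
     (\<Sum>x<n. \<Sum>ys\<in>words {..<n} m. \<Prod>j<p. A $$ ((x # ys) ! (Suc j mod p), (x # ys) ! j))"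
    unfolding m by (rule sum_words_Suc)
  also have "\<dots> = (\<Sum>x<n. \<Sum>ys\<in>words {..<n} m. path_weight (\<lambda>i j. A $$ (i, j)) x ys x)"
    by (intro sum.cong refl cyc) (simp add: words_def)
  also have "\<dots> = (\<Sum>x<n. (A ^\<^sub>m p) $$ (x, x))"
    using sum_path_weight[OF A] m by simp
  also have "\<dots> = mtrace (A ^\<^sub>m p)" unfolding mtrace_def using c by (metis carrier_matD(1))
  finally show ?thesis .
qed

lemma bij_mult_mod:
  assumes "coprime t (p::nat)" "p > 0"
  shows "bij_betw (\<lambda>j. t * j mod p) {..<p} {..<p}"
proof -
  have "inj_on (\<lambda>j. t * j mod p) {..<p}"
  proof (rule inj_onI)
    fix i j assume ij: "i \<in> {..<p}" "j \<in> {..<p}" "t * i mod p = t * j mod p"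
    hence "[t * i = t * j] (mod p)" by (simp add: cong_def)
    hence "[i = j] (mod p)" using assms(1) by (simp add: cong_mult_lcancel_nat)
    thus "i = j" using ij by (simp add: cong_def)
  qed
  moreover have "(\<lambda>j. t * j mod p) ` {..<p} \<subseteq> {..<p}" using assms(2) by auto
  ultimately show ?thesis by (metis bij_betw_def endo_inj_surj finite_lessThan)
qed

text \<open>If the positions of a word are read in the order \<open>0, t, 2t, \<dots>\<close> modulo \<open>p\<close>, then rotation by \<open>t\<close>
  becomes rotation by 1.\<close>

lemma rotated_sum_mtrace:
  fixes A :: "'k::comm_ring_1 mat"
  assumes A: "A \<in> carrier_mat n n" and p: "p > 0" and t: "coprime t p"
  shows "(\<Sum>xs\<in>words {..<n} p. \<Prod>i<p. A $$ (rotate t xs ! i, xs ! i)) = mtrace (A ^\<^sub>m p)"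
proof -
  define \<pi> where "\<pi> xs = map (\<lambda>j. xs ! (t * j mod p)) [0..<p]" for xs :: "nat list"
  note bij = bij_mult_mod[OF t p]
  have nth: "\<pi> xs ! j = xs ! (t * j mod p)" if "j < p" for xs j using that by (simp add: \<pi>_def)
  have maps: "\<pi> xs \<in> words {..<n} p" if "xs \<in> words {..<n} p" for xs
  proof -
    have "xs ! (t * j mod p) \<in> {..<n}" for j
    proof -
      have "xs ! (t * j mod p) \<in> set xs" using that p by (intro nth_mem) (simp add: words_def)
      thus ?thesis using that by (auto simp: words_def)
    qed
    thus ?thesis by (auto simp: words_def \<pi>_def)
  qed
  have "inj_on \<pi> (words {..<n} p)"
  proof (rule inj_onI)
    fix xs ys assume xy: "xs \<in> words {..<n} p" "ys \<in> words {..<n} p" "\<pi> xs = \<pi> ys"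
    show "xs = ys"
    proof (rule nth_equalityI)
      show "length xs = length ys" using xy by (simp add: words_def)
      fix i assume "i < length xs"
      hence "i \<in> (\<lambda>j. t * j mod p) ` {..<p}" using xy bij by (simp add: words_def bij_betw_def)
      then obtain j where "j < p" "i = t * j mod p" by auto
      thus "xs ! i = ys ! i" using nth xy(3) by metis
    qed
  qed
  hence bijw: "bij_betw \<pi> (words {..<n} p) (words {..<n} p)"
    using maps by (metis bij_betw_def endo_inj_surj finite_words finite_lessThan image_subsetI)
  have "(\<Prod>i<p. A $$ (rotate t xs ! i, xs ! i)) = (\<Prod>j<p. A $$ (\<pi> xs ! (Suc j mod p), \<pi> xs ! j))"
    if xs: "xs \<in> words {..<n} p" for xs
  proof -
    have len: "length xs = p" using xs by (simp add: words_def)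
    have "(\<Prod>i<p. A $$ (rotate t xs ! i, xs ! i)) =
       (\<Prod>j<p. A $$ (rotate t xs ! (t * j mod p), xs ! (t * j mod p)))"
      by (rule prod.reindex_bij_betw[OF bij, symmetric])
    also have "\<dots> = (\<Prod>j<p. A $$ (\<pi> xs ! (Suc j mod p), \<pi> xs ! j))"
    proof (rule prod.cong[OF refl])
      fix j assume j: "j \<in> {..<p}"
      have "rotate t xs ! (t * j mod p) = xs ! ((t + t * j mod p) mod p)"
        using p len by (subst nth_rotate) auto
      also have "(t + t * j mod p) mod p = t * (Suc j mod p) mod p"
        by (simp add: mod_simps)
      also have "xs ! \<dots> = \<pi> xs ! (Suc j mod p)" using p by (simp add: nth)
      finally show "A $$ (rotate t xs ! (t * j mod p), xs ! (t * j mod p)) = A $$ (\<pi> xs ! (Suc j mod p), \<pi> xs ! j)"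
        using j by (simp add: nth)
    qed
    finally show ?thesis .
  qed
  hence "(\<Sum>xs\<in>words {..<n} p. \<Prod>i<p. A $$ (rotate t xs ! i, xs ! i)) =
      (\<Sum>xs\<in>words {..<n} p. \<Prod>j<p. A $$ (\<pi> xs ! (Suc j mod p), \<pi> xs ! j))"
    by (rule sum.cong[OF refl])
  also have "\<dots> = (\<Sum>xs\<in>words {..<n} p. \<Prod>j<p. A $$ (xs ! (Suc j mod p), xs ! j))"
    by (rule sum.reindex_bij_betw[OF bijw, of "\<lambda>xs. \<Prod>j<p. A $$ (xs ! (Suc j mod p), xs ! j)"])
  also have "\<dots> = mtrace (A ^\<^sub>m p)" by (rule cyclic_sum_mtrace[OF A p])
  finally show ?thesis .
qed

lemma representation_pow:
  assumes "monoid G" "representation G n T" "g \<in> carrier G"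
  shows "T (g [^]\<^bsub>G\<^esub> (m::nat)) = T g ^\<^sub>m m"
proof -
  interpret monoid G by (rule assms(1))
  show ?thesis
    using assms by (induction m) (auto simp: representation_def)
qed

lemma char_of_mtrace:
  assumes "representation G n T" "g \<in> carrier G"
  shows "char_of G n T g = mtrace (T g)"
proof -
  have "T g \<in> carrier_mat n n" using assms by (simp add: representation_def)
  thus ?thesis using assms by (simp add: char_of_def mtrace_def)
qed

text \<open>The cyclic group of order \<open>p\<close> permutes the factors of the \<open>p\<close>-th tensor power of a representation with
  character \<open>\<chi>\<close>.  The trace of \<open>g\<close> composed with a rotation is \<open>\<chi>(g)\<^sup>p\<close> for the identity
  and \<open>\<chi>(g\<^sup>p)\<close> otherwise.  Therefore the isotypic parts for the roots of unity 1 and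
  \<open>w \<noteq> 1\<close> have the characters \<open>(\<chi>(g)\<^sup>p + (p - 1) \<chi>(g\<^sup>p)) / p\<close> and
  \<open>(\<chi>(g)\<^sup>p - \<chi>(g\<^sup>p)) / p\<close>, whose difference is \<open>\<chi>(g\<^sup>p)\<close>.\<close>

theorem adams_virtual:
  fixes T :: "'g \<Rightarrow> 'k::{alg_closed_field, field_char_0} mat"
  assumes G: "monoid G" and T: "representation G n T" and p: "Factorial_Ring.prime (p::nat)"
  obtains n1 T1 n2 T2 where "representation G n1 T1" "representation G n2 T2"
    "\<And>g. g \<in> carrier G \<Longrightarrow> char_of G n1 T1 g - char_of G n2 T2 g = char_of G n T (g [^]\<^bsub>G\<^esub> p)"
proof -
  interpret monoid G by (rule G)
  have p0: "p > 0" and p2: "p \<ge> 2" using p by (auto intro: prime_gt_0_nat prime_ge_2_nat)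
  define I where "I = words {..<n} p"
  define \<rho> where "\<rho> g xs ys = (\<Prod>i<p. T g $$ (xs ! i, ys ! i))" for g and xs ys :: "nat list"
  have len: "length xs = p" if "xs \<in> I" for xs using that by (simp add: I_def words_def)
  have ltn: "xs ! i < n" if "xs \<in> I" "i < p" for xs i
    using that by (auto simp: I_def words_def subset_iff)
  have Tc: "T g \<in> carrier_mat n n" if "g \<in> carrier G" for g using T that by (simp add: representation_def)
  have rep: "rep_on G I \<rho>"
    unfolding rep_on_def
  proof (intro conjI ballI)
    show "finite I" by (simp add: I_def)
    fix xs ys assume xy: "xs \<in> I" "ys \<in> I"
    have "\<rho> \<one>\<^bsub>G\<^esub> xs ys = (\<Prod>i<p. if xs ! i = ys ! i then 1 else 0)"
      unfolding \<rho>_def using T ltn xy by (intro prod.cong refl) (auto simp: representation_def)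
    thus "\<rho> \<one>\<^bsub>G\<^esub> xs ys = (if xs = ys then 1 else 0)" using prod_delta_words[OF len[OF xy(1)] len[OF xy(2)]] by metis
    fix g h assume gh: "g \<in> carrier G" "h \<in> carrier G"
    have "\<rho> (g \<otimes>\<^bsub>G\<^esub> h) xs ys = (\<Prod>i<p. \<Sum>k<n. T g $$ (xs ! i, k) * T h $$ (k, ys ! i))"
      unfolding \<rho>_def
    proof (rule prod.cong[OF refl])
      fix i assume "i \<in> {..<p}"
      hence "xs ! i < n" "ys ! i < n" using ltn xy by auto
      moreover have "T (g \<otimes>\<^bsub>G\<^esub> h) = T g * T h" using T gh by (simp add: representation_def)
      ultimately show "T (g \<otimes>\<^bsub>G\<^esub> h) $$ (xs ! i, ys ! i) = (\<Sum>k<n. T g $$ (xs ! i, k) * T h $$ (k, ys ! i))"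
        using Tc[OF gh(1)] Tc[OF gh(2)] by (simp add: scalar_prod_def atLeast0LessThan)
    qed
    also have "\<dots> = (\<Sum>zs\<in>I. \<rho> g xs zs * \<rho> h zs ys)"
      unfolding prod_sum_words I_def \<rho>_def by (simp only: prod.distrib)
    finally show "\<rho> (g \<otimes>\<^bsub>G\<^esub> h) xs ys = (\<Sum>zs\<in>I. \<rho> g xs zs * \<rho> h zs ys)" .
  qed
  have rot: "(rotate1 ^^ t) xs = rotate t xs" for t and xs :: "nat list" by (simp add: rotate_def)
  have s1: "rotate1 xs \<in> I" if "xs \<in> I" for xs using that by (simp add: I_def words_def)
  have s2: "(rotate1 ^^ p) xs = xs" if "xs \<in> I" for xs
    using len[OF that] by (simp add: rot rotate_id)
  have inv: "\<rho> g (rotate1 xs) (rotate1 ys) = \<rho> g xs ys" if "xs \<in> I" "ys \<in> I" for g xs ys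
  proof -
    have "bij_betw (\<lambda>i. Suc i mod p) {..<p} {..<p}"
    proof -
      have "inj_on (\<lambda>i. Suc i mod p) {..<p}"
      proof (rule inj_onI)
        fix i j assume ij: "i \<in> {..<p}" "j \<in> {..<p}" "Suc i mod p = Suc j mod p"
        hence "[i + 1 = j + 1] (mod p)" by (simp add: cong_def)
        hence "[i = j] (mod p)" by (simp only: cong_add_rcancel_nat)
        thus "i = j" using ij by (simp add: cong_def)
      qed
      moreover have "(\<lambda>i. Suc i mod p) ` {..<p} \<subseteq> {..<p}" using p0 by auto
      ultimately show ?thesis by (metis bij_betw_def endo_inj_surj finite_lessThan)
    qed
    from prod.reindex_bij_betw[OF this, of "\<lambda>i. T g $$ (xs ! i, ys ! i)"]
    have "(\<Prod>i<p. T g $$ (xs ! (Suc i mod p), ys ! (Suc i mod p))) = \<rho> g xs ys" by (simp only: \<rho>_def)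
    moreover have "\<rho> g (rotate1 xs) (rotate1 ys) = (\<Prod>i<p. T g $$ (xs ! (Suc i mod p), ys ! (Suc i mod p)))"
      unfolding \<rho>_def using len that by (intro prod.cong refl) (simp add: nth_rotate1)
    ultimately show ?thesis by simp
  qed
  \<comment> \<open>A primitive \<open>p\<close>-th root of unity is a root of \<open>1 + X + \<dots> + X\<^bsup>p-1\<^esup>\<close>.\<close>
  define q :: "'k poly" where "q = (\<Sum>i<p. Polynomial.monom 1 i)"
  have "Polynomial.coeff q (p - 1) = 1" using p0 by (simp add: q_def coeff_sum)
  hence "Polynomial.degree q \<ge> p - 1" by (intro le_degree) simp
  hence "Polynomial.degree q > 0" using p2 by simp
  then obtain w where "poly q w = 0" using alg_closed_imp_poly_has_root by blast
  hence w0: "(\<Sum>i<p. w ^ i) = 0" by (simp add: q_def poly_sum poly_monom)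
  have w: "w ^ p = 1" using power_diff_1_eq[of w p] w0 by simp
  define tr where "tr t g = (\<Sum>xs\<in>I. \<rho> g ((rotate1 ^^ t) xs) xs)" for t g
  have tr: "tr t g = char_of G n T (g [^]\<^bsub>G\<^esub> p)" if "g \<in> carrier G" "0 < t" "t < p" for t g
  proof -
    have "coprime t p" using prime_imp_coprime[OF p, of t] that by (simp add: coprime_commute nat_dvd_not_less)
    hence "tr t g = mtrace (T g ^\<^sub>m p)"
      unfolding tr_def rot \<rho>_def I_def by (rule rotated_sum_mtrace[OF Tc[OF that(1)] p0])
    also have "\<dots> = char_of G n T (g [^]\<^bsub>G\<^esub> p)"
      using that char_of_mtrace[OF T, of "g [^]\<^bsub>G\<^esub> p"] representation_pow[OF G T that(1)] by simp
    finally show ?thesis .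
  qed
  obtain n1 T1 where T1: "representation G n1 T1"
    "\<And>g. g \<in> carrier G \<Longrightarrow> char_of G n1 T1 g = (\<Sum>t<p. 1 ^ t * tr t g) / of_nat p"
    using cyclic_isotypic_rep[OF rep G s1 s2 p0 inv power_one] unfolding tr_def by blast
  obtain n2 T2 where T2: "representation G n2 T2"
    "\<And>g. g \<in> carrier G \<Longrightarrow> char_of G n2 T2 g = (\<Sum>t<p. w ^ t * tr t g) / of_nat p"
    using cyclic_isotypic_rep[OF rep G s1 s2 p0 inv w] unfolding tr_def by blast
  show thesis
  proof (rule that[OF T1(1) T2(1)])
    fix g assume g: "g \<in> carrier G"
    let ?c = "char_of G n T (g [^]\<^bsub>G\<^esub> p)"
    have "char_of G n1 T1 g - char_of G n2 T2 g = (\<Sum>t<p. (1 - w ^ t) * tr t g) / of_nat p"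
      by (simp add: T1(2)[OF g] T2(2)[OF g] left_diff_distrib sum_subtractf diff_divide_distrib)
    also have "(\<Sum>t<p. (1 - w ^ t) * tr t g) = (\<Sum>t<p. (1 - w ^ t) * ?c)"
    proof (rule sum.cong[OF refl])
      fix t assume "t \<in> {..<p}"
      thus "(1 - w ^ t) * tr t g = (1 - w ^ t) * ?c" using tr[OF g] by (cases "t = 0") auto
    qed
    also have "\<dots> = of_nat p * ?c"
      using w0 by (simp add: left_diff_distrib sum_subtractf flip: sum_distrib_right)
    finally show "char_of G n1 T1 g - char_of G n2 T2 g = ?c" using p0 by simp
  qed
qed

section \<open>Integral elements of the algebraic closure\<close>

instance fract :: ("{idom, ring_char_0}") field_char_0
proof
  show "inj (of_nat :: nat \<Rightarrow> 'a fract)"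
    by (rule injI) (simp add: of_nat_fract eq_fract)
qed

lemma to_Nc_simps [simp]:
  "to_Nc 0 = 0" "to_Nc 1 = 1" "to_Nc (a + b) = to_Nc a + to_Nc b" "to_Nc (a - b) = to_Nc a - to_Nc b"
  "to_Nc (- a) = - to_Nc a" "to_Nc (a * b) = to_Nc a * to_Nc b"
  "to_Nc a = to_Nc b \<longleftrightarrow> a = b" "to_Nc a = 0 \<longleftrightarrow> a = 0"
  for a b :: "'r::idom"
  by (simp_all add: to_Nc_def)

interpretation to_Nc_hom: inj_comm_ring_hom "to_Nc :: 'r::idom \<Rightarrow> 'r fract alg_closure"
  by unfold_locales auto

lemmas to_Nc_of_nat [simp] = to_Nc_hom.hom_of_nat
lemmas to_Nc_power [simp] = to_Nc_hom.hom_power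

definition integers :: "'r::idom fract alg_closure set" where
  "integers = {y. integral_over (range to_Nc) y}"

lemma integersI:
  fixes q :: "'r::idom poly"
  assumes "Polynomial.lead_coeff q = 1" "poly (map_poly to_Nc q) y = 0"
  shows "y \<in> integers"
  unfolding integers_def integral_over_def mem_Collect_eq
  by (intro exI[of _ "map_poly to_Nc q"]) (use assms in \<open>auto simp: coeff_map_poly\<close>)

lemma integersE:
  fixes y :: "'r::idom fract alg_closure"
  assumes "y \<in> integers"
  obtains q :: "'r poly" where "Polynomial.lead_coeff q = 1" "poly (map_poly to_Nc q) y = 0"
proof -
  obtain P where P: "Polynomial.lead_coeff P = 1" "\<And>i. Polynomial.coeff P i \<in> range (to_Nc :: 'r \<Rightarrow> _)" "poly P y = 0"
    using assms by (auto simp: integers_def integral_over_def)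
  define s where "s = (inv_into UNIV to_Nc :: _ \<Rightarrow> 'r)"
  have inj: "inj (to_Nc :: 'r \<Rightarrow> _)" by (auto simp: inj_def)
  have s: "s (to_Nc a) = a" for a using inj by (simp add: s_def)
  have s0: "s 0 = 0" using s[of 0] by simp
  have Ps: "map_poly to_Nc (map_poly s P) = P"
  proof (rule poly_eqI)
    fix i
    obtain a where "Polynomial.coeff P i = to_Nc a" using P(2) by blast
    thus "Polynomial.coeff (map_poly to_Nc (map_poly s P)) i = Polynomial.coeff P i"
      by (simp add: coeff_map_poly s0 s)
  qed
  have "to_Nc (Polynomial.lead_coeff (map_poly s P)) = (1 :: 'r fract alg_closure)"
    using P(1) by (metis Ps to_Nc_hom.hom_lead_coeff)
  hence "Polynomial.lead_coeff (map_poly s P) = 1" using to_Nc_hom.hom_1_iff by blast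
  thus thesis using that[of "map_poly s P"] P(3) Ps by simp
qed

text \<open>Here \<open>y\<close> is an eigenvalue of a matrix over the base ring.\<close>

lemma eigen_root:
  fixes M :: "'i \<Rightarrow> 'i \<Rightarrow> 'r::idom" and v :: "'i \<Rightarrow> 'r fract alg_closure"
  assumes f: "bij_betw f {..<n} I"
    and v: "i0 \<in> I" "v i0 \<noteq> 0"
    and ev: "\<And>i. i \<in> I \<Longrightarrow> (\<Sum>j\<in>I. to_Nc (M i j) * v j) = y * v i"
  shows "poly (map_poly to_Nc (char_poly (mat n n (\<lambda>(i, j). M (f i) (f j))))) y = 0"
proof -
  define A where "A = mat n n (\<lambda>(i, j). M (f i) (f j))"
  have A: "A \<in> carrier_mat n n" by (simp add: A_def)
  have mA: "map_mat to_Nc A \<in> carrier_mat n n" using A by simp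
  define u where "u = vec n (\<lambda>i. v (f i))"
  obtain k where k: "k < n" "f k = i0" using f v(1) by (auto simp: bij_betw_def)
  have "u $ k \<noteq> 0\<^sub>v n $ k" using k v by (simp add: u_def)
  hence u0: "u \<noteq> 0\<^sub>v n" by auto
  have "map_mat to_Nc A *\<^sub>v u = y \<cdot>\<^sub>v u"
  proof (rule eq_vecI)
    fix i assume "i < dim_vec (y \<cdot>\<^sub>v u)"
    hence i: "i < n" by (simp add: u_def)
    have "(map_mat to_Nc A *\<^sub>v u) $ i = (\<Sum>j<n. to_Nc (M (f i) (f j)) * v (f j))"
      using i by (simp add: A_def u_def scalar_prod_def atLeast0LessThan)
    also have "\<dots> = (\<Sum>j\<in>I. to_Nc (M (f i) j) * v j)"
      by (rule sum.reindex_bij_betw[OF f, of "\<lambda>j. to_Nc (M (f i) j) * v j"])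
    also have "\<dots> = y * v (f i)" using f i by (intro ev) (auto simp: bij_betw_def)
    finally show "(map_mat to_Nc A *\<^sub>v u) $ i = (y \<cdot>\<^sub>v u) $ i" using i by (simp add: u_def)
  qed (simp add: A_def u_def)
  hence "eigenvalue (map_mat to_Nc A) y"
    unfolding eigenvalue_def eigenvector_def using u0 mA by (intro exI[of _ u]) (auto simp: u_def)
  hence "poly (char_poly (map_mat to_Nc A)) y = 0"
    using eigenvalue_root_char_poly[OF mA] by simp
  thus ?thesis using to_Nc_hom.char_poly_hom[OF A] by (simp add: A_def)
qed

text \<open>Multiplication by \<open>y\<close> maps the module spanned by the \<open>v i\<close> over the base ring to itself.\<close>

definition acts :: "'i set \<Rightarrow> ('i \<Rightarrow> 'r::idom fract alg_closure) \<Rightarrow> 'r fract alg_closure \<Rightarrow> bool" where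
  "acts I v y \<longleftrightarrow> (\<exists>M. \<forall>i\<in>I. (\<Sum>j\<in>I. to_Nc (M i j) * v j) = y * v i)"

lemma acts_integers:
  assumes "finite I" "i0 \<in> I" "v i0 \<noteq> 0" "acts I v y"
  shows "y \<in> integers"
proof -
  obtain M where M: "\<And>i. i \<in> I \<Longrightarrow> (\<Sum>j\<in>I. to_Nc (M i j) * v j) = y * v i"
    using assms(4) by (auto simp: acts_def)
  obtain f where f: "bij_betw f {..<card I} I"
    using ex_bij_betw_nat_finite[OF assms(1)] by (auto simp: atLeast0LessThan)
  let ?A = "mat (card I) (card I) (\<lambda>(i, j). M (f i) (f j))"
  show ?thesis
  proof (rule integersI[of "char_poly ?A"])
    show "poly (map_poly to_Nc (char_poly ?A)) y = 0" by (rule eigen_root[OF f assms(2,3) M])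
    show "Polynomial.lead_coeff (char_poly ?A) = 1"
      using degree_monic_char_poly[of ?A "card I"] by simp
  qed
qed

lemma acts_add: "acts I v x \<Longrightarrow> acts I v y \<Longrightarrow> acts I v (x + y)"
  unfolding acts_def
proof (elim exE)
  fix M N assume "\<forall>i\<in>I. (\<Sum>j\<in>I. to_Nc (M i j) * v j) = x * v i" "\<forall>i\<in>I. (\<Sum>j\<in>I. to_Nc (N i j) * v j) = y * v i"
  thus "\<exists>M. \<forall>i\<in>I. (\<Sum>j\<in>I. to_Nc (M i j) * v j) = (x + y) * v i"
    by (intro exI[of _ "\<lambda>i j. M i j + N i j"]) (simp add: distrib_right sum.distrib)
qed

lemma acts_mult: "acts I v x \<Longrightarrow> acts I v y \<Longrightarrow> acts I v (x * y)"
  unfolding acts_def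
proof (elim exE)
  fix M N assume M: "\<forall>i\<in>I. (\<Sum>j\<in>I. to_Nc (M i j) * v j) = x * v i"
    and N: "\<forall>i\<in>I. (\<Sum>j\<in>I. to_Nc (N i j) * v j) = y * v i"
  show "\<exists>M. \<forall>i\<in>I. (\<Sum>j\<in>I. to_Nc (M i j) * v j) = (x * y) * v i"
  proof (intro exI[of _ "\<lambda>i j. \<Sum>k\<in>I. N i k * M k j"] ballI)
    fix i assume i: "i \<in> I"
    have "(\<Sum>j\<in>I. to_Nc (\<Sum>k\<in>I. N i k * M k j) * v j) = (\<Sum>j\<in>I. \<Sum>k\<in>I. to_Nc (N i k) * (to_Nc (M k j) * v j))"
      by (simp add: to_Nc_hom.hom_sum sum_distrib_right mult.assoc)
    also have "\<dots> = (\<Sum>k\<in>I. to_Nc (N i k) * (\<Sum>j\<in>I. to_Nc (M k j) * v j))"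
      by (subst sum.swap) (simp add: sum_distrib_left)
    also have "\<dots> = (\<Sum>k\<in>I. to_Nc (N i k) * (x * v k))" using M by simp
    also have "\<dots> = x * (\<Sum>k\<in>I. to_Nc (N i k) * v k)" by (simp add: sum_distrib_left mult_ac)
    finally show "(\<Sum>j\<in>I. to_Nc (\<Sum>k\<in>I. N i k * M k j) * v j) = (x * y) * v i" using N i by (simp add: mult_ac)
  qed
qed

lemma monic_power_relation:
  fixes q :: "'r::idom poly"
  assumes "Polynomial.lead_coeff q = 1" "poly (map_poly to_Nc q) y = 0"
  shows "Polynomial.degree q > 0"
    "y ^ Polynomial.degree q = (\<Sum>i<Polynomial.degree q. to_Nc (- Polynomial.coeff q i) * y ^ i)"
proof -
  show "Polynomial.degree q > 0"
  proof (rule ccontr)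
    assume "\<not> ?thesis"
    hence "Polynomial.degree q = 0" by simp
    then obtain c where "q = [:c:]" by (rule degree_eq_zeroE)
    thus False using assms by (auto simp: map_poly_pCons)
  qed
  have "0 = (\<Sum>i\<le>Polynomial.degree q. to_Nc (Polynomial.coeff q i) * y ^ i)"
    using assms(2) by (simp add: poly_altdef coeff_map_poly)
  also have "\<dots> = y ^ Polynomial.degree q + (\<Sum>i<Polynomial.degree q. to_Nc (Polynomial.coeff q i) * y ^ i)"
    using assms(1) by (simp add: lessThan_Suc_atMost[symmetric] add.commute)
  finally show "y ^ Polynomial.degree q = (\<Sum>i<Polynomial.degree q. to_Nc (- Polynomial.coeff q i) * y ^ i)"
    by (simp add: sum_negf eq_neg_iff_add_eq_0)
qed

text \<open>The products \<open>x\<^sup>i y\<^sup>j\<close> with exponents below the degrees of monic equations for \<open>x\<close> and \<open>y\<close>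
  span a module that both elements act on.\<close>

lemma common_acts:
  fixes x y :: "'r::idom fract alg_closure"
  assumes "x \<in> integers" "y \<in> integers"
  obtains I :: "(nat \<times> nat) set" and v i0
  where "finite I" "i0 \<in> I" "v i0 \<noteq> 0" "acts I v x" "acts I v y"
proof -
  obtain q :: "'r poly" where q: "Polynomial.lead_coeff q = 1" "poly (map_poly to_Nc q) x = 0" using assms(1) by (rule integersE)
  obtain r :: "'r poly" where r: "Polynomial.lead_coeff r = 1" "poly (map_poly to_Nc r) y = 0" using assms(2) by (rule integersE)
  define m where "m = Polynomial.degree q"
  define n where "n = Polynomial.degree r"
  have mn: "m > 0" "n > 0" using monic_power_relation(1) q r by (auto simp: m_def n_def)
  define v where "v = (\<lambda>(i, j). x ^ i * y ^ j)"
  define I where "I = {..<m} \<times> {..<n}"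
  have shift: "\<exists>c. (\<Sum>j<m. to_Nc (c j) * z ^ j) = z * z ^ i"
    if q: "Polynomial.lead_coeff q = 1" "poly (map_poly to_Nc q) z = 0" and i: "i < m" and m: "m = Polynomial.degree q"
    for q :: "'r poly" and z i m
  proof (cases "Suc i = m")
    case True
    have "(\<Sum>j<m. to_Nc (- Polynomial.coeff q j) * z ^ j) = z ^ Suc i"
      unfolding True m by (rule monic_power_relation(2)[OF q, symmetric])
    thus ?thesis by (intro exI[of _ "\<lambda>j. - Polynomial.coeff q j"]) simp
  next
    case False
    have "(\<Sum>j<m. to_Nc (if j = Suc i then 1 else 0) * z ^ j) = (\<Sum>j<m. if j = Suc i then z ^ j else 0)"
      by (intro sum.cong) auto
    also have "\<dots> = z * z ^ i" using False i by simp
    finally show ?thesis by (intro exI[of _ "\<lambda>j. if j = Suc i then 1 else 0"])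
  qed
  have "\<exists>c. \<forall>i<m. (\<Sum>j<m. to_Nc (c i j) * x ^ j) = x * x ^ i"
  proof -
    have "\<forall>i. \<exists>c. i < m \<longrightarrow> (\<Sum>j<m. to_Nc (c j) * x ^ j) = x * x ^ i" using shift[OF q _ m_def] by blast
    thus ?thesis by metis
  qed
  then obtain c where c: "\<And>i. i < m \<Longrightarrow> (\<Sum>j<m. to_Nc (c i j) * x ^ j) = x * x ^ i" by blast
  have "\<exists>d. \<forall>i<n. (\<Sum>j<n. to_Nc (d i j) * y ^ j) = y * y ^ i"
  proof -
    have "\<forall>i. \<exists>d. i < n \<longrightarrow> (\<Sum>j<n. to_Nc (d j) * y ^ j) = y * y ^ i" using shift[OF r _ n_def] by blast
    thus ?thesis by metis
  qed
  then obtain d where d: "\<And>i. i < n \<Longrightarrow> (\<Sum>j<n. to_Nc (d i j) * y ^ j) = y * y ^ i" by blast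
  define Mx where "Mx = (\<lambda>(i :: nat, j :: nat) (k :: nat, l :: nat). if l = j then c i k else 0)"
  have "(\<Sum>w\<in>I. to_Nc (Mx z w) * v w) = x * v z" if "z \<in> I" for z
  proof -
    obtain i j where z: "z = (i, j)" by (cases z)
    have ij: "z = (i, j)" "i < m" "j < n" using that by (simp_all add: I_def z)
    have "(\<Sum>w\<in>I. to_Nc (Mx z w) * v w) =
       (\<Sum>k<m. \<Sum>l<n. if l = j then to_Nc (c i k) * x ^ k * y ^ l else 0)"
      unfolding I_def v_def Mx_def ij(1)
      by (subst sum.cartesian_product) (intro sum.cong refl, auto)
    also have "\<dots> = (\<Sum>k<m. to_Nc (c i k) * x ^ k) * y ^ j" using ij by (simp add: sum_distrib_right)
    also have "\<dots> = x * v z" using c[OF ij(2)] by (simp add: v_def ij(1))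
    finally show ?thesis .
  qed
  hence ax: "acts I v x" unfolding acts_def by blast
  define My where "My = (\<lambda>(i :: nat, j :: nat) (k :: nat, l :: nat). if k = i then d j l else 0)"
  have "(\<Sum>w\<in>I. to_Nc (My z w) * v w) = y * v z" if "z \<in> I" for z
  proof -
    obtain i j where z: "z = (i, j)" by (cases z)
    have ij: "z = (i, j)" "i < m" "j < n" using that by (simp_all add: I_def z)
    have "(\<Sum>w\<in>I. to_Nc (My z w) * v w) =
       (\<Sum>k<m. \<Sum>l<n. if k = i then x ^ k * (to_Nc (d j l) * y ^ l) else 0)"
      unfolding I_def v_def My_def ij(1)
      by (subst sum.cartesian_product) (intro sum.cong refl, auto)
    also have "\<dots> = (\<Sum>l<n. \<Sum>k<m. if k = i then x ^ k * (to_Nc (d j l) * y ^ l) else 0)" by (rule sum.swap)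
    also have "\<dots> = x ^ i * (\<Sum>l<n. to_Nc (d j l) * y ^ l)" using ij by (simp add: sum_distrib_left)
    also have "\<dots> = y * v z" using d[OF ij(3)] by (simp add: v_def ij(1))
    finally show ?thesis .
  qed
  hence ay: "acts I v y" unfolding acts_def by blast
  have "finite I" "(0, 0) \<in> I" "v (0, 0) \<noteq> 0" using mn by (auto simp: I_def v_def)
  thus thesis using that ax ay by blast
qed

lemma integers_add: "x \<in> integers \<Longrightarrow> y \<in> integers \<Longrightarrow> x + y \<in> integers"
  by (rule common_acts[of x y]) (auto intro: acts_integers acts_add)

lemma integers_mult: "x \<in> integers \<Longrightarrow> y \<in> integers \<Longrightarrow> x * y \<in> integers"
  by (rule common_acts[of x y]) (auto intro: acts_integers acts_mult)

lemma integers_to_Nc [simp]: "to_Nc a \<in> integers"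
  by (rule integersI[of "[:- a, 1:]"]) (simp_all add: map_poly_pCons)

lemma integers_0 [simp]: "0 \<in> integers" and integers_1 [simp]: "1 \<in> integers"
  using integers_to_Nc[of 0] integers_to_Nc[of 1] by simp_all

lemma integers_of_nat [simp]: "of_nat n \<in> integers"
  using integers_to_Nc[of "of_nat n"] by simp

lemma integers_uminus: "x \<in> integers \<Longrightarrow> - x \<in> integers"
  using integers_mult[of "to_Nc (- 1)" x] integers_to_Nc[of "- 1"] by simp

lemma integers_diff: "x \<in> integers \<Longrightarrow> y \<in> integers \<Longrightarrow> x - y \<in> integers"
  using integers_add[of x "- y"] integers_uminus[of y] by simp

lemma integers_power: "x \<in> integers \<Longrightarrow> x ^ n \<in> integers"
  by (induction n) (auto intro: integers_mult)

lemma integers_sum: "(\<And>i. i \<in> I \<Longrightarrow> f i \<in> integers) \<Longrightarrow> (\<Sum>i\<in>I. f i) \<in> integers"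
  by (induction I rule: infinite_finite_induct) (auto intro: integers_add)

lemma integers_root_of_unity:
  fixes w :: "'r::idom fract alg_closure"
  assumes "w ^ n = 1" "n > 0"
  shows "w \<in> integers"
proof (rule integersI[of "Polynomial.monom 1 n - 1 :: 'r poly"])
  have "Polynomial.degree (Polynomial.monom 1 n - 1 :: 'r poly) \<le> n"
    by (intro degree_diff_le) (auto simp: degree_monom_le)
  moreover have "Polynomial.degree (Polynomial.monom 1 n - 1 :: 'r poly) \<ge> n"
    using assms(2) by (intro le_degree) simp
  ultimately have "Polynomial.degree (Polynomial.monom 1 n - 1 :: 'r poly) = n" by simp
  thus "Polynomial.lead_coeff (Polynomial.monom 1 n - 1 :: 'r poly) = 1"
    using assms(2) by simp
  have "map_poly to_Nc (Polynomial.monom 1 n - 1 :: 'r poly) = Polynomial.monom 1 n - 1"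
    by (rule poly_eqI) (simp add: coeff_map_poly)
  thus "poly (map_poly to_Nc (Polynomial.monom 1 n - 1 :: 'r poly)) w = 0"
    using assms(1) by (simp add: poly_monom)
qed

lemma normal_integers:
  fixes y :: "'r::idom fract alg_closure"
  assumes normal: "normal_domain TYPE('r)"
    and y: "y \<in> integers" "y * to_Nc b = to_Nc a" "b \<noteq> 0"
  shows "\<exists>c. y = to_Nc c"
proof -
  define x where "x = to_fract a / to_fract b"
  have yx: "y = to_ac x" using y(2,3) by (simp add: x_def to_Nc_def field_simps)
  obtain q :: "'r poly" where q: "Polynomial.lead_coeff q = 1" "poly (map_poly to_Nc q) y = 0" using y(1) by (rule integersE)
  have "map_poly to_Nc q = map_poly to_ac (map_poly to_fract q)"
    by (rule poly_eqI) (simp add: coeff_map_poly to_Nc_def)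
  moreover have "poly (map_poly to_ac P) (to_ac z) = to_ac (poly P z)" for P :: "'r fract poly" and z
    by (induction P) (auto simp: map_poly_pCons)
  ultimately have "poly (map_poly to_fract q) x = 0" using q(2) by (simp add: yx)
  moreover have "Polynomial.degree (map_poly to_fract q) = Polynomial.degree q" by (intro degree_map_poly) auto
  hence "Polynomial.lead_coeff (map_poly to_fract q) = 1" using q(1) by (simp add: coeff_map_poly)
  ultimately have "integral_over (range to_fract) x"
    unfolding integral_over_def by (intro exI[of _ "map_poly to_fract q"]) (auto simp: coeff_map_poly)
  hence "x \<in> range to_fract" using normal by (simp add: normal_domain_def)
  thus ?thesis using yx by (auto simp: to_Nc_def)
qed

section \<open>The \<open>p\<close>-adic topology\<close>

text \<open>The conditions \<open>separated\<close> and \<open>complete\<close> are the injectivity and the surjectivity of the map from the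
  base ring to its \<open>p\<close>-adic completion.\<close>

locale padic_normal =
  fixes p :: nat and ty :: "'r::{idom, ring_char_0} itself"
  assumes p: "Factorial_Ring.prime p"
    and normal: "normal_domain TYPE('r)"
    and separated: "\<And>r :: 'r. (\<And>n. of_nat p ^ n dvd r) \<Longrightarrow> r = 0"
    and complete: "\<And>a :: nat \<Rightarrow> 'r. (\<And>n. of_nat p ^ n dvd a (Suc n) - a n) \<Longrightarrow> \<exists>l. \<forall>n. of_nat p ^ n dvd l - a n"
begin

lemma p_pos: "p > 0" using p by (rule prime_gt_0_nat)

lemma p_nonzero [simp]: "(of_nat p :: 'r) \<noteq> 0" "(of_nat p :: 'r fract alg_closure) \<noteq> 0"
  using p_pos by simp_all

text \<open>The basic neighbourhoods of 0 in the \<open>p\<close>-adic topology of the closure.\<close>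

definition mults :: "nat \<Rightarrow> 'r fract alg_closure set" where
  "mults k = {of_nat p ^ k * y | y. y \<in> integers}"

lemma multsI: "y \<in> integers \<Longrightarrow> z = of_nat p ^ k * y \<Longrightarrow> z \<in> mults k"
  by (auto simp: mults_def)

lemma mults_0 [simp]: "0 \<in> mults k"
  by (rule multsI[of 0]) simp_all

lemma mults_add: "x \<in> mults k \<Longrightarrow> y \<in> mults k \<Longrightarrow> x + y \<in> mults k"
  unfolding mults_def using integers_add by (force simp: distrib_left[symmetric])

lemma mults_mult: "x \<in> mults k \<Longrightarrow> y \<in> integers \<Longrightarrow> x * y \<in> mults k"
  unfolding mults_def using integers_mult by (force simp: mult.assoc)

lemma mults_mult': "y \<in> integers \<Longrightarrow> x \<in> mults k \<Longrightarrow> y * x \<in> mults k"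
  using mults_mult[of x k y] by (simp add: mult.commute)

lemma mults_uminus: "x \<in> mults k \<Longrightarrow> - x \<in> mults k"
  using mults_mult[of x k "- 1"] integers_uminus[of 1] by simp

lemma mults_diff: "x \<in> mults k \<Longrightarrow> y \<in> mults k \<Longrightarrow> x - y \<in> mults k"
  using mults_add[of x k "- y"] mults_uminus[of y] by simp

lemma mults_sum: "(\<And>i. i \<in> I \<Longrightarrow> f i \<in> mults k) \<Longrightarrow> (\<Sum>i\<in>I. f i) \<in> mults k"
  by (induction I rule: infinite_finite_induct) (auto intro: mults_add)

lemma mults_mono: "x \<in> mults k \<Longrightarrow> l \<le> k \<Longrightarrow> x \<in> mults l"
proof -
  assume "x \<in> mults k" "l \<le> k"
  then obtain y where y: "y \<in> integers" "x = of_nat p ^ k * y" by (auto simp: mults_def)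
  have "x = of_nat p ^ l * (of_nat p ^ (k - l) * y)"
    using \<open>l \<le> k\<close> y(2) by (simp flip: power_add mult.assoc)
  thus "x \<in> mults l"
    by (rule multsI[rotated]) (intro integers_mult integers_power integers_of_nat y(1))
qed

text \<open>The quotient of \<open>r\<close> by \<open>p\<^sup>k\<close> is integral and lies in the field of fractions, hence in the normal
  base ring.\<close>

lemma mults_to_Nc: "to_Nc r \<in> mults k \<longleftrightarrow> of_nat p ^ k dvd r"
proof
  assume "to_Nc r \<in> mults k"
  then obtain y where y: "y \<in> integers" "to_Nc r = of_nat p ^ k * y" by (auto simp: mults_def)
  have "y * to_Nc (of_nat p ^ k) = to_Nc r" using y(2) by (simp add: mult.commute)
  then obtain c where "y = to_Nc c" using normal_integers[OF normal y(1)] p_nonzero(1) power_not_zero by blast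
  hence "to_Nc r = to_Nc (of_nat p ^ k * c)"
    using y(2) by (simp only: to_Nc_simps(6) to_Nc_power to_Nc_of_nat)
  hence "r = of_nat p ^ k * c" by (rule to_Nc_simps(7)[THEN iffD1])
  thus "of_nat p ^ k dvd r" by simp
next
  assume "of_nat p ^ k dvd r"
  then obtain c where "r = of_nat p ^ k * c" by blast
  thus "to_Nc r \<in> mults k" by (intro multsI[OF integers_to_Nc[of c]]) simp
qed

text \<open>The nonzero constant term of an equation for \<open>y \<noteq> 0\<close> is a multiple of \<open>y\<close>, so it would be
  divisible by all powers of \<open>p\<close> in the base ring.\<close>

lemma mults_separated:
  assumes "\<And>k. y \<in> mults k"
  shows "y = 0"
proof (rule ccontr)
  assume y0: "y \<noteq> 0"
  have "y \<in> integers" using assms[of 0] by (auto simp: mults_def)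
  then obtain q :: "'r poly" where q: "Polynomial.lead_coeff q = 1" "poly (map_poly to_Nc q) y = 0" by (rule integersE)
  have "\<exists>c Q. c \<noteq> 0 \<and> poly (map_poly to_Nc (pCons c Q)) y = 0" if "q \<noteq> 0" "poly (map_poly to_Nc q) y = 0" for q :: "'r poly"
    using that
  proof (induction q)
    case (pCons c q)
    show ?case
    proof (cases "c = 0")
      case True
      hence "q \<noteq> 0" using pCons.prems(1) by simp
      moreover have "poly (map_poly to_Nc q) y = 0" using pCons.prems(2) True y0 by (simp add: to_Nc_hom.map_poly_pCons_hom)
      ultimately show ?thesis using pCons.IH by blast
    next
      case False
      thus ?thesis using pCons.prems(2) by blast
    qed
  qed simp
  moreover have "q \<noteq> 0" using q(1) by auto
  ultimately obtain c Q where cQ: "c \<noteq> 0" "poly (map_poly to_Nc (pCons c Q)) y = 0" using q(2) by blast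
  have Q: "poly (map_poly to_Nc Q) y \<in> integers"
    unfolding poly_altdef
    by (intro integers_sum integers_mult integers_power \<open>y \<in> integers\<close>) (simp add: coeff_map_poly)
  have c: "to_Nc c = y * (- poly (map_poly to_Nc Q) y)"
    using cQ(2) by (simp add: to_Nc_hom.map_poly_pCons_hom add_eq_0_iff)
  have "to_Nc c \<in> mults k" for k unfolding c by (intro mults_mult assms integers_uminus Q)
  hence "c = 0" by (intro separated) (simp add: mults_to_Nc)
  thus False using cQ(1) by simp
qed

text \<open>The number \<open>c\<close> is invertible modulo \<open>p\<close>, and the geometric series inverts the elements congruent to 1
  modulo \<open>p\<close>.\<close>

lemma coprime_unit:
  assumes "coprime c p"
  shows "(of_nat c :: 'r) dvd 1"
proof -
  obtain a where "[c * a = Suc 0] (mod p)" using cong_solve_coprime_nat[OF assms] by blast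
  hence "[int c * int a = 1] (mod int p)" by (metis cong_int_iff of_nat_Suc of_nat_0 add_0 of_nat_mult One_nat_def of_nat_1)
  then obtain b where b: "int c * int a = 1 + int p * b"
    by (metis cong_iff_lin cong_sym)
  define x :: 'r where "x = - of_nat p * of_int b"
  have cx: "of_nat c * of_nat a = 1 - x"
    using arg_cong[OF b, of "of_int :: int \<Rightarrow> 'r"] by (simp add: x_def)
  have px: "of_nat p ^ n dvd x ^ n" for n unfolding x_def by (intro dvd_power_same) simp
  have "\<exists>l. \<forall>n. of_nat p ^ n dvd l - (\<Sum>i<n. x ^ i)"
    by (rule complete) (simp add: px)
  then obtain l where l: "\<And>n. of_nat p ^ n dvd l - (\<Sum>i<n. x ^ i)" by blast
  have "(1 - x) * l - 1 = 0"
  proof (rule separated)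
    fix n
    have "(1 - x) * l - 1 = (1 - x) * (l - (\<Sum>i<n. x ^ i)) + ((1 - x) * (\<Sum>i<n. x ^ i) - 1)"
      by (simp add: algebra_simps)
    also have "(1 - x) * (\<Sum>i<n. x ^ i) = 1 - x ^ n" by (rule one_diff_power_eq[symmetric])
    finally show "of_nat p ^ n dvd (1 - x) * l - 1" using l[of n] px[of n] by (simp add: dvd_diff)
  qed
  hence "of_nat c * (of_nat a * l) = 1" using cx by (simp flip: mult.assoc)
  thus ?thesis by (metis dvd_triv_left)
qed

lemma integers_inverse_coprime:
  assumes "coprime c p"
  shows "inverse (of_nat c) \<in> (integers :: 'r fract alg_closure set)"
proof -
  obtain u :: 'r where "1 = of_nat c * u" using coprime_unit[OF assms] by blast
  hence "to_Nc (of_nat c * u) = 1" by simp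
  hence "of_nat c * to_Nc u = 1" by simp
  hence "inverse (of_nat c) = to_Nc u" by (metis inverse_unique)
  thus ?thesis by simp
qed

lemma coprime_pos: "coprime c p \<Longrightarrow> c > 0"
  using p prime_gt_1_nat by (intro Nat.gr0I) auto

lemma power_over_index:
  assumes "i \<ge> 2 * k" "i > 0"
  shows "of_nat p ^ i / of_nat i \<in> mults k"
proof -
  obtain b c where bc: "coprime c p" "i * (b * p ^ k) = c * p ^ i" using index_dvd_prime_power[OF p assms] by blast
  have "of_nat i * (of_nat b * of_nat p ^ k) = of_nat c * (of_nat p ^ i :: 'r fract alg_closure)"
    using arg_cong[OF bc(2), of "of_nat :: nat \<Rightarrow> 'r fract alg_closure"] by simp
  hence "of_nat p ^ i / of_nat i = of_nat p ^ k * (of_nat b * inverse (of_nat c :: 'r fract alg_closure))"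
    using assms(2) coprime_pos[OF bc(1)] by (simp add: field_simps)
  thus ?thesis
    by (rule multsI[rotated]) (intro integers_mult integers_of_nat integers_inverse_coprime[OF bc(1)])
qed

lemma power_over_fact:
  assumes "i > 0"
  shows "of_nat p ^ i / fact i \<in> mults 1"
proof -
  obtain b c where bc: "coprime c p" "fact i * b = c * p ^ (i - 1)" using fact_dvd_prime_power[OF p assms] by blast
  have "fact i * of_nat b = of_nat c * (of_nat p ^ (i - 1) :: 'r fract alg_closure)"
    using arg_cong[OF bc(2), of "of_nat :: nat \<Rightarrow> 'r fract alg_closure"] by simp
  moreover have "of_nat p ^ i = (of_nat p * of_nat p ^ (i - 1) :: 'r fract alg_closure)"
    using assms by (simp flip: power_Suc)
  ultimately have "of_nat p ^ i / fact i = of_nat p ^ 1 * (of_nat b * inverse (of_nat c :: 'r fract alg_closure))"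
    using coprime_pos[OF bc(1)] by (simp add: field_simps)
  thus ?thesis
    by (rule multsI[rotated]) (intro integers_mult integers_of_nat integers_inverse_coprime[OF bc(1)])
qed

end

section \<open>Power series that can be evaluated at 1\<close>

interpretation map_to_Nc: map_poly_inj_comm_ring_hom "to_Nc :: 'r::idom \<Rightarrow> 'r fract alg_closure" ..

definition integral_fps :: "'r::idom fract alg_closure fps \<Rightarrow> bool" where
  "integral_fps a \<longleftrightarrow> (\<forall>n. fps_nth a n \<in> integers)"

lemma integral_fps_mult: "integral_fps a \<Longrightarrow> integral_fps b \<Longrightarrow> integral_fps (a * b)"
  unfolding integral_fps_def fps_mult_nth by (intro allI integers_sum integers_mult) auto

lemma integral_fps_diff: "integral_fps a \<Longrightarrow> integral_fps b \<Longrightarrow> integral_fps (a - b)"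
  by (simp add: integral_fps_def integers_diff)

lemma integral_fps_const: "c \<in> integers \<Longrightarrow> integral_fps (fps_const c)"
  by (simp add: integral_fps_def)

lemma integral_fps_1: "integral_fps 1"
  by (simp add: integral_fps_def)

lemma integral_fps_power: "integral_fps a \<Longrightarrow> integral_fps (a ^ n)"
  by (induction n) (auto intro: integral_fps_mult integral_fps_1)

lemma integral_fps_to_Nc: "integral_fps (fps_of_poly (map_poly to_Nc d))"
  by (simp add: integral_fps_def coeff_map_poly)

lemma integral_fps_divide:
  assumes d: "Polynomial.coeff d 0 = 1" and "integral_fps (fps_of_poly (map_poly to_Nc d) * a)"
  shows "integral_fps a"
  unfolding integral_fps_def
proof
  fix n show "fps_nth a n \<in> integers"
  proof (induction n rule: less_induct)
    case (less n)
    have "fps_nth (fps_of_poly (map_poly to_Nc d) * a) n =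
        (\<Sum>i=0..n. to_Nc (Polynomial.coeff d i) * fps_nth a (n - i))"
      by (simp add: fps_mult_nth coeff_map_poly)
    also have "\<dots> = fps_nth a n + (\<Sum>i=Suc 0..n. to_Nc (Polynomial.coeff d i) * fps_nth a (n - i))"
      using d by (simp add: sum.atLeast_Suc_atMost)
    finally have "fps_nth a n = fps_nth (fps_of_poly (map_poly to_Nc d) * a) n -
        (\<Sum>i=Suc 0..n. to_Nc (Polynomial.coeff d i) * fps_nth a (n - i))" by simp
    moreover have "(\<Sum>i=Suc 0..n. to_Nc (Polynomial.coeff d i) * fps_nth a (n - i)) \<in> integers"
      by (intro integers_sum integers_mult integers_to_Nc less.IH) auto
    ultimately show ?case using assms(2) by (auto simp: integral_fps_def intro: integers_diff)
  qed
qed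

text \<open>A power series with integral coefficients has in general no value at \<open>t = 1\<close>.  It has one if it is a
  rational function whose denominator \<open>d\<close> over the base ring satisfies \<open>d(0) = 1\<close>, so that division by
  \<open>d\<close> preserves the integrality of coefficients, and has a unit \<open>d(1)\<close>, so that the value is integral.\<close>

definition rational_at_1 :: "'r::idom fract alg_closure fps \<Rightarrow> 'r fract alg_closure \<Rightarrow> bool" where
  "rational_at_1 a v \<longleftrightarrow> (\<exists>d P. Polynomial.coeff d 0 = 1 \<and> poly d 1 dvd 1 \<and>
     (\<forall>i. Polynomial.coeff P i \<in> integers) \<and>
     fps_of_poly (map_poly to_Nc d) * a = fps_of_poly P \<and> to_Nc (poly d 1) * v = poly P 1)"

lemma poly_in_integers:
  "(\<And>i. Polynomial.coeff P i \<in> integers) \<Longrightarrow> x \<in> integers \<Longrightarrow> poly P x \<in> integers"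
  unfolding poly_altdef by (intro integers_sum integers_mult integers_power)

lemma poly_map_to_Nc_1: "poly (map_poly to_Nc d) 1 = to_Nc (poly d 1)"
  by (metis to_Nc_hom.poly_map_poly to_Nc_simps(2))

lemma rational_at_1_integral:
  assumes "rational_at_1 a v"
  shows "integral_fps a" "v \<in> integers"
proof -
  obtain d P where dP: "Polynomial.coeff d 0 = 1" "poly d 1 dvd 1" "\<And>i. Polynomial.coeff P i \<in> integers"
    "fps_of_poly (map_poly to_Nc d) * a = fps_of_poly P" "to_Nc (poly d 1) * v = poly P 1"
    using assms by (auto simp: rational_at_1_def)
  show "integral_fps a"
    by (rule integral_fps_divide[OF dP(1)]) (simp add: dP(3,4) integral_fps_def)
  obtain u where u: "1 = poly d 1 * u" using dP(2) by blast
  have "v = to_Nc (u * poly d 1) * v" using u by (simp add: mult.commute)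
  also have "\<dots> = to_Nc u * poly P 1" using dP(5) by (simp add: mult.assoc)
  finally show "v \<in> integers" using poly_in_integers[OF dP(3)] by (simp add: integers_mult)
qed

lemma rational_at_1_poly:
  "(\<And>i. Polynomial.coeff P i \<in> integers) \<Longrightarrow> rational_at_1 (fps_of_poly P) (poly P 1)"
  unfolding rational_at_1_def by (intro exI[of _ 1] exI[of _ P]) auto

lemma rational_at_1_const: "c \<in> integers \<Longrightarrow> rational_at_1 (fps_const c) c"
  using rational_at_1_poly[of "[:c:]"] by (simp add: fps_of_poly_const coeff_pCons split: nat.splits)

lemma rational_at_1_add:
  assumes "rational_at_1 a v" "rational_at_1 b w"
  shows "rational_at_1 (a + b) (v + w)"
proof -
  obtain d P where dP: "Polynomial.coeff d 0 = 1" "poly d 1 dvd 1" "\<And>i. Polynomial.coeff P i \<in> integers"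
    "fps_of_poly (map_poly to_Nc d) * a = fps_of_poly P" "to_Nc (poly d 1) * v = poly P 1"
    using assms(1) by (auto simp: rational_at_1_def)
  obtain e Q where eQ: "Polynomial.coeff e 0 = 1" "poly e 1 dvd 1" "\<And>i. Polynomial.coeff Q i \<in> integers"
    "fps_of_poly (map_poly to_Nc e) * b = fps_of_poly Q" "to_Nc (poly e 1) * w = poly Q 1"
    using assms(2) by (auto simp: rational_at_1_def)
  let ?d = "map_poly to_Nc d" and ?e = "map_poly to_Nc e"
  have de: "map_poly to_Nc (d * e) = ?d * ?e" by (simp add: map_to_Nc.hom_mult)
  have 1: "fps_of_poly (map_poly to_Nc (d * e)) * (a + b) = fps_of_poly (?e * P + ?d * Q)"
    unfolding de fps_of_poly_mult fps_of_poly_add dP(4)[symmetric] eQ(4)[symmetric]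
    by (simp add: algebra_simps)
  have 2: "to_Nc (poly (d * e) 1) * (v + w) = poly (?e * P + ?d * Q) 1"
    by (simp add: poly_map_to_Nc_1 dP(5)[symmetric] eQ(5)[symmetric] algebra_simps)
  have 3: "Polynomial.coeff (?e * P + ?d * Q) i \<in> integers" for i
    by (simp add: coeff_mult coeff_map_poly integers_add integers_sum integers_mult dP(3) eQ(3))
  have 4: "poly (d * e) 1 dvd 1" using mult_dvd_mono[OF dP(2) eQ(2)] by simp
  have 5: "Polynomial.coeff (d * e) 0 = 1" using dP(1) eQ(1) by (simp add: coeff_mult_0)
  show ?thesis unfolding rational_at_1_def using 1 2 3 4 5 by blast
qed

lemma rational_at_1_mult:
  assumes "rational_at_1 a v" "rational_at_1 b w"
  shows "rational_at_1 (a * b) (v * w)"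
proof -
  obtain d P where dP: "Polynomial.coeff d 0 = 1" "poly d 1 dvd 1" "\<And>i. Polynomial.coeff P i \<in> integers"
    "fps_of_poly (map_poly to_Nc d) * a = fps_of_poly P" "to_Nc (poly d 1) * v = poly P 1"
    using assms(1) by (auto simp: rational_at_1_def)
  obtain e Q where eQ: "Polynomial.coeff e 0 = 1" "poly e 1 dvd 1" "\<And>i. Polynomial.coeff Q i \<in> integers"
    "fps_of_poly (map_poly to_Nc e) * b = fps_of_poly Q" "to_Nc (poly e 1) * w = poly Q 1"
    using assms(2) by (auto simp: rational_at_1_def)
  let ?d = "map_poly to_Nc d" and ?e = "map_poly to_Nc e"
  have de: "map_poly to_Nc (d * e) = ?d * ?e" by (simp add: map_to_Nc.hom_mult)
  have 1: "fps_of_poly (map_poly to_Nc (d * e)) * (a * b) = fps_of_poly (P * Q)"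
    unfolding de fps_of_poly_mult dP(4)[symmetric] eQ(4)[symmetric] by (simp add: algebra_simps)
  have 2: "to_Nc (poly (d * e) 1) * (v * w) = poly (P * Q) 1"
    by (simp add: dP(5)[symmetric] eQ(5)[symmetric] algebra_simps)
  have 3: "Polynomial.coeff (P * Q) i \<in> integers" for i
    by (simp add: coeff_mult integers_sum integers_mult dP(3) eQ(3))
  have 4: "poly (d * e) 1 dvd 1" using mult_dvd_mono[OF dP(2) eQ(2)] by simp
  have 5: "Polynomial.coeff (d * e) 0 = 1" using dP(1) eQ(1) by (simp add: coeff_mult_0)
  show ?thesis unfolding rational_at_1_def using 1 2 3 4 5 by blast
qed

lemma rational_at_1_0: "rational_at_1 0 0" and rational_at_1_1: "rational_at_1 1 1"
  using rational_at_1_const[of 0] rational_at_1_const[of 1] by simp_all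

lemma rational_at_1_diff:
  assumes "rational_at_1 a v" "rational_at_1 b w"
  shows "rational_at_1 (a - b) (v - w)"
proof -
  have m1: "- 1 \<in> integers" using integers_uminus[of 1] by simp
  have "rational_at_1 (a + fps_const (- 1) * b) (v + (- 1) * w)"
    by (intro rational_at_1_add rational_at_1_mult rational_at_1_const assms m1)
  moreover have "a + fps_const (- 1) * b = a - b" by (simp flip: fps_const_neg)
  ultimately show ?thesis by simp
qed

lemma rational_at_1_sum:
  "(\<And>i. i \<in> I \<Longrightarrow> rational_at_1 (f i) (v i)) \<Longrightarrow> rational_at_1 (\<Sum>i\<in>I. f i) (\<Sum>i\<in>I. v i)"
  by (induction I rule: infinite_finite_induct) (auto intro: rational_at_1_add rational_at_1_0)

lemma rational_at_1_power:
  "rational_at_1 a v \<Longrightarrow> rational_at_1 (a ^ n) (v ^ n)"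
  by (induction n) (auto intro: rational_at_1_mult rational_at_1_1)

lemma rational_at_1_prod_list:
  "(\<And>x. x \<in> set xs \<Longrightarrow> rational_at_1 (f x) (v x)) \<Longrightarrow>
     rational_at_1 (\<Prod>x\<leftarrow>xs. f x) (\<Prod>x\<leftarrow>xs. v x)"
  by (induction xs) (auto intro: rational_at_1_mult rational_at_1_1)

lemma rational_at_1_unique:
  assumes "rational_at_1 a v" "rational_at_1 a w"
  shows "v = w"
proof -
  have "rational_at_1 (a - a) (v - w)" by (rule rational_at_1_diff[OF assms])
  then obtain d P where dP: "poly d 1 dvd 1" "fps_of_poly (map_poly to_Nc d) * 0 = fps_of_poly P"
    "to_Nc (poly d 1) * (v - w) = poly P 1"
    by (auto simp: rational_at_1_def)
  have "fps_of_poly P = fps_of_poly 0" using dP(2) by simp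
  hence "P = 0" by (simp only: fps_of_poly_eq_iff)
  moreover have "poly d 1 \<noteq> 0" using dP(1) by auto
  ultimately show ?thesis using dP(3) by simp
qed

text \<open>The denominator \<open>d\<close> need not change: the new numerator \<open>d b\<close> has integral coefficients because \<open>b\<close>
  has.\<close>

lemma rational_at_1_divide:
  assumes "rational_at_1 (fps_const c * b) v" "c \<noteq> 0" "integral_fps b"
  shows "rational_at_1 b (v / c)"
proof -
  obtain d P where dP: "Polynomial.coeff d 0 = 1" "poly d 1 dvd 1" "\<And>i. Polynomial.coeff P i \<in> integers"
    "fps_of_poly (map_poly to_Nc d) * (fps_const c * b) = fps_of_poly P" "to_Nc (poly d 1) * v = poly P 1"
    using assms(1) by (auto simp: rational_at_1_def)
  define Q where "Q = Polynomial.smult (inverse c) P"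
  have "fps_of_poly Q = fps_const (inverse c) * (fps_of_poly (map_poly to_Nc d) * (fps_const c * b))"
    by (simp add: Q_def fps_of_poly_smult dP(4))
  also have "\<dots> = fps_const (inverse c) * fps_const c * (fps_of_poly (map_poly to_Nc d) * b)"
    by (simp only: mult_ac)
  also have "fps_const (inverse c) * fps_const c = 1" using assms(2) by simp
  finally have Q: "fps_of_poly (map_poly to_Nc d) * b = fps_of_poly Q" by simp
  have "Polynomial.coeff Q i \<in> integers" for i
    using integral_fps_mult[OF integral_fps_to_Nc[of d] assms(3)]
    unfolding Q integral_fps_def by simp
  moreover have "to_Nc (poly d 1) * (v / c) = poly Q 1"
    using dP(5) by (simp add: Q_def field_simps)
  ultimately show ?thesis unfolding rational_at_1_def using dP(1,2) Q by blast
qed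

text \<open>The series \<open>1 - c t\<close> is a polynomial that divides the reversal of \<open>q\<close>, and this reversal is a
  polynomial over the base ring with constant coefficient 1 and with the unit \<open>q(1)\<close> as its value at 1.
  Substitution of \<open>t\<^sup>e\<close> for \<open>t\<close> preserves all this.\<close>

lemma rational_at_1_inverse_linear:
  fixes q :: "'r::idom poly"
  assumes q: "Polynomial.lead_coeff q = 1" "poly q 1 dvd 1" and c: "poly (map_poly to_Nc q) c = 0"
    and e: "e > 0"
  shows "rational_at_1 (1 - fps_const c * fps_X ^ e) (1 - c)"
    "rational_at_1 (inverse (1 - fps_const c * fps_X ^ e)) (inverse (1 - c))" "c \<noteq> 1"
proof -
  have cint: "c \<in> integers" by (rule integersI[OF q(1) c])
  have "rational_at_1 (1 - fps_const c * fps_of_poly (Polynomial.monom 1 e)) (1 - c * poly (Polynomial.monom 1 e) 1)"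
    by (intro rational_at_1_diff rational_at_1_mult rational_at_1_const rational_at_1_1 cint rational_at_1_poly) simp
  thus r: "rational_at_1 (1 - fps_const c * fps_X ^ e) (1 - c)"
    by (simp add: poly_monom fps_of_poly_monom')
  have q1: "poly q 1 \<noteq> 0" using q(2) by auto
  show c1: "c \<noteq> 1" using c q1 by (auto simp: poly_map_to_Nc_1)
  obtain s where s: "map_poly to_Nc q = [:- c, 1:] * s" using c by (metis dvdE poly_eq_0_iff_dvd)
  have "reflect_poly (map_poly to_Nc q) = reflect_poly [:- c, 1:] * reflect_poly s"
    unfolding s by (rule reflect_poly_mult)
  moreover have "reflect_poly [:- c, 1:] = [:1, - c:]"
    by (rule poly_eqI) (auto simp: coeff_reflect_poly coeff_pCons split: nat.splits)
  moreover have mr: "reflect_poly (map_poly to_Nc q) = map_poly to_Nc (reflect_poly q)"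
    by (rule poly_eqI) (simp add: coeff_reflect_poly coeff_map_poly)
  ultimately have refl: "map_poly to_Nc (reflect_poly q) = [:1, - c:] * reflect_poly s" by simp
  define Xe where "Xe = (Polynomial.monom 1 e :: 'r poly)"
  define Ye where "Ye = (Polynomial.monom 1 e :: 'r fract alg_closure poly)"
  define d where "d = pcompose (reflect_poly q) Xe"
  have "map_poly to_Nc d = pcompose (map_poly to_Nc (reflect_poly q)) Ye"
    unfolding d_def to_Nc_hom.map_poly_pcompose by (simp add: Xe_def Ye_def to_Nc_hom.map_poly_hom_monom)
  also have "\<dots> = (1 - Polynomial.smult c Ye) * pcompose (reflect_poly s) Ye"
  proof -
    have "pcompose [:1, - c:] Ye = 1 - Polynomial.smult c Ye"
      by (simp add: pcompose_pCons)
    thus ?thesis by (simp only: refl pcompose_mult)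
  qed
  finally have d: "map_poly to_Nc d = (1 - Polynomial.smult c Ye) * pcompose (reflect_poly s) Ye" .
  define a where "a = 1 - fps_const c * fps_X ^ e"
  have a: "fps_of_poly (1 - Polynomial.smult c Ye) = a"
    by (simp add: a_def Ye_def fps_of_poly_diff fps_of_poly_smult fps_of_poly_monom')
  have a0: "fps_nth a 0 = 1" using e by (simp add: a_def)
  have "fps_of_poly (map_poly to_Nc d) * inverse a = (inverse a * a) * fps_of_poly (pcompose (reflect_poly s) Ye)"
    unfolding d fps_of_poly_mult a by (simp add: mult_ac)
  also have "inverse a * a = 1" using a0 by (intro inverse_mult_eq_1) simp
  finally have Q: "fps_of_poly (map_poly to_Nc d) * inverse a = fps_of_poly (pcompose (reflect_poly s) Ye)" by simp
  have "integral_fps (inverse a)"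
    unfolding integral_fps_def
  proof
    fix n show "fps_nth (inverse a) n \<in> integers"
    proof (induction n rule: less_induct)
      case (less n)
      show ?case
      proof (cases "n = 0")
        case True thus ?thesis using a0 by simp
      next
        case False
        have "0 = fps_nth (a * inverse a) n"
          using inverse_mult_eq_1'[of a] a0 False by simp
        also have "\<dots> = fps_nth (inverse a) n - c * fps_nth (fps_X ^ e * inverse a) n"
          unfolding a_def by (simp add: left_diff_distrib mult.assoc)
        finally have "fps_nth (inverse a) n = c * (if n < e then 0 else fps_nth (inverse a) (n - e))"
          by (simp add: fps_X_power_mult_nth)
        thus ?thesis using less.IH[of "n - e"] e False cint by (auto intro: integers_mult)
      qed
    qed
  qed
  from integral_fps_mult[OF integral_fps_to_Nc[of d] this]
  have P: "Polynomial.coeff (pcompose (reflect_poly s) Ye) i \<in> integers" for i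
    unfolding Q integral_fps_def by simp
  have X1: "poly Xe 1 = 1" "poly Ye 1 = 1" "poly Ye 0 = 0" "poly Xe 0 = 0" using e by (simp_all add: Xe_def Ye_def poly_monom)
  have "to_Nc (poly (reflect_poly q) 1) = to_Nc (poly q 1)"
    unfolding poly_map_to_Nc_1[symmetric] mr[symmetric] by (simp add: poly_reflect_poly_nz)
  hence d1: "poly d 1 = poly q 1"
    by (simp add: d_def poly_pcompose X1)
  have d0: "Polynomial.coeff d 0 = 1"
    using q(1) by (simp add: d_def X1 poly_pcompose coeff_reflect_poly flip: poly_0_coeff_0)
  have "to_Nc (poly d 1) = (1 - c) * poly (pcompose (reflect_poly s) Ye) 1"
    unfolding poly_map_to_Nc_1[symmetric] d by (simp add: X1)
  hence "to_Nc (poly d 1) * inverse (1 - c) = poly (pcompose (reflect_poly s) Ye) 1"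
    using c1 by (simp add: field_simps)
  thus "rational_at_1 (inverse (1 - fps_const c * fps_X ^ e)) (inverse (1 - c))"
    unfolding rational_at_1_def a_def[symmetric]
    using d0 P Q q(2) by (intro exI[of _ d] exI[of _ "pcompose (reflect_poly s) Ye"]) (simp add: d1)
qed

context padic_normal
begin

definition fps_mults :: "nat \<Rightarrow> 'r fract alg_closure fps set" where
  "fps_mults k = {fps_const (of_nat p ^ k) * a | a. integral_fps a}"

lemma fps_mults_iff: "b \<in> fps_mults k \<longleftrightarrow> (\<forall>n. fps_nth b n \<in> mults k)"
proof
  assume "\<forall>n. fps_nth b n \<in> mults k"
  hence "\<forall>n. \<exists>y. y \<in> integers \<and> fps_nth b n = of_nat p ^ k * y" by (auto simp: mults_def)
  then obtain y where y: "\<And>n. y n \<in> integers" "\<And>n. fps_nth b n = of_nat p ^ k * y n" by metis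
  hence "b = fps_const (of_nat p ^ k) * Abs_fps y" "integral_fps (Abs_fps y)"
    by (auto simp: integral_fps_def intro: fps_ext)
  thus "b \<in> fps_mults k" unfolding fps_mults_def by blast
qed (auto simp: fps_mults_def integral_fps_def mults_def)

lemma fps_mults_diff: "a \<in> fps_mults k \<Longrightarrow> b \<in> fps_mults k \<Longrightarrow> a - b \<in> fps_mults k"
  by (simp add: fps_mults_iff mults_diff)

lemma fps_mults_add: "a \<in> fps_mults k \<Longrightarrow> b \<in> fps_mults k \<Longrightarrow> a + b \<in> fps_mults k"
  by (simp add: fps_mults_iff mults_add)

lemma fps_mults_mono: "a \<in> fps_mults k \<Longrightarrow> l \<le> k \<Longrightarrow> a \<in> fps_mults l"
  using mults_mono by (auto simp: fps_mults_iff)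

lemma fps_mults_mult: "integral_fps c \<Longrightarrow> a \<in> fps_mults k \<Longrightarrow> c * a \<in> fps_mults k"
  unfolding fps_mults_iff fps_mult_nth integral_fps_def by (intro allI mults_sum mults_mult') auto

lemma rational_at_1_mults:
  assumes "rational_at_1 b v" "b \<in> fps_mults k"
  shows "v \<in> mults k"
proof -
  obtain a where a: "integral_fps a" "b = fps_const (of_nat p ^ k) * a" using assms(2) by (auto simp: fps_mults_def)
  have "rational_at_1 a (v / of_nat p ^ k)"
    using assms(1) a p_pos by (intro rational_at_1_divide) auto
  hence "v / of_nat p ^ k \<in> integers" by (rule rational_at_1_integral)
  thus ?thesis by (rule multsI) (use p_pos in simp)
qed

text \<open>The logarithm of a rational series is no longer rational, but only a \<open>p\<close>-adic limit of rational series,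
  uniformly in the coefficients.  Its value at 1 is the limit of their values.\<close>

definition value_at_1 :: "'r fract alg_closure fps \<Rightarrow> 'r fract alg_closure \<Rightarrow> bool" where
  "value_at_1 a v \<longleftrightarrow> (\<forall>k. \<exists>s w. rational_at_1 s w \<and> a - s \<in> fps_mults k \<and> v - w \<in> mults k)"

lemma value_at_1_approx:
  assumes "value_at_1 a v" "rational_at_1 s w" "a - s \<in> fps_mults k"
  shows "v - w \<in> mults k"
proof -
  obtain s' w' where s': "rational_at_1 s' w'" "a - s' \<in> fps_mults k" "v - w' \<in> mults k"
    using assms(1) unfolding value_at_1_def by blast
  have "w' - w \<in> mults k"
  proof (rule rational_at_1_mults[OF rational_at_1_diff[OF s'(1) assms(2)]])
    have "s' - s = (a - s) - (a - s')" by simp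
    thus "s' - s \<in> fps_mults k" using fps_mults_diff[OF assms(3) s'(2)] by simp
  qed
  thus ?thesis using mults_add[OF s'(3)] by fastforce
qed

lemma value_at_1_0: "value_at_1 0 0"
  unfolding value_at_1_def using rational_at_1_0
  by (intro allI exI[of _ 0]) (simp add: fps_mults_iff)

lemma value_at_1_add:
  assumes "value_at_1 a v" "value_at_1 b w"
  shows "value_at_1 (a + b) (v + w)"
  unfolding value_at_1_def
proof
  fix k
  obtain s x where s: "rational_at_1 s x" "a - s \<in> fps_mults k" "v - x \<in> mults k"
    using assms(1) unfolding value_at_1_def by blast
  obtain t y where t: "rational_at_1 t y" "b - t \<in> fps_mults k" "w - y \<in> mults k"
    using assms(2) unfolding value_at_1_def by blast
  have "a + b - (s + t) = (a - s) + (b - t)" "v + w - (x + y) = (v - x) + (w - y)" by simp_all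
  thus "\<exists>s z. rational_at_1 s z \<and> a + b - s \<in> fps_mults k \<and> v + w - z \<in> mults k"
    using rational_at_1_add[OF s(1) t(1)] fps_mults_add[OF s(2) t(2)] mults_add[OF s(3) t(3)]
    by (intro exI[of _ "s + t"] exI[of _ "x + y"]) (simp only: simp_thms)
qed

lemma value_at_1_cmult:
  assumes "value_at_1 a v" "c \<in> integers"
  shows "value_at_1 (fps_const c * a) (c * v)"
  unfolding value_at_1_def
proof
  fix k
  obtain s x where s: "rational_at_1 s x" "a - s \<in> fps_mults k" "v - x \<in> mults k"
    using assms(1) unfolding value_at_1_def by blast
  have "fps_const c * a - fps_const c * s = fps_const c * (a - s)" "c * v - c * x = c * (v - x)"
    by (simp_all add: algebra_simps)
  thus "\<exists>s z. rational_at_1 s z \<and> fps_const c * a - s \<in> fps_mults k \<and> c * v - z \<in> mults k"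
    using rational_at_1_mult[OF rational_at_1_const[OF assms(2)] s(1)]
      fps_mults_mult[OF integral_fps_const[OF assms(2)] s(2)] mults_mult'[OF assms(2) s(3)]
    by (intro exI[of _ "fps_const c * s"] exI[of _ "c * x"]) (simp only: simp_thms)
qed

lemma value_at_1_sum:
  "(\<And>i. i \<in> I \<Longrightarrow> value_at_1 (f i) (v i)) \<Longrightarrow> value_at_1 (\<Sum>i\<in>I. f i) (\<Sum>i\<in>I. v i)"
  by (induction I rule: infinite_finite_induct) (auto intro: value_at_1_add value_at_1_0)

text \<open>The exponential maps multiples of \<open>p\<close> to series congruent to 1 modulo \<open>p\<close>, since \<open>p\<^sup>i/i!\<close> is
  divisible by \<open>p\<close> for positive \<open>i\<close>.\<close>

lemma fps_log_divisible:
  assumes u: "fps_nth u 0 = 1" and log: "fps_log u \<in> fps_mults 1"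
  shows "u - 1 \<in> fps_mults 1"
proof -
  obtain W where W: "integral_fps W" "fps_log u = fps_const (of_nat p) * W"
    using log by (auto simp: fps_mults_def)
  have "fps_nth (u - 1) N \<in> mults 1" for N
  proof -
    have "fps_nth u N = fps_nth (fps_exp 1 oo fps_log u) N" using fps_exp_log[OF u] by simp
    also have "\<dots> = (\<Sum>i=0..N. of_nat p ^ i / fact i * fps_nth (W ^ i) N)"
      unfolding fps_compose_nth W(2)
      by (intro sum.cong refl) (simp add: power_mult_distrib fps_const_power)
    also have "\<dots> = fps_nth 1 N + (\<Sum>i=Suc 0..N. of_nat p ^ i / fact i * fps_nth (W ^ i) N)"
      by (simp add: sum.atLeast_Suc_atMost)
    finally have "fps_nth (u - 1) N = (\<Sum>i=Suc 0..N. of_nat p ^ i / fact i * fps_nth (W ^ i) N)" by simp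
    moreover have "\<dots> \<in> mults 1"
      by (intro mults_sum mults_mult power_over_fact)
         (use integral_fps_power[OF W(1)] in \<open>auto simp: integral_fps_def\<close>)
    ultimately show ?thesis by simp
  qed
  thus ?thesis by (simp add: fps_mults_iff)
qed

text \<open>With \<open>u = 1 + p a\<close> the \<open>i\<close>-th term of the logarithm is \<open>\<plusminus> (p\<^sup>i/i) a\<^sup>i\<close>, which
  is divisible by \<open>p\<^sup>k\<close> for \<open>i \<ge> 2 k\<close>.\<close>

lemma log_partial_approx:
  assumes u: "fps_nth u 0 = 1" "fps_log u \<in> fps_mults 1" and z: "rational_at_1 u z" and n: "n \<ge> 2 * k"
  shows "rational_at_1 (fps_log_partial n u) (log_partial n z)"
    "fps_log u - fps_log_partial n u \<in> fps_mults k"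
proof -
  obtain a where a: "integral_fps a" "u - 1 = fps_const (of_nat p) * a"
    using fps_log_divisible[OF u] by (auto simp: fps_mults_def)
  have "rational_at_1 (u - 1) (z - 1)" by (rule rational_at_1_diff[OF z rational_at_1_1])
  hence ra: "rational_at_1 a ((z - 1) / of_nat p)"
    unfolding a(2) by (rule rational_at_1_divide) (use a p_pos in auto)
  have pw: "(u - 1) ^ i = fps_const (of_nat p ^ i) * a ^ i" for i
    unfolding a(2) by (simp add: power_mult_distrib fps_const_power)
  define c :: "nat \<Rightarrow> 'r fract alg_closure" where "c i = (-1) ^ (i + 1) * (of_nat p ^ i / of_nat i)" for i
  have sg: "(-1 :: 'r fract alg_closure) ^ i \<in> integers" for i
    using integers_power[OF integers_uminus[OF integers_1]] .
  have c: "c i \<in> mults l" if "i \<ge> 2 * l" "i > 0" for i l :: nat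
    unfolding c_def by (intro mults_mult' power_over_index that sg)
  have ci: "c i \<in> integers" if "i > 0" for i :: nat using c[of 0 i] that by (auto simp: mults_def)
  have "rational_at_1 (\<Sum>i=1..n. fps_const (c i) * a ^ i) (\<Sum>i=1..n. c i * ((z - 1) / of_nat p) ^ i)"
    by (intro rational_at_1_sum rational_at_1_mult rational_at_1_const rational_at_1_power ra ci) auto
  moreover have "(\<Sum>i=1..n. fps_const (c i) * a ^ i) = fps_log_partial n u"
    unfolding fps_log_partial_def pw
  proof (rule sum.cong[OF refl])
    fix i
    have "fps_const ((- 1) ^ (i + 1) / of_nat i) * (fps_const (of_nat p ^ i) * a ^ i) =
      (fps_const ((- 1) ^ (i + 1) / of_nat i) * fps_const (of_nat p ^ i)) * a ^ i" by (simp only: mult.assoc)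
    also have "fps_const ((- 1) ^ (i + 1) / of_nat i) * fps_const (of_nat p ^ i) = fps_const (c i)"
      by (simp only: fps_const_mult c_def times_divide_eq_left times_divide_eq_right)
    finally show "fps_const (c i) * a ^ i = fps_const ((- 1) ^ (i + 1) / of_nat i) * (fps_const (of_nat p ^ i) * a ^ i)"
      by (rule sym)
  qed
  moreover have "(\<Sum>i=1..n. c i * ((z - 1) / of_nat p) ^ i) = log_partial n z"
    unfolding log_partial_def using p_pos by (intro sum.cong refl) (simp add: c_def power_divide)
  ultimately show "rational_at_1 (fps_log_partial n u) (log_partial n z)" by simp
  show "fps_log u - fps_log_partial n u \<in> fps_mults k"
    unfolding fps_mults_iff
  proof
    fix N
    have "fps_nth (fps_log u - fps_log_partial n u) N = (\<Sum>i=Suc n..max n N. c i * fps_nth (a ^ i) N)"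
      unfolding fps_log_tail[OF u(1)] by (intro sum.cong refl) (simp add: pw c_def)
    also have "\<dots> \<in> mults k"
      by (intro mults_sum mults_mult c)
         (use n integral_fps_power[OF a(1)] in \<open>auto simp: integral_fps_def\<close>)
    finally show "fps_nth (fps_log u - fps_log_partial n u) N \<in> mults k" .
  qed
qed

text \<open>The truncated logarithms of \<open>u\<close> approximate its formal logarithm, and their values at 1 are the partial
  sums of the \<open>p\<close>-adic logarithm of \<open>z\<close>.\<close>

lemma value_at_1_log:
  assumes u: "fps_nth u 0 = 1" "fps_log u \<in> fps_mults 1" and z: "rational_at_1 u z"
    and l: "value_at_1 (fps_log u) l"
  shows "padic_tendsto p (\<lambda>n. log_partial n z) l"
  unfolding padic_tendsto_def
proof
  fix k
  have "\<exists>y. integral_over (range to_Nc) y \<and> log_partial n z - l = of_nat p ^ k * y" if "n \<ge> 2 * k" for n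
  proof -
    have "l - log_partial n z \<in> mults k"
      by (rule value_at_1_approx[OF l log_partial_approx[OF u z that]])
    hence "- (l - log_partial n z) \<in> mults k" by (rule mults_uminus)
    thus ?thesis by (auto simp: mults_def integers_def)
  qed
  thus "\<exists>m. \<forall>n\<ge>m. \<exists>y. integral_over (range to_Nc) y \<and> log_partial n z - l = of_nat p ^ k * y" by blast
qed

lemma padic_tendsto_unique:
  assumes "padic_tendsto p s l" "padic_tendsto p s (l' :: 'r fract alg_closure)"
  shows "l = l'"
proof -
  have "l - l' \<in> mults k" for k
  proof -
    obtain m where m: "\<And>n. n \<ge> m \<Longrightarrow> s n - l \<in> mults k"
      using assms(1) unfolding padic_tendsto_def mults_def integers_def by blast
    obtain m' where m': "\<And>n. n \<ge> m' \<Longrightarrow> s n - l' \<in> mults k"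
      using assms(2) unfolding padic_tendsto_def mults_def integers_def by blast
    have "(s (max m m') - l') - (s (max m m') - l) \<in> mults k" by (intro mults_diff m m') auto
    thus ?thesis by simp
  qed
  hence "l - l' = 0" by (rule mults_separated)
  thus ?thesis by simp
qed

lemma padic_log_eq:
  assumes "padic_tendsto p (\<lambda>n. log_partial n z) (l :: 'r fract alg_closure)"
  shows "padic_log p z = l"
  using assms padic_tendsto_unique unfolding padic_log_def log_partial_def by (intro the_equality) blast+

text \<open>Let \<open>V\<close> have coefficients in the base ring, and let \<open>s = P/d\<close> approximate it modulo \<open>p\<^sup>k\<close>.  The
  coefficients of \<open>P\<close> are only integral, but they are congruent to those of \<open>d V\<close>, which lie in the base
  ring.  Hence the value \<open>P(1)/d(1)\<close> is congruent to an element of the base ring.  As the base ring is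
  complete and \<open>p\<^sup>k\<close> divides the same elements in it as in its integral closure, these elements
  converge to a value in the base ring.\<close>

lemma value_at_1_descent:
  fixes r :: "nat \<Rightarrow> 'r"
  assumes W: "\<And>k. \<exists>s w. rational_at_1 s w \<and> Abs_fps (\<lambda>n. to_Nc (r n)) - s \<in> fps_mults k"
  shows "\<exists>l. value_at_1 (Abs_fps (\<lambda>n. to_Nc (r n))) (to_Nc (l :: 'r))"
proof -
  define V where "V = Abs_fps (\<lambda>n. to_Nc (r n))"
  have "\<exists>s w l. rational_at_1 s w \<and> V - s \<in> fps_mults k \<and> to_Nc (l :: 'r) - w \<in> mults k" for k
  proof -
    obtain s w where s: "rational_at_1 s w" "V - s \<in> fps_mults k" using W[of k] unfolding V_def by blast
    obtain d P where dP: "Polynomial.coeff d 0 = 1" "poly d 1 dvd 1" "\<And>i. Polynomial.coeff P i \<in> integers"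
      "fps_of_poly (map_poly to_Nc d) * s = fps_of_poly P" "to_Nc (poly d 1) * w = poly P 1"
      using s(1) by (auto simp: rational_at_1_def)
    define m where "m = Polynomial.degree P"
    define c where "c n = (\<Sum>i=0..n. Polynomial.coeff d i * r (n - i))" for n
    define Q where "Q = (\<Sum>n\<le>m. Polynomial.monom (c n) n)"
    have cN: "fps_nth (fps_of_poly (map_poly to_Nc d) * V) n = to_Nc (c n)" for n
      by (simp add: fps_mult_nth c_def V_def to_Nc_hom.hom_sum coeff_map_poly)
    have diff: "to_Nc (c n) - Polynomial.coeff P n \<in> mults k" for n
    proof -
      have "fps_of_poly (map_poly to_Nc d) * (V - s) \<in> fps_mults k"
        by (intro fps_mults_mult integral_fps_to_Nc s(2))
      hence "fps_nth (fps_of_poly (map_poly to_Nc d) * V - fps_of_poly P) n \<in> mults k"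
        by (simp add: fps_mults_iff right_diff_distrib dP(4))
      thus ?thesis by (simp only: fps_sub_nth cN fps_of_poly_nth)
    qed
    have P1: "poly P 1 = (\<Sum>n\<le>m. Polynomial.coeff P n)" by (simp add: poly_altdef m_def)
    have Q1: "to_Nc (poly Q 1) = (\<Sum>n\<le>m. to_Nc (c n))"
      by (simp add: Q_def poly_sum poly_monom to_Nc_hom.hom_sum)
    have QP: "to_Nc (poly Q 1) - poly P 1 \<in> mults k"
      unfolding P1 Q1 sum_subtractf[symmetric] by (intro mults_sum diff)
    obtain u where u: "1 = poly d 1 * u" using dP(2) by blast
    have "to_Nc (u * poly d 1) = 1" using u by (simp add: mult.commute)
    hence "to_Nc (poly Q 1 * u) - w = to_Nc u * (to_Nc (poly Q 1) - poly P 1)"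
      unfolding dP(5)[symmetric] by (simp add: algebra_simps)
    hence "to_Nc (poly Q 1 * u) - w \<in> mults k" using mults_mult'[OF integers_to_Nc QP] by simp
    thus ?thesis using s by blast
  qed
  then obtain s w l where swl: "\<And>k. rational_at_1 (s k) (w k)" "\<And>k. V - s k \<in> fps_mults k"
     "\<And>k. to_Nc (l k :: 'r) - w k \<in> mults k" by metis
  have "of_nat p ^ k dvd l (Suc k) - l k" for k
  proof -
    have "w (Suc k) - w k \<in> mults k"
    proof (rule rational_at_1_mults[OF rational_at_1_diff[OF swl(1) swl(1)]])
      have "s (Suc k) - s k = (V - s k) - (V - s (Suc k))" by simp
      also have "\<dots> \<in> fps_mults k"
        by (intro fps_mults_diff swl(2) fps_mults_mono[OF swl(2)[of "Suc k"]]) simp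
      finally show "s (Suc k) - s k \<in> fps_mults k" .
    qed
    moreover have "to_Nc (l (Suc k)) - w (Suc k) \<in> mults k" using mults_mono[OF swl(3)[of "Suc k"]] by simp
    ultimately have "(to_Nc (l (Suc k)) - w (Suc k)) + (w (Suc k) - w k) - (to_Nc (l k) - w k) \<in> mults k"
      using mults_diff[OF mults_add swl(3)] by blast
    hence "to_Nc (l (Suc k) - l k) \<in> mults k" by simp
    thus ?thesis by (simp only: mults_to_Nc)
  qed
  then obtain L where L: "\<And>k. of_nat p ^ k dvd L - l k" using complete by blast
  have "value_at_1 V (to_Nc L)"
    unfolding value_at_1_def
  proof
    fix k
    have "to_Nc (L - l k) \<in> mults k" using L by (simp only: mults_to_Nc)
    hence "to_Nc (L - l k) + (to_Nc (l k) - w k) \<in> mults k" by (intro mults_add swl(3))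
    hence "to_Nc L - w k \<in> mults k" by simp
    thus "\<exists>s w. rational_at_1 s w \<and> V - s \<in> fps_mults k \<and> to_Nc L - w \<in> mults k" using swl(1,2) by blast
  qed
  thus ?thesis unfolding V_def by blast
qed

text \<open>Let \<open>p\<^sup>a\<close> be the \<open>p\<close>-part of \<open>c\<close>.  An approximation of \<open>c W\<close> modulo \<open>p\<^bsup>a+k\<^esup>\<close> has the
  form \<open>c (W - g)\<close> with \<open>g\<close> divisible by \<open>p\<^sup>k\<close>; then \<open>W - g\<close> is rational and approximates \<open>W\<close>.\<close>

lemma approx_divide:
  assumes W: "integral_fps W" and c: "c > 0"
    and approx: "\<And>k. \<exists>s w. rational_at_1 s w \<and> fps_const (of_nat c) * W - s \<in> fps_mults k"
  shows "\<exists>s w. rational_at_1 s w \<and> W - s \<in> fps_mults k"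
proof -
  obtain a c' where c': "c = p ^ a * c'" "\<not> p dvd c'"
    using multiplicity_decompose'[of c p] c p by (metis not_prime_unit neq0_conv)
  have cop: "coprime c' p" using prime_imp_coprime[OF p c'(2)] by (simp add: coprime_commute)
  have c'0: "(of_nat c' :: 'r fract alg_closure) \<noteq> 0" using coprime_pos[OF cop] by simp
  obtain s w where s: "rational_at_1 s w" "fps_const (of_nat c) * W - s \<in> fps_mults (a + k)" using approx by blast
  obtain b where b: "integral_fps b" "fps_const (of_nat c) * W - s = fps_const (of_nat p ^ (a + k)) * b"
    using s(2) by (auto simp: fps_mults_def)
  define g where "g = fps_const (of_nat p ^ k * inverse (of_nat c')) * b"
  have g: "integral_fps g"
    unfolding g_def by (intro integral_fps_mult integral_fps_const integers_mult integers_power integers_of_nat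
        integers_inverse_coprime[OF cop] b(1))
  have "fps_const (of_nat c) * g = fps_const (of_nat p ^ (a + k)) * b"
  proof -
    have "of_nat c * (of_nat p ^ k * inverse (of_nat c' :: 'r fract alg_closure)) = of_nat p ^ (a + k)"
      using c'0 by (simp add: c'(1) power_add field_simps)
    thus ?thesis unfolding g_def by (simp only: mult.assoc[symmetric] fps_const_mult)
  qed
  moreover have "s = fps_const (of_nat c) * W - (fps_const (of_nat c) * W - s)" by simp
  ultimately have "s = fps_const (of_nat c) * (W - g)" unfolding b(2) by (simp add: right_diff_distrib)
  hence "rational_at_1 (W - g) (w / of_nat c)"
    using s(1) W g c by (intro rational_at_1_divide integral_fps_diff) simp_all
  moreover have "W - (W - g) \<in> fps_mults k"
  proof -
    have "g = fps_const (of_nat p ^ k) * (fps_const (inverse (of_nat c')) * b)"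
      unfolding g_def by (simp only: mult.assoc[symmetric] fps_const_mult)
    moreover have "integral_fps (fps_const (inverse (of_nat c')) * b)"
      by (intro integral_fps_mult integral_fps_const integers_inverse_coprime[OF cop] b(1))
    ultimately show ?thesis by (auto simp: fps_mults_def)
  qed
  ultimately show ?thesis by blast
qed

end

section \<open>Units of the group ring and their determinants\<close>

lemma coeff_ring_simps [simp]:
  "carrier coeff_ring = UNIV" "\<zero>\<^bsub>coeff_ring\<^esub> = 0" "\<one>\<^bsub>coeff_ring\<^esub> = 1"
  "a \<oplus>\<^bsub>coeff_ring\<^esub> b = a + b" "a \<otimes>\<^bsub>coeff_ring\<^esub> b = a * b"
  by (simp_all add: ring_of_type_algebra_def)

lemma finsum_coeff_ring:
  fixes f :: "'i \<Rightarrow> 'r::comm_ring_1"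
  assumes "finite A"
  shows "finsum coeff_ring f A = (\<Sum>a\<in>A. f a)"
proof -
  interpret R: cring "coeff_ring :: 'r ring" by (rule cring_from_type_algebra)
  show ?thesis using assms by (induction A) auto
qed

locale padic_group = padic_normal p ty + group G
  for p and ty :: "'r::{idom, ring_char_0} itself" and G :: "('g, 'm) monoid_scheme" (structure) +
  assumes fin: "finite (carrier G)"
begin

definition conv :: "('g \<Rightarrow> 'r) \<Rightarrow> ('g \<Rightarrow> 'r) \<Rightarrow> 'g \<Rightarrow> 'r" where
  "conv x x' g = (\<Sum>h\<in>carrier G. x h * x' (inv h \<otimes> g))"

text \<open>Invertibility in the group ring, in terms of the values on the carrier.\<close>

definition gunit :: "('g \<Rightarrow> 'r) \<Rightarrow> bool" where
  "gunit x \<longleftrightarrow> (\<exists>x'. \<forall>g\<in>carrier G. conv x x' g = (if g = \<one> then 1 else 0))"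

lemma sum_translate:
  fixes f :: "'g \<Rightarrow> 'c::comm_monoid_add"
  assumes "h \<in> carrier G"
  shows "(\<Sum>k\<in>carrier G. f (h \<otimes> k)) = (\<Sum>k\<in>carrier G. f k)"
proof (rule sum.reindex_bij_witness[of _ "\<lambda>k. inv h \<otimes> k" "\<lambda>k. h \<otimes> k"])
qed (use assms in \<open>simp_all add: m_assoc[symmetric]\<close>)

lemma monoid_ring_unit:
  assumes "x \<in> Units (monoid_ring (coeff_ring :: 'r ring) G)"
  shows "gunit x" "\<And>g. g \<notin> carrier G \<Longrightarrow> x g = 0"
proof -
  let ?M = "monoid_ring (coeff_ring :: 'r ring) G"
  have carr: "(\<forall>g. g \<notin> carrier G \<longrightarrow> y g = 0)" if "y \<in> carrier ?M" for y
    using that by (simp add: monoid_ring_def)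
  obtain x' where x': "x \<in> carrier ?M" "x' \<in> carrier ?M" "x \<otimes>\<^bsub>?M\<^esub> x' = \<one>\<^bsub>?M\<^esub>"
    using assms by (auto simp: Units_def)
  show 0: "x g = 0" if "g \<notin> carrier G" for g using carr[OF x'(1)] that by blast
  have z': "x' g = 0" if "g \<notin> carrier G" for g using carr[OF x'(2)] that by blast
  have "conv x x' g = (if g = \<one> then 1 else 0)" if g: "g \<in> carrier G" for g
  proof -
    define S where "S = {(y, z). x y \<noteq> 0 \<and> x' z \<noteq> 0 \<and> y \<otimes> z = g}"
    have S: "S \<subseteq> carrier G \<times> carrier G" using 0 z' by (auto simp: S_def)
    have finS: "finite S" by (rule finite_subset[OF S]) (simp add: fin)
    have Sh: "S \<subseteq> (\<lambda>h. (h, inv h \<otimes> g)) ` carrier G"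
    proof
      fix yz assume yz: "yz \<in> S"
      obtain y z where e: "yz = (y, z)" by (cases yz)
      have yz': "y \<in> carrier G" "z \<in> carrier G" "y \<otimes> z = g" using yz S by (auto simp: S_def e)
      hence "z = inv y \<otimes> g" by (simp add: m_assoc[symmetric] flip: yz'(3))
      thus "yz \<in> (\<lambda>h. (h, inv h \<otimes> g)) ` carrier G" using yz'(1) e by blast
    qed
    have "(x \<otimes>\<^bsub>?M\<^esub> x') g = (\<Sum>(y, z)\<in>S. x y * x' z)"
      using finS unfolding S_def by (simp add: monoid_ring_def finsum_coeff_ring)
    also have "\<dots> = (\<Sum>(y, z)\<in>(\<lambda>h. (h, inv h \<otimes> g)) ` carrier G. x y * x' z)"
    proof (rule sum.mono_neutral_left)
      show "finite ((\<lambda>h. (h, inv h \<otimes> g)) ` carrier G)" using fin by simp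
      show "\<forall>i\<in>(\<lambda>h. (h, inv h \<otimes> g)) ` carrier G - S. (case i of (y, z) \<Rightarrow> x y * x' z) = 0"
        using g by (auto simp: S_def m_assoc[symmetric])
    qed (rule Sh)
    also have "\<dots> = conv x x' g"
      unfolding conv_def by (subst sum.reindex) (auto simp: inj_on_def)
    finally have "conv x x' g = (x \<otimes>\<^bsub>?M\<^esub> x') g" by simp
    thus ?thesis unfolding x'(3) by (simp add: monoid_ring_def)
  qed
  thus "gunit x" unfolding gunit_def by blast
qed

text \<open>The family \<open>1 - t (1 - x)\<close> deforms 1 into \<open>x\<close>.\<close>

definition compl :: "('g \<Rightarrow> 'r) \<Rightarrow> 'g \<Rightarrow> 'r" where
  "compl x g = (if g = \<one> then 1 else 0) - x g"

abbreviation rmat :: "nat \<Rightarrow> ('g \<Rightarrow> 'r fract alg_closure mat) \<Rightarrow> ('g \<Rightarrow> 'r) \<Rightarrow> 'r fract alg_closure mat" where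
  "rmat n T x \<equiv> rep_ext G n T x"

lemma rmat_carrier [simp]: "rmat n T x \<in> carrier_mat n n"
  by (simp add: rep_ext_def)

lemma rmat_index: "i < n \<Longrightarrow> j < n \<Longrightarrow> rmat n T x $$ (i, j) = (\<Sum>g\<in>carrier G. to_Nc (x g) * T g $$ (i, j))"
  by (simp add: rep_ext_def)

lemma rep_mult_index:
  assumes "representation G n T" "g \<in> carrier G" "h \<in> carrier G" "i < n" "j < n"
  shows "T (g \<otimes> h) $$ (i, j) = (\<Sum>k<n. T g $$ (i, k) * T h $$ (k, j))"
proof -
  have "T g \<in> carrier_mat n n" "T h \<in> carrier_mat n n" "T (g \<otimes> h) = T g * T h"
    using assms by (auto simp: representation_def)
  thus ?thesis using assms(4,5) by (simp add: scalar_prod_def atLeast0LessThan)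
qed

lemma rmat_conv:
  assumes T: "representation G n T"
  shows "rmat n T x * rmat n T x' = rmat n T (conv x x')"
proof (rule eq_matI)
  fix i j assume "i < dim_row (rmat n T (conv x x'))" "j < dim_col (rmat n T (conv x x'))"
  hence ij: "i < n" "j < n" by (simp_all add: rep_ext_def)
  have "(rmat n T x * rmat n T x') $$ (i, j) =
     (\<Sum>k<n. (\<Sum>g\<in>carrier G. to_Nc (x g) * T g $$ (i, k)) * (\<Sum>h\<in>carrier G. to_Nc (x' h) * T h $$ (k, j)))"
    using ij by (simp add: rep_ext_def scalar_prod_def atLeast0LessThan)
  also have "\<dots> = (\<Sum>k<n. \<Sum>g\<in>carrier G. \<Sum>h\<in>carrier G. to_Nc (x g) * to_Nc (x' h) * (T g $$ (i, k) * T h $$ (k, j)))"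
    by (simp add: sum_product mult_ac)
  also have "\<dots> = (\<Sum>g\<in>carrier G. \<Sum>h\<in>carrier G. \<Sum>k<n. to_Nc (x g) * to_Nc (x' h) * (T g $$ (i, k) * T h $$ (k, j)))"
    by (rule trans[OF sum.swap], rule sum.cong[OF refl], rule sum.swap)
  also have "\<dots> = (\<Sum>g\<in>carrier G. \<Sum>h\<in>carrier G. to_Nc (x g) * to_Nc (x' h) * T (g \<otimes> h) $$ (i, j))"
    using rep_mult_index[OF T _ _ ij] by (intro sum.cong refl) (simp add: sum_distrib_left)
  also have "\<dots> = (\<Sum>g\<in>carrier G. \<Sum>k\<in>carrier G. to_Nc (x g) * to_Nc (x' (inv g \<otimes> k)) * T k $$ (i, j))"
  proof (rule sum.cong[OF refl])
    fix g assume g: "g \<in> carrier G"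
    have "(\<Sum>h\<in>carrier G. to_Nc (x g) * to_Nc (x' h) * T (g \<otimes> h) $$ (i, j)) =
        (\<Sum>h\<in>carrier G. to_Nc (x g) * to_Nc (x' (inv g \<otimes> (g \<otimes> h))) * T (g \<otimes> h) $$ (i, j))"
      using g by (intro sum.cong refl) (simp add: m_assoc[symmetric])
    also have "\<dots> = (\<Sum>k\<in>carrier G. to_Nc (x g) * to_Nc (x' (inv g \<otimes> k)) * T k $$ (i, j))"
      by (rule sum_translate[OF g, of "\<lambda>k. to_Nc (x g) * to_Nc (x' (inv g \<otimes> k)) * T k $$ (i, j)"])
    finally show "(\<Sum>h\<in>carrier G. to_Nc (x g) * to_Nc (x' h) * T (g \<otimes> h) $$ (i, j)) =
      (\<Sum>k\<in>carrier G. to_Nc (x g) * to_Nc (x' (inv g \<otimes> k)) * T k $$ (i, j))" .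
  qed
  also have "\<dots> = (\<Sum>k\<in>carrier G. \<Sum>g\<in>carrier G. to_Nc (x g) * to_Nc (x' (inv g \<otimes> k)) * T k $$ (i, j))"
    by (rule sum.swap)
  also have "\<dots> = rmat n T (conv x x') $$ (i, j)"
    using ij by (simp add: rmat_index conv_def to_Nc_hom.hom_sum sum_distrib_right)
  finally show "(rmat n T x * rmat n T x') $$ (i, j) = rmat n T (conv x x') $$ (i, j)" .
qed (simp_all add: rep_ext_def)

lemma rmat_delta:
  assumes T: "representation G n T" and x: "\<And>g. g \<in> carrier G \<Longrightarrow> x g = (if g = \<one> then 1 else 0)"
  shows "rmat n T x = 1\<^sub>m n"
proof (rule eq_matI)
  fix i j assume "i < dim_row (1\<^sub>m n)" "j < dim_col (1\<^sub>m n)"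
  hence ij: "i < n" "j < n" by simp_all
  have "rmat n T x $$ (i, j) = (\<Sum>g\<in>carrier G. if g = \<one> then T \<one> $$ (i, j) else 0)"
    unfolding rmat_index[OF ij] using x by (intro sum.cong refl) auto
  also have "\<dots> = T \<one> $$ (i, j)" using fin by simp
  finally show "rmat n T x $$ (i, j) = 1\<^sub>m n $$ (i, j)" using T by (simp add: representation_def)
qed (simp_all add: rep_ext_def)

lemma det_rmat_nonzero:
  assumes T: "representation G n T" and x: "gunit x"
  shows "det (rmat n T x) \<noteq> 0"
proof -
  obtain x' where x': "\<forall>g\<in>carrier G. conv x x' g = (if g = \<one> then 1 else 0)"
    using x by (auto simp: gunit_def)
  have "rmat n T x * rmat n T x' = 1\<^sub>m n"
    unfolding rmat_conv[OF T] by (rule rmat_delta[OF T]) (use x' in blast)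
  hence "det (rmat n T x) * det (rmat n T x') = 1"
    by (metis det_mult det_one rmat_carrier)
  thus ?thesis by auto
qed

lemma rmat_compl:
  assumes T: "representation G n T"
  shows "- char_matrix (rmat n T (compl x)) 1 = rmat n T x"
proof (rule eq_matI)
  fix i j assume "i < dim_row (rmat n T x)" "j < dim_col (rmat n T x)"
  hence ij: "i < n" "j < n" by (simp_all add: rep_ext_def)
  have d: "rmat n T (\<lambda>g. if g = \<one> then 1 else 0) = 1\<^sub>m n" by (rule rmat_delta[OF T]) simp
  have "rmat n T (compl x) $$ (i, j) = rmat n T (\<lambda>g. if g = \<one> then 1 else 0) $$ (i, j) - rmat n T x $$ (i, j)"
    unfolding rmat_index[OF ij] compl_def by (simp add: left_diff_distrib sum_subtractf)
  thus "(- char_matrix (rmat n T (compl x)) 1) $$ (i, j) = rmat n T x $$ (i, j)"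
    using ij unfolding d by (simp add: char_matrix_def rep_ext_def)
qed (simp_all add: rep_ext_def char_matrix_def)

text \<open>If \<open>w\<close> is an eigenvector of \<open>T(1 - x)\<close>, then the functions \<open>g \<mapsto> (T(g) w)\<^sub>k\<close>, not all
  zero, are eigenvectors of \<open>1 - x\<close> acting on the functions on the group.  So \<open>q\<close> can be taken as the
  characteristic polynomial of this action, which is defined over the base ring; its value at 1 is the
  determinant of the invertible element \<open>x\<close>.\<close>

lemma common_annihilator:
  assumes x: "gunit x"
  obtains q :: "'r poly" where "Polynomial.lead_coeff q = 1" "poly q 1 dvd 1"
    "\<And>n T c. representation G n T \<Longrightarrow> poly (char_poly (rmat n T (compl x))) c = 0 \<Longrightarrow>
       poly (map_poly to_Nc q) c = 0"
proof -
  define N where "N = card (carrier G)"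
  obtain f where f: "bij_betw f {..<N} (carrier G)"
    using ex_bij_betw_nat_finite[OF fin] by (auto simp: N_def atLeast0LessThan)
  have fG: "f i \<in> carrier G" if "i < N" for i using f that by (auto simp: bij_betw_def)
  have finj: "f i = f j \<longleftrightarrow> i = j" if "i < N" "j < N" for i j
    using f that by (auto simp: bij_betw_def inj_on_def)
  have fsum: "(\<Sum>k<N. h (f k)) = (\<Sum>k\<in>carrier G. h k)" for h :: "'g \<Rightarrow> 'r"
    by (rule sum.reindex_bij_betw[OF f])
  define M where "M z = mat N N (\<lambda>(i, j). z (inv (f i) \<otimes> f j))" for z :: "'g \<Rightarrow> 'r"
  have M: "M z \<in> carrier_mat N N" for z by (simp add: M_def)
  define q where "q = char_poly (M (compl x))"
  obtain x' where x': "\<And>g. g \<in> carrier G \<Longrightarrow> conv x x' g = (if g = \<one> then 1 else 0)"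
    using x by (auto simp: gunit_def)
  have one: "inv a \<otimes> b = \<one> \<longleftrightarrow> a = b" if "a \<in> carrier G" "b \<in> carrier G" for a b
    using that by (metis inv_closed inv_equality inv_inv l_inv)
  have "M x * M x' = 1\<^sub>m N"
  proof (rule eq_matI)
    fix i j assume "i < dim_row (1\<^sub>m N)" "j < dim_col (1\<^sub>m N)"
    hence ij: "i < N" "j < N" by simp_all
    define a where "a = inv (f i) \<otimes> f j"
    have a: "a \<in> carrier G" using ij fG by (simp add: a_def)
    have "(M x * M x') $$ (i, j) = (\<Sum>k<N. x (inv (f i) \<otimes> f k) * x' (inv (f k) \<otimes> f j))"
      using ij by (simp add: M_def scalar_prod_def atLeast0LessThan)
    also have "\<dots> = (\<Sum>k\<in>carrier G. x (inv (f i) \<otimes> k) * x' (inv k \<otimes> f j))" by (rule fsum)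
    also have "\<dots> = (\<Sum>k\<in>carrier G. x (inv (f i) \<otimes> k) * x' (inv (inv (f i) \<otimes> k) \<otimes> a))"
    proof (rule sum.cong[OF refl])
      fix k assume k: "k \<in> carrier G"
      have ff: "f i \<in> carrier G" "f j \<in> carrier G" using ij fG by simp_all
      have "inv (inv (f i) \<otimes> k) \<otimes> a = inv k \<otimes> f i \<otimes> (inv (f i) \<otimes> f j)"
        using k ff by (simp add: a_def inv_mult_group)
      also have "\<dots> = inv k \<otimes> (f i \<otimes> (inv (f i) \<otimes> f j))" using k ff by (simp only: m_assoc inv_closed m_closed)
      also have "f i \<otimes> (inv (f i) \<otimes> f j) = f j" using ff by (simp add: m_assoc[symmetric])
      finally have "inv (inv (f i) \<otimes> k) \<otimes> a = inv k \<otimes> f j" .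
      thus "x (inv (f i) \<otimes> k) * x' (inv k \<otimes> f j) = x (inv (f i) \<otimes> k) * x' (inv (inv (f i) \<otimes> k) \<otimes> a)"
        by (simp only:)
    qed
    also have "\<dots> = conv x x' a"
      unfolding conv_def using ij fG
      by (intro sum_translate[of "inv (f i)" "\<lambda>k. x k * x' (inv k \<otimes> a)"]) simp
    also have "\<dots> = 1\<^sub>m N $$ (i, j)" using x'[OF a] one ij fG finj by (simp add: a_def)
    finally show "(M x * M x') $$ (i, j) = 1\<^sub>m N $$ (i, j)" .
  qed (simp_all add: M_def)
  hence "det (M x) * det (M x') = 1" by (metis det_mult det_one M)
  hence unit: "det (M x) dvd 1" by (metis dvd_triv_left)
  have "to_Nc (poly q 1) = poly (char_poly (map_mat to_Nc (M (compl x)))) 1"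
    by (simp only: q_def to_Nc_hom.char_poly_hom[OF M] poly_map_to_Nc_1)
  also have "\<dots> = det (- (char_matrix (map_mat to_Nc (M (compl x))) 1))"
    by (rule char_poly_matrix[of _ N]) (simp add: M)
  also have "- (char_matrix (map_mat to_Nc (M (compl x))) 1) = map_mat to_Nc (M x)"
  proof (rule eq_matI)
    fix i j assume "i < dim_row (map_mat to_Nc (M x))" "j < dim_col (map_mat to_Nc (M x))"
    hence ij: "i < N" "j < N" by (simp_all add: M_def)
    thus "(- (char_matrix (map_mat to_Nc (M (compl x))) 1)) $$ (i, j) = map_mat to_Nc (M x) $$ (i, j)"
      using one fG finj by (simp add: char_matrix_def M_def compl_def)
  qed (simp_all add: char_matrix_def M_def)
  also have "det (map_mat to_Nc (M x)) = to_Nc (det (M x))" by (rule to_Nc_hom.hom_det)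
  finally have q1: "poly q 1 dvd 1" using unit by simp
  have lc: "Polynomial.lead_coeff q = 1" using degree_monic_char_poly[OF M] by (simp add: q_def)
  show thesis
  proof (rule that[OF lc q1])
    fix n and T :: "'g \<Rightarrow> 'r fract alg_closure mat" and c
    assume T: "representation G n T" and "poly (char_poly (rmat n T (compl x))) c = 0"
    hence "eigenvalue (rmat n T (compl x)) c"
      using eigenvalue_root_char_poly[OF rmat_carrier[of n T "compl x"], of c] by blast
    then obtain w where w: "w \<in> carrier_vec n" "w \<noteq> 0\<^sub>v n" "rmat n T (compl x) *\<^sub>v w = c \<cdot>\<^sub>v w"
      by (auto simp: eigenvalue_def eigenvector_def rep_ext_def)
    obtain k where k: "k < n" "w $ k \<noteq> 0"
      using w by (metis carrier_vecD eq_vecI index_zero_vec(1) index_zero_vec(2))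
    define v where "v g = (\<Sum>l<n. T g $$ (k, l) * w $ l)" for g
    have "v \<one> = (\<Sum>l<n. if l = k then w $ k else 0)"
      unfolding v_def using T k by (intro sum.cong refl) (auto simp: representation_def)
    hence v1: "v \<one> \<noteq> 0" using k by simp
    have row: "(\<Sum>l<n. rmat n T (compl x) $$ (m, l) * w $ l) = c * w $ m" if "m < n" for m
    proof -
      have "(rmat n T (compl x) *\<^sub>v w) $ m = (\<Sum>l<n. rmat n T (compl x) $$ (m, l) * w $ l)"
        using that w(1) by (simp add: rep_ext_def scalar_prod_def atLeast0LessThan)
      thus ?thesis using w that by simp
    qed
    have "(\<Sum>h\<in>carrier G. to_Nc (compl x (inv g \<otimes> h)) * v h) = c * v g" if g: "g \<in> carrier G" for g
    proof -
      have "(\<Sum>h\<in>carrier G. to_Nc (compl x (inv g \<otimes> h)) * v h) =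
         (\<Sum>h\<in>carrier G. to_Nc (compl x (inv g \<otimes> (g \<otimes> h))) * v (g \<otimes> h))"
        by (rule sum_translate[OF g, symmetric])
      also have "\<dots> = (\<Sum>h\<in>carrier G. to_Nc (compl x h) * (\<Sum>l<n. (\<Sum>m<n. T g $$ (k, m) * T h $$ (m, l)) * w $ l))"
        using g rep_mult_index[OF T g _ k(1)]
        by (intro sum.cong refl) (simp add: v_def m_assoc[symmetric])
      also have "\<dots> = (\<Sum>h\<in>carrier G. \<Sum>l<n. \<Sum>m<n. T g $$ (k, m) * (to_Nc (compl x h) * T h $$ (m, l) * w $ l))"
        by (simp add: sum_distrib_left sum_distrib_right mult_ac)
      also have "\<dots> = (\<Sum>h\<in>carrier G. \<Sum>m<n. \<Sum>l<n. T g $$ (k, m) * (to_Nc (compl x h) * T h $$ (m, l) * w $ l))"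
        by (intro sum.cong refl sum.swap)
      also have "\<dots> = (\<Sum>m<n. \<Sum>h\<in>carrier G. \<Sum>l<n. T g $$ (k, m) * (to_Nc (compl x h) * T h $$ (m, l) * w $ l))"
        by (rule sum.swap)
      also have "\<dots> = (\<Sum>m<n. \<Sum>l<n. \<Sum>h\<in>carrier G. T g $$ (k, m) * (to_Nc (compl x h) * T h $$ (m, l) * w $ l))"
        by (rule sum.cong[OF refl], rule sum.swap)
      also have "\<dots> = (\<Sum>m<n. T g $$ (k, m) * (\<Sum>l<n. rmat n T (compl x) $$ (m, l) * w $ l))"
        by (intro sum.cong refl) (simp add: rmat_index sum_distrib_left sum_distrib_right)
      also have "\<dots> = (\<Sum>m<n. T g $$ (k, m) * (c * w $ m))" by (intro sum.cong refl) (simp add: row)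
      also have "\<dots> = c * v g" by (simp add: v_def sum_distrib_left mult_ac)
      finally show ?thesis .
    qed
    from eigen_root[OF f one_closed v1 this]
    show "poly (map_poly to_Nc q) c = 0" by (simp add: q_def M_def)
  qed
qed

text \<open>The trace of the formal logarithm of \<open>1 - t\<^sup>e (1 - x)\<close>, where \<open>\<chi>\<close> is extended linearly to
  the group ring.  For functions \<open>\<chi>\<close> that need not be characters it is still additive in
  \<open>\<chi>\<close>.\<close>

definition clog :: "nat \<Rightarrow> ('g \<Rightarrow> 'r) \<Rightarrow> ('g \<Rightarrow> 'r fract alg_closure) \<Rightarrow> 'r fract alg_closure fps" where
  "clog e x \<chi> = Abs_fps (\<lambda>N. if N > 0 \<and> e dvd N then
     - (\<Sum>xs\<in>words (carrier G) (N div e). to_Nc (prod_list (map (compl x) xs)) * \<chi> (word_prod G xs)) / of_nat (N div e)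
     else 0)"

lemma pow_mat_commute:
  fixes A :: "'k::comm_ring_1 mat"
  assumes "A \<in> carrier_mat n n"
  shows "A ^\<^sub>m m * A = A * A ^\<^sub>m m"
proof (induction m)
  case (Suc m)
  have "A ^\<^sub>m Suc m * A = (A * A ^\<^sub>m m) * A" using Suc by simp
  also have "\<dots> = A * (A ^\<^sub>m m * A)"
    using assms by (intro assoc_mult_mat[of _ n n _ n _ n]) (auto intro: pow_carrier_mat)
  finally show ?case by simp
qed (use assms in simp)

lemma rmat_power:
  assumes T: "representation G n T" and ij: "i < n" "j < n"
  shows "(rmat n T y ^\<^sub>m m) $$ (i, j) =
    (\<Sum>xs\<in>words (carrier G) m. to_Nc (prod_list (map y xs)) * T (word_prod G xs) $$ (i, j))"
  using ij(1)
proof (induction m arbitrary: i)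
  case 0
  have "T \<one> = 1\<^sub>m n" using T by (simp add: representation_def)
  moreover have "dim_row (rmat n T y) = n" by (simp add: rep_ext_def)
  ultimately show ?case using 0 ij(2) by simp
next
  case (Suc m)
  have c: "rmat n T y ^\<^sub>m m \<in> carrier_mat n n" by (rule pow_carrier_mat) simp
  have "(rmat n T y ^\<^sub>m Suc m) $$ (i, j) = (rmat n T y * rmat n T y ^\<^sub>m m) $$ (i, j)"
    using pow_mat_commute[OF rmat_carrier] by simp
  also have "\<dots> = (\<Sum>k<n. rmat n T y $$ (i, k) * (rmat n T y ^\<^sub>m m) $$ (k, j))"
    using c Suc.prems ij(2) by (simp add: scalar_prod_def atLeast0LessThan rep_ext_def)
  also have "\<dots> = (\<Sum>k<n. \<Sum>g\<in>carrier G. \<Sum>xs\<in>words (carrier G) m.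
      to_Nc (y g) * T g $$ (i, k) * (to_Nc (prod_list (map y xs)) * T (word_prod G xs) $$ (k, j)))"
    using Suc.prems by (intro sum.cong refl) (simp add: Suc.IH rmat_index sum_product)
  also have "\<dots> = (\<Sum>g\<in>carrier G. \<Sum>xs\<in>words (carrier G) m. \<Sum>k<n.
      to_Nc (y g) * T g $$ (i, k) * (to_Nc (prod_list (map y xs)) * T (word_prod G xs) $$ (k, j)))"
    by (rule trans[OF sum.swap], rule sum.cong[OF refl], rule sum.swap)
  also have "\<dots> = (\<Sum>g\<in>carrier G. \<Sum>xs\<in>words (carrier G) m.
      to_Nc (prod_list (map y (g # xs))) * T (word_prod G (g # xs)) $$ (i, j))"
  proof (intro sum.cong refl)
    fix g xs assume g: "g \<in> carrier G" and xs: "xs \<in> words (carrier G) m"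
    have wp: "word_prod G xs \<in> carrier G" using xs by (intro word_prod_closed) (simp add: words_def)
    show "(\<Sum>k<n. to_Nc (y g) * T g $$ (i, k) * (to_Nc (prod_list (map y xs)) * T (word_prod G xs) $$ (k, j))) =
      to_Nc (prod_list (map y (g # xs))) * T (word_prod G (g # xs)) $$ (i, j)"
      using rep_mult_index[OF T g wp Suc.prems ij(2)] by (simp add: sum_distrib_left mult_ac)
  qed
  finally show ?case by (simp only: sum_words_Suc)
qed

lemma mtrace_rmat_power:
  assumes T: "representation G n T"
  shows "mtrace (rmat n T y ^\<^sub>m m) =
    (\<Sum>xs\<in>words (carrier G) m. to_Nc (prod_list (map y xs)) * char_of G n T (word_prod G xs))"
proof -
  have c: "rmat n T y ^\<^sub>m m \<in> carrier_mat n n" by (rule pow_carrier_mat) simp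
  have "mtrace (rmat n T y ^\<^sub>m m) = (\<Sum>i<n. \<Sum>xs\<in>words (carrier G) m. to_Nc (prod_list (map y xs)) * T (word_prod G xs) $$ (i, i))"
    unfolding mtrace_def carrier_matD(1)[OF c] using rmat_power[OF T] by simp
  also have "\<dots> = (\<Sum>xs\<in>words (carrier G) m. to_Nc (prod_list (map y xs)) * (\<Sum>i<n. T (word_prod G xs) $$ (i, i)))"
    by (subst sum.swap) (simp add: sum_distrib_left)
  also have "\<dots> = (\<Sum>xs\<in>words (carrier G) m. to_Nc (prod_list (map y xs)) * char_of G n T (word_prod G xs))"
    by (intro sum.cong refl) (auto simp: char_of_def words_def)
  finally show ?thesis .
qed

lemma prod_list_inverse_fps:
  "inverse (\<Prod>c\<leftarrow>cs. f c :: 'k::field fps) = (\<Prod>c\<leftarrow>cs. inverse (f c))"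
  by (induction cs) (auto simp: fps_inverse_mult)

lemma prod_list_inverse_field:
  "inverse (\<Prod>c\<leftarrow>cs. f c :: 'k::field) = (\<Prod>c\<leftarrow>cs. inverse (f c))"
  by (induction cs) auto

text \<open>The series is \<open>det (1 - t\<^sup>e T(1 - x))\<close>, the product of the series \<open>1 - c t\<^sup>e\<close> over the
  eigenvalues \<open>c\<close> of \<open>T(1 - x)\<close>.  Its logarithm involves only the traces of the powers of \<open>T(1 - x)\<close>,
  which are determined by the character.\<close>

lemma char_series:
  assumes T: "representation G n T" and x: "gunit x" and e: "e > 0"
  obtains f where "fps_nth f 0 = 1" "rational_at_1 f (det (rmat n T x))"
    "rational_at_1 (inverse f) (inverse (det (rmat n T x)))"
    "fps_log f = clog e x (char_of G n T)"
proof -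
  obtain q where q: "Polynomial.lead_coeff q = 1" "poly q 1 dvd 1"
    "\<And>c. poly (char_poly (rmat n T (compl x))) c = 0 \<Longrightarrow> poly (map_poly to_Nc q) c = 0"
    using common_annihilator[OF x] T by metis
  obtain es where es: "char_poly (rmat n T (compl x)) = (\<Prod>c\<leftarrow>es. [:- c, 1:])"
    "\<And>m. mtrace (rmat n T (compl x) ^\<^sub>m m) = (\<Sum>c\<leftarrow>es. c ^ m)"
    using eigenvalue_list[OF rmat_carrier[of n T "compl x"]] by blast
  have root: "poly (map_poly to_Nc q) c = 0" if "c \<in> set es" for c
  proof -
    have "poly (\<Prod>c\<leftarrow>es. [:- c, 1:]) c = 0" using that by (induction es) auto
    thus ?thesis using q(3) es(1) by simp
  qed
  have "poly (\<Prod>c\<leftarrow>es. [:- c, 1:]) 1 = (\<Prod>c\<leftarrow>es. 1 - c)"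
    by (induction es) (auto simp: left_diff_distrib)
  moreover have "poly (char_poly (rmat n T (compl x))) 1 = det (rmat n T x)"
    using char_poly_matrix[OF rmat_carrier, of n T "compl x" 1] rmat_compl[OF T] by simp
  ultimately have det: "det (rmat n T x) = (\<Prod>c\<leftarrow>es. 1 - c)" using es(1) by simp
  define l where "l c = 1 - fps_const c * fps_X ^ e" for c :: "'r fract alg_closure"
  define f where "f = (\<Prod>c\<leftarrow>es. l c)"
  have l0: "fps_nth (l c) 0 = 1" for c using e by (simp add: l_def)
  have f0: "fps_nth f 0 = 1" and flog: "fps_log f = (\<Sum>c\<leftarrow>es. fps_log (l c))"
    using fps_log_prod_list[of es l] l0 by (auto simp: f_def)
  have r1: "rational_at_1 f (det (rmat n T x))"
    unfolding f_def det l_def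
    by (rule rational_at_1_prod_list) (rule rational_at_1_inverse_linear(1)[OF q(1,2) root e])
  have r2: "rational_at_1 (inverse f) (inverse (det (rmat n T x)))"
    unfolding f_def det prod_list_inverse_fps prod_list_inverse_field l_def
    by (rule rational_at_1_prod_list) (rule rational_at_1_inverse_linear(2)[OF q(1,2) root e])
  have "fps_nth (fps_log f) N = fps_nth (clog e x (char_of G n T)) N" for N
  proof -
    have "fps_nth (fps_log f) N = (\<Sum>c\<leftarrow>es. fps_nth (fps_log (l c)) N)"
      unfolding flog by (induction es) auto
    also have "\<dots> = (if N > 0 \<and> e dvd N then - (\<Sum>c\<leftarrow>es. c ^ (N div e)) / of_nat (N div e) else 0)"
      unfolding l_def fps_log_1_minus_nth[OF e] by (induction es) (auto simp: add_divide_distrib diff_divide_distrib)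
    also have "\<dots> = fps_nth (clog e x (char_of G n T)) N"
      unfolding clog_def es(2)[symmetric] mtrace_rmat_power[OF T] by simp
    finally show ?thesis .
  qed
  hence "fps_log f = clog e x (char_of G n T)" by (rule fps_ext)
  with f0 r1 r2 that show thesis by blast
qed

lemma clog_cong:
  assumes "\<And>g. g \<in> carrier G \<Longrightarrow> \<chi> g = \<chi>' g"
  shows "clog e x \<chi> = clog e x \<chi>'"
proof -
  have "(\<Sum>xs\<in>words (carrier G) m. to_Nc (prod_list (map (compl x) xs)) * \<chi> (word_prod G xs)) =
      (\<Sum>xs\<in>words (carrier G) m. to_Nc (prod_list (map (compl x) xs)) * \<chi>' (word_prod G xs))" for m
    by (intro sum.cong refl) (simp add: assms words_def)
  thus ?thesis unfolding clog_def by presburger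
qed

lemma clog_add: "clog e x (\<lambda>g. \<chi> g + \<chi>' g) = clog e x \<chi> + clog e x \<chi>'"
  by (rule fps_ext) (simp add: clog_def distrib_left sum.distrib add_divide_distrib diff_divide_distrib)

lemma clog_diff: "clog e x (\<lambda>g. \<chi> g - \<chi>' g) = clog e x \<chi> - clog e x \<chi>'"
  by (rule fps_ext) (simp add: clog_def right_diff_distrib sum_subtractf diff_divide_distrib)

text \<open>The determinants are the values at 1 of series that are determined by their logarithms, and these
  depend additively on the characters.\<close>

lemma det_ratio:
  assumes T: "representation G n T" "representation G n' T'" and S: "representation G m S" "representation G m' S'"
    and eq: "\<And>g. g \<in> carrier G \<Longrightarrow> char_of G n T g - char_of G n' T' g = char_of G m S g - char_of G m' S' g"
    and x: "gunit x"
  shows "det (rmat n T x) / det (rmat n' T' x) = det (rmat m S x) / det (rmat m' S' x)"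
proof -
  have e: "(1::nat) > 0" by simp
  obtain f1 where f1: "fps_nth f1 0 = 1" "rational_at_1 f1 (det (rmat n T x))" "fps_log f1 = clog 1 x (char_of G n T)"
    using char_series[OF T(1) x e] by blast
  obtain f2 where f2: "fps_nth f2 0 = 1" "rational_at_1 f2 (det (rmat n' T' x))" "fps_log f2 = clog 1 x (char_of G n' T')"
    using char_series[OF T(2) x e] by blast
  obtain f3 where f3: "fps_nth f3 0 = 1" "rational_at_1 f3 (det (rmat m S x))" "fps_log f3 = clog 1 x (char_of G m S)"
    using char_series[OF S(1) x e] by blast
  obtain f4 where f4: "fps_nth f4 0 = 1" "rational_at_1 f4 (det (rmat m' S' x))" "fps_log f4 = clog 1 x (char_of G m' S')"
    using char_series[OF S(2) x e] by blast
  have "fps_log (f1 * f4) = clog 1 x (\<lambda>g. char_of G n T g + char_of G m' S' g)"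
    using f1 f4 by (simp add: fps_log_mult clog_add)
  also have "\<dots> = clog 1 x (\<lambda>g. char_of G m S g + char_of G n' T' g)"
  proof (rule clog_cong)
    fix g assume "g \<in> carrier G"
    from eq[OF this] show "char_of G n T g + char_of G m' S' g = char_of G m S g + char_of G n' T' g"
      by (simp add: algebra_simps)
  qed
  also have "\<dots> = fps_log (f3 * f2)" using f2 f3 by (simp add: fps_log_mult clog_add)
  finally have l: "fps_log (f1 * f4) = fps_log (f3 * f2)" .
  have "fps_nth (f1 * f4) 0 = 1" "fps_nth (f3 * f2) 0 = 1"
    by (simp_all add: f1(1) f2(1) f3(1) f4(1))
  from fps_log_inj[OF this l] have "f1 * f4 = f3 * f2" .
  hence "rational_at_1 (f1 * f4) (det (rmat m S x) * det (rmat n' T' x))"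
    using rational_at_1_mult[OF f3(2) f2(2)] by (simp only:)
  from rational_at_1_unique[OF rational_at_1_mult[OF f1(2) f4(2)] this]
  have "det (rmat n T x) * det (rmat m' S' x) = det (rmat m S x) * det (rmat n' T' x)" .
  thus ?thesis using det_rmat_nonzero[OF T(2) x] det_rmat_nonzero[OF S(2) x] by (simp add: frac_eq_eq)
qed

lemma Det_virtual:
  assumes T: "representation G n T" "representation G n' T'" and x: "gunit x"
    and \<chi>: "\<chi> = (\<lambda>g. char_of G n T g - char_of G n' T' g)"
  shows "\<chi> \<in> virtual_characters G" "Det G x \<chi> = det (rmat n T x) / det (rmat n' T' x)"
proof -
  show v: "\<chi> \<in> virtual_characters G"
    unfolding virtual_characters_def characters_def using T \<chi> by blast
  have "(THE d. \<exists>n T n' T'. representation G n T \<and> representation G n' T' \<and>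
        \<chi> = (\<lambda>g. char_of G n T g - char_of G n' T' g) \<and>
        d = det (rep_ext G n T x) / det (rep_ext G n' T' x)) = det (rmat n T x) / det (rmat n' T' x)"
  proof (rule the_equality)
    show "\<exists>m S m' S'. representation G m S \<and> representation G m' S' \<and>
        \<chi> = (\<lambda>g. char_of G m S g - char_of G m' S' g) \<and>
        det (rmat n T x) / det (rmat n' T' x) = det (rep_ext G m S x) / det (rep_ext G m' S' x)"
      using T \<chi> by blast
    fix d assume "\<exists>m S m' S'. representation G m S \<and> representation G m' S' \<and>
        \<chi> = (\<lambda>g. char_of G m S g - char_of G m' S' g) \<and>
        d = det (rep_ext G m S x) / det (rep_ext G m' S' x)"
    then obtain m S m' S' where S: "representation G m S" "representation G m' S'"
        "\<chi> = (\<lambda>g. char_of G m S g - char_of G m' S' g)"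
        "d = det (rep_ext G m S x) / det (rep_ext G m' S' x)" by blast
    have "char_of G m S g - char_of G m' S' g = char_of G n T g - char_of G n' T' g" for g
      using S(3) \<chi> by metis
    from det_ratio[OF S(1,2) T this x] S(4) show "d = det (rmat n T x) / det (rmat n' T' x)" by simp
  qed
  thus "Det G x \<chi> = det (rmat n T x) / det (rmat n' T' x)" using v by (simp add: Det_def)
qed

lemma zero_representation: "representation G 0 (\<lambda>_. 1\<^sub>m 0)"
  by (simp add: representation_def)

lemma Det_character:
  assumes T: "representation G n T" and x: "gunit x"
  shows "char_of G n T \<in> virtual_characters G" "Det G x (char_of G n T) = det (rmat n T x)"
proof -
  have c: "char_of G n T = (\<lambda>g. char_of G n T g - char_of G 0 (\<lambda>_. 1\<^sub>m 0) g)"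
    by (auto simp: char_of_def fun_eq_iff)
  show "char_of G n T \<in> virtual_characters G" by (rule Det_virtual(1)[OF T zero_representation x c])
  have "det (rmat 0 (\<lambda>_. 1\<^sub>m 0) x) = 1" by (rule det_dim_zero) simp
  thus "Det G x (char_of G n T) = det (rmat n T x)"
    using Det_virtual(2)[OF T zero_representation x c] by simp
qed

end

section \<open>Roots of unity and character values\<close>

lemma card_roots_separable:
  fixes P :: "'k::alg_closed_field poly"
  assumes "P \<noteq> 0" "\<And>a. poly P a = 0 \<Longrightarrow> poly (pderiv P) a \<noteq> 0"
  shows "card {a. poly P a = 0} = Polynomial.degree P"
  using assms
proof (induction "Polynomial.degree P" arbitrary: P)
  case 0
  then obtain c where "P = [:c:]" by (metis degree_eq_zeroE)
  thus ?case using 0 by auto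
next
  case (Suc n)
  then obtain z where z: "poly P z = 0" using alg_closed_imp_poly_has_root[of P] by auto
  then obtain Q where Q: "P = [:- z, 1:] * Q" by (metis dvdE poly_eq_0_iff_dvd)
  have Q0: "Q \<noteq> 0" using Suc.prems(1) Q by auto
  have d: "pderiv P = Q + [:- z, 1:] * pderiv Q"
  proof -
    have "pderiv [:- z, 1:] = 1" by (simp add: pderiv_pCons one_pCons)
    thus ?thesis unfolding Q pderiv_mult by (simp only: mult_1_right add.commute)
  qed
  have "poly Q z \<noteq> 0" using Suc.prems(2)[OF z] d by simp
  have deg: "n = Polynomial.degree Q"
    using Suc.hyps(2) Q0 unfolding Q by (subst (asm) degree_mult_eq) auto
  have "card {a. poly Q a = 0} = Polynomial.degree Q"
  proof (rule Suc.hyps(1)[OF deg Q0])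
    fix a assume "poly Q a = 0"
    thus "poly (pderiv Q) a \<noteq> 0" using Suc.prems(2)[of a] d Q by auto
  qed
  moreover have "{a. poly P a = 0} = insert z {a. poly Q a = 0}" unfolding Q by auto
  moreover have "finite {a. poly Q a = 0}" using Q0 by (rule poly_roots_finite)
  ultimately show ?case using \<open>poly Q z \<noteq> 0\<close> deg Suc.hyps(2) by simp
qed

lemma card_roots_of_unity:
  assumes "n > 0"
  shows "card {w :: 'k::{alg_closed_field, field_char_0}. w ^ n = 1} = n" "finite {w :: 'k. w ^ n = 1}"
proof -
  define P where "P = Polynomial.monom 1 n - (1 :: 'k poly)"
  have deg: "Polynomial.degree P = n"
  proof (rule antisym)
    show "Polynomial.degree P \<le> n" unfolding P_def by (intro degree_diff_le) (auto simp: degree_monom_le)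
    show "n \<le> Polynomial.degree P" unfolding P_def using assms by (intro le_degree) simp
  qed
  hence P0: "P \<noteq> 0" using assms by auto
  have roots: "{w. poly P w = 0} = {w. w ^ n = 1}" by (simp add: P_def poly_monom)
  have "card {w. poly P w = 0} = Polynomial.degree P"
  proof (rule card_roots_separable[OF P0])
    fix a assume "poly P a = 0"
    hence "a ^ n = 1" by (simp add: P_def poly_monom)
    hence "a \<noteq> 0" using assms by (auto simp: power_0_left)
    thus "poly (pderiv P) a \<noteq> 0" using assms by (simp add: P_def pderiv_diff pderiv_monom poly_monom)
  qed
  thus "card {w :: 'k. w ^ n = 1} = n" by (simp only: roots deg)
  show "finite {w :: 'k. w ^ n = 1}" using poly_roots_finite[OF P0] by (simp only: roots)
qed

lemma sum_roots_of_unity: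
  assumes n: "n > 0" and j: "\<not> n dvd j"
  shows "(\<Sum>w | w ^ n = (1 :: 'k::{alg_closed_field, field_char_0}). w ^ j) = 0"
proof -
  define i where "i = j mod n"
  have i: "0 < i" "i < n" using assms by (auto simp: i_def mod_greater_zero_iff_not_dvd)
  have "\<not> {w :: 'k. w ^ n = 1} \<subseteq> {w. w ^ i = 1}"
    using card_mono[OF card_roots_of_unity(2)[OF i(1)], of "{w :: 'k. w ^ n = 1}"] card_roots_of_unity(1)[OF i(1), where 'k = 'k]
      card_roots_of_unity(1)[OF n, where 'k = 'k] i by auto
  then obtain v :: 'k where v: "v ^ n = 1" "v ^ i \<noteq> 1" by blast
  have "v ^ j = v ^ (n * (j div n) + i)" by (simp add: i_def)
  hence vj: "v ^ j \<noteq> 1" using v by (simp add: power_add power_mult)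
  have v0: "v \<noteq> 0" using v(1) n by (auto simp: power_0_left)
  \<comment> \<open>Multiplication by \<open>v\<close> permutes the roots of unity.\<close>
  have "(\<Sum>w | w ^ n = (1 :: 'k). w ^ j) = (\<Sum>w | w ^ n = (1 :: 'k). (v * w) ^ j)"
    by (rule sum.reindex_bij_witness[of _ "\<lambda>w. v * w" "\<lambda>w. w / v"])
       (use v v0 in \<open>auto simp: power_mult_distrib power_divide\<close>)
  also have "\<dots> = v ^ j * (\<Sum>w | w ^ n = (1 :: 'k). w ^ j)"
    by (simp add: power_mult_distrib sum_distrib_left)
  finally have "(v ^ j - 1) * (\<Sum>w | w ^ n = (1 :: 'k). w ^ j) = 0" by (simp add: left_diff_distrib)
  thus ?thesis using vj by simp
qed

context padic_group
begin

lemma pow_card: "g \<in> carrier G \<Longrightarrow> g [^] card (carrier G) = \<one>"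
  using pow_order_eq_1[of g] by (simp add: Coset.order_def)

lemma card_pos: "card (carrier G) > 0"
  using fin one_closed card_gt_0_iff by blast

lemma char_roots_of_unity:
  fixes T :: "'g \<Rightarrow> 'k::{alg_closed_field, field_char_0} mat"
  assumes T: "representation G n T" and g: "g \<in> carrier G"
  shows "\<exists>es. (\<forall>c\<in>set es. c ^ card (carrier G) = 1) \<and> char_of G n T g = sum_list es"
proof -
  have Tg: "T g \<in> carrier_mat n n" using T g by (simp add: representation_def)
  obtain es where es: "char_poly (T g) = (\<Prod>c\<leftarrow>es. [:- c, 1:])" "\<And>m. mtrace (T g ^\<^sub>m m) = (\<Sum>c\<leftarrow>es. c ^ m)"
    using eigenvalue_list[OF Tg] by blast
  have "c ^ card (carrier G) = 1" if "c \<in> set es" for c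
  proof -
    have "poly (char_poly (T g)) c = 0" unfolding es(1) using that by (induction es) auto
    hence "eigenvalue (T g) c" using eigenvalue_root_char_poly[OF Tg] by blast
    then obtain v where v: "eigenvector (T g) v c" by (auto simp: eigenvalue_def)
    have v': "v \<in> carrier_vec n" "v \<noteq> 0\<^sub>v n" using v Tg by (auto simp: eigenvector_def)
    have "T g ^\<^sub>m card (carrier G) = T (g [^] card (carrier G))"
      using representation_pow[OF monoid_axioms T g] by simp
    also have "\<dots> = 1\<^sub>m n" using T g by (simp add: pow_card representation_def)
    finally have "v = c ^ card (carrier G) \<cdot>\<^sub>v v"
      using eigenvector_pow[OF Tg v, of "card (carrier G)"] v' by simp
    moreover obtain k where k: "k < n" "v $ k \<noteq> 0"
      using v' by (metis carrier_vecD eq_vecI index_zero_vec(1) index_zero_vec(2))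
    ultimately have "v $ k = c ^ card (carrier G) * v $ k" using v' by (metis carrier_vecD index_smult_vec(1))
    thus ?thesis using k by simp
  qed
  moreover have "char_of G n T g = sum_list es"
  proof -
    have "T g ^\<^sub>m 1 = T g" using Tg by simp
    thus ?thesis using char_of_mtrace[OF T g] es(2)[of 1] by simp
  qed
  ultimately show ?thesis by blast
qed

lemma char_integers:
  fixes T :: "'g \<Rightarrow> 'r fract alg_closure mat"
  assumes "representation G n T" "g \<in> carrier G"
  shows "char_of G n T g \<in> integers"
proof -
  obtain es where es: "\<forall>c\<in>set es. c ^ card (carrier G) = 1" "char_of G n T g = sum_list es"
    using char_roots_of_unity[OF assms] by blast
  have "sum_list es \<in> integers" using es(1)
    by (induction es) (auto intro: integers_add integers_root_of_unity[OF _ card_pos])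
  thus ?thesis using es(2) by simp
qed

section \<open>Conjugacy classes\<close>

lemma conj_class_self: "g \<in> carrier G \<Longrightarrow> g \<in> conj_class G g"
  unfolding conj_class_def by (intro CollectI exI[of _ "\<one>"]) simp

lemma conj_class_eq:
  assumes g: "g \<in> carrier G" and k: "k \<in> conj_class G g"
  shows "conj_class G k = conj_class G g"
proof -
  obtain h where h: "h \<in> carrier G" "k = h \<otimes> g \<otimes> inv h" using k by (auto simp: conj_class_def)
  have kG: "k \<in> carrier G" using h g by simp
  have gk: "g = inv h \<otimes> k \<otimes> h" using h g by (simp add: m_assoc) (simp add: m_assoc[symmetric])
  show ?thesis
  proof (intro equalityI subsetI)
    fix z assume "z \<in> conj_class G k"
    then obtain a where a: "a \<in> carrier G" "z = a \<otimes> k \<otimes> inv a" by (auto simp: conj_class_def)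
    have "z = (a \<otimes> h) \<otimes> g \<otimes> inv (a \<otimes> h)" using a h g by (simp add: m_assoc inv_mult_group)
    thus "z \<in> conj_class G g" unfolding conj_class_def using a h by blast
  next
    fix z assume "z \<in> conj_class G g"
    then obtain a where a: "a \<in> carrier G" "z = a \<otimes> g \<otimes> inv a" by (auto simp: conj_class_def)
    have "z = (a \<otimes> inv h) \<otimes> k \<otimes> inv (a \<otimes> inv h)"
      using a h kG unfolding a(2) gk by (simp add: m_assoc inv_mult_group)
    thus "z \<in> conj_class G k" unfolding conj_class_def using a h by blast
  qed
qed

lemma conj_classes_mem_iff:
  assumes "c \<in> conj_classes G" "g \<in> carrier G"
  shows "g \<in> c \<longleftrightarrow> c = conj_class G g"
proof -
  obtain h where h: "h \<in> carrier G" "c = conj_class G h" using assms(1) by (auto simp: conj_classes_def)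
  thus ?thesis using conj_class_eq[OF h(1), of g] conj_class_self[OF assms(2)] by auto
qed

lemma class_swap:
  assumes c: "c \<in> conj_classes G" and ab: "a \<in> carrier G" "b \<in> carrier G"
  shows "a \<otimes> b \<in> c \<longleftrightarrow> b \<otimes> a \<in> c"
proof -
  have "a \<otimes> b = a \<otimes> (b \<otimes> a) \<otimes> inv a" using ab by (simp add: m_assoc)
  hence "a \<otimes> b \<in> conj_class G (b \<otimes> a)" unfolding conj_class_def using ab by blast
  hence "conj_class G (a \<otimes> b) = conj_class G (b \<otimes> a)" using conj_class_eq ab by blast
  thus ?thesis using conj_classes_mem_iff[OF c] ab by auto
qed

lemma finite_conj_classes: "finite (conj_classes G)"
  using fin by (simp add: conj_classes_def)

lemma char_conj:
  assumes T: "representation G n T" and g: "g \<in> carrier G" and k: "k \<in> conj_class G g"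
  shows "char_of G n T k = char_of G n T g"
proof -
  obtain h where h: "h \<in> carrier G" "k = h \<otimes> (g \<otimes> inv h)" using k g by (auto simp: conj_class_def m_assoc)
  have c: "T a \<in> carrier_mat n n" if "a \<in> carrier G" for a using T that by (simp add: representation_def)
  have m: "T (a \<otimes> b) = T a * T b" if "a \<in> carrier G" "b \<in> carrier G" for a b
    using T that by (simp add: representation_def)
  have "char_of G n T k = mtrace (T h * T (g \<otimes> inv h))"
    using char_of_mtrace[OF T, of k] h g m by simp
  also have "\<dots> = mtrace (T (g \<otimes> inv h) * T h)"
    by (rule mtrace_mult_comm[of _ n n]) (use c h g in auto)
  also have "T (g \<otimes> inv h) * T h = T g" using h g by (simp add: m[symmetric] m_assoc)
  finally show ?thesis using char_of_mtrace[OF T g] by simp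
qed

lemma char_class:
  assumes T: "representation G n T" and g: "g \<in> carrier G"
  shows "the_elem (char_of G n T ` conj_class G g) = char_of G n T g"
proof -
  have "char_of G n T ` conj_class G g \<subseteq> {char_of G n T g}"
    using char_conj[OF T g] by (intro image_subsetI) simp
  moreover have "char_of G n T g \<in> char_of G n T ` conj_class G g"
    by (rule imageI[OF conj_class_self[OF g]])
  ultimately have "char_of G n T ` conj_class G g = {char_of G n T g}"
    by (intro equalityI) simp_all
  thus ?thesis by simp
qed

lemma char_expand:
  fixes T :: "'g \<Rightarrow> 'k::field mat"
  assumes T: "representation G n T" and g: "g \<in> carrier G"
  shows "char_of G n T g = (\<Sum>c\<in>conj_classes G. (if g \<in> c then 1 else 0) * the_elem (char_of G n T ` c))"
proof -
  have "(\<Sum>c\<in>conj_classes G. (if g \<in> c then 1 else 0) * the_elem (char_of G n T ` c)) =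
     (\<Sum>c\<in>conj_classes G. if c = conj_class G g then the_elem (char_of G n T ` conj_class G g) else 0)"
    using conj_classes_mem_iff g by (intro sum.cong refl) auto
  also have "\<dots> = char_of G n T g"
    using g finite_conj_classes char_class[OF T g] by (simp add: conj_classes_def)
  finally show ?thesis by simp
qed

text \<open>Characters separate conjugacy classes.  Here this is needed with integral coefficients \<open>a\<close>, which are
  found as follows.  Right multiplication by an element \<open>g0\<close> of the class \<open>c\<close> commutes with the regular
  representation.  Its composition with left multiplication by \<open>h\<close> has as its trace the number of \<open>i\<close>
  with \<open>i g0 = h i\<close>, which vanishes unless \<open>h\<close> is conjugate to \<open>g0\<close>.  Fourier inversion over the roots
  of unity \<open>w\<close> expresses this trace by the characters of the isotypic parts.\<close>

lemma class_separation:
  assumes c: "c \<in> conj_classes G"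
  obtains \<Omega> :: "'r fract alg_closure set"
    and a :: "'r fract alg_closure \<Rightarrow> 'r fract alg_closure" and d T and z :: nat where "finite \<Omega>" "z > 0"
    "\<And>w. w \<in> \<Omega> \<Longrightarrow> a w \<in> integers" "\<And>w. w \<in> \<Omega> \<Longrightarrow> representation G (d w) (T w)"
    "\<And>c'. c' \<in> conj_classes G \<Longrightarrow>
       (\<Sum>w\<in>\<Omega>. a w * the_elem (char_of G (d w) (T w) ` c')) = (if c' = c then of_nat z else 0)"
proof -
  obtain g0 where g0: "g0 \<in> carrier G" "c = conj_class G g0" using c by (auto simp: conj_classes_def)
  define n where "n = card (carrier G)"
  have n: "n > 0" using card_pos by (simp add: n_def)
  define \<Omega> where "\<Omega> = {w :: 'r fract alg_closure. w ^ n = 1}"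
  have fin\<Omega>: "finite \<Omega>" and card\<Omega>: "card \<Omega> = n" using card_roots_of_unity[OF n] by (simp_all add: \<Omega>_def)
  define \<rho> :: "'g \<Rightarrow> 'g \<Rightarrow> 'g \<Rightarrow> 'r fract alg_closure" where "\<rho> h i j = (if i = h \<otimes> j then 1 else 0)" for h i j
  define s where "s i = i \<otimes> g0" for i
  have rep: "rep_on G (carrier G) \<rho>"
    unfolding rep_on_def
  proof (intro conjI ballI)
    fix g h i j assume gh: "g \<in> carrier G" "h \<in> carrier G" and ij: "i \<in> carrier G" "j \<in> carrier G"
    have "(\<Sum>k\<in>carrier G. \<rho> g i k * \<rho> h k j) = (\<Sum>k\<in>carrier G. if k = h \<otimes> j then \<rho> g i k else 0)"
      by (intro sum.cong refl) (simp add: \<rho>_def)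
    also have "\<dots> = \<rho> g i (h \<otimes> j)" using fin gh ij by simp
    finally show "\<rho> (g \<otimes> h) i j = (\<Sum>k\<in>carrier G. \<rho> g i k * \<rho> h k j)"
      using gh ij by (simp add: \<rho>_def m_assoc)
  qed (use fin in \<open>auto simp: \<rho>_def\<close>)
  have st: "(s ^^ t) i = i \<otimes> g0 [^] t" if "i \<in> carrier G" for t i
    using that g0 by (induction t) (auto simp: s_def m_assoc)
  have s1: "s i \<in> carrier G" if "i \<in> carrier G" for i using that g0 by (simp add: s_def)
  have s2: "(s ^^ n) i = i" if "i \<in> carrier G" for i using that g0 by (simp add: st n_def pow_card)
  have inv: "\<rho> h (s i) (s j) = \<rho> h i j" if "h \<in> carrier G" "i \<in> carrier G" "j \<in> carrier G" for h i j
    using that g0 by (simp add: \<rho>_def s_def m_assoc[symmetric])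
  define tr where "tr t h = (\<Sum>i\<in>carrier G. \<rho> h ((s ^^ t) i) i)" for t h
  have "\<forall>w. \<exists>m T. w \<in> \<Omega> \<longrightarrow> representation G m T \<and> (\<forall>h\<in>carrier G. char_of G m T h = (\<Sum>t<n. w ^ t * tr t h) / of_nat n)"
  proof
    fix w :: "'r fract alg_closure"
    show "\<exists>m T. w \<in> \<Omega> \<longrightarrow> representation G m T \<and> (\<forall>h\<in>carrier G. char_of G m T h = (\<Sum>t<n. w ^ t * tr t h) / of_nat n)"
      using cyclic_isotypic_rep[OF rep monoid_axioms s1 s2 n inv, of w] unfolding tr_def \<Omega>_def by blast
  qed
  then obtain d T where dT: "\<And>w. w \<in> \<Omega> \<Longrightarrow> representation G (d w) (T w)"
    "\<And>w h. w \<in> \<Omega> \<Longrightarrow> h \<in> carrier G \<Longrightarrow> char_of G (d w) (T w) h = (\<Sum>t<n. w ^ t * tr t h) / of_nat n"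
    by metis
  \<comment> \<open>The factor \<open>w\<^bsup>n-1\<^esup> = w\<inverse>\<close> selects \<open>t = 1\<close>, and \<open>n\<close> clears the denominator.\<close>
  define a where "a w = of_nat n * w ^ (n - 1)" for w :: "'r fract alg_closure"
  define z where "z = n * card {i \<in> carrier G. i \<otimes> g0 = g0 \<otimes> i}"
  have z: "z > 0"
  proof -
    have "\<one> \<in> {i \<in> carrier G. i \<otimes> g0 = g0 \<otimes> i}" using g0 by simp
    thus ?thesis unfolding z_def using n fin by (auto simp: card_gt_0_iff)
  qed
  have key: "(\<Sum>w\<in>\<Omega>. a w * char_of G (d w) (T w) h) = of_nat n * of_nat (card {i \<in> carrier G. i \<otimes> g0 = h \<otimes> i})"
    if h: "h \<in> carrier G" for h
  proof -
    have "(\<Sum>w\<in>\<Omega>. a w * char_of G (d w) (T w) h) = (\<Sum>w\<in>\<Omega>. \<Sum>t<n. w ^ (n - 1 + t) * tr t h)"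
    proof (rule sum.cong[OF refl])
      fix w assume w: "w \<in> \<Omega>"
      have "a w * char_of G (d w) (T w) h = w ^ (n - 1) * (\<Sum>t<n. w ^ t * tr t h)"
        using n by (simp add: a_def dT(2)[OF w h])
      thus "a w * char_of G (d w) (T w) h = (\<Sum>t<n. w ^ (n - 1 + t) * tr t h)"
        by (simp only: sum_distrib_left power_add mult.assoc)
    qed
    also have "\<dots> = (\<Sum>t<n. (\<Sum>w\<in>\<Omega>. w ^ (n - 1 + t)) * tr t h)"
      by (subst sum.swap) (simp add: sum_distrib_right)
    \<comment> \<open>For the trivial group the exponent \<open>t = 1\<close> is represented by 0, whence \<open>1 mod n\<close>.\<close>
    also have "\<dots> = (\<Sum>t<n. if t = 1 mod n then of_nat n * tr t h else 0)"
    proof (rule sum.cong[OF refl])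
      fix t assume t: "t \<in> {..<n}"
      show "(\<Sum>w\<in>\<Omega>. w ^ (n - 1 + t)) * tr t h = (if t = 1 mod n then of_nat n * tr t h else 0)"
      proof (cases "t = 1 mod n")
        case True
        have "w ^ (n - 1 + t) = 1" if "w \<in> \<Omega>" for w
        proof (cases "n = 1")
          case False
          hence "n - 1 + t = n" using True n by simp
          thus ?thesis using that by (simp add: \<Omega>_def)
        qed (use True in simp)
        thus ?thesis using True card\<Omega> by simp
      next
        case False
        have "\<not> n dvd n - 1 + t"
        proof
          assume "n dvd n - 1 + t"
          then obtain q where q: "n - 1 + t = n * q" by blast
          have "n * q < n * 2" unfolding q[symmetric] using t n by simp
          hence "q < 2" by (simp only: mult_less_cancel1)
          moreover have "q \<noteq> 0 \<or> n = 1" using q n by (cases "q = 0") auto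
          ultimately have "n = 1 \<or> q = 1" by linarith
          thus False using False q t n by (cases "n = 1") (auto simp: mod_less)
        qed
        thus ?thesis using False sum_roots_of_unity[OF n, where 'k = "'r fract alg_closure"] by (simp add: \<Omega>_def)
      qed
    qed
    also have "\<dots> = of_nat n * tr (1 mod n) h" using n by simp
    also have "tr (1 mod n) h = (\<Sum>i\<in>carrier G. if i \<otimes> g0 = h \<otimes> i then 1 else 0)"
    proof -
      have "g0 [^] (1 mod n) = g0"
      proof (cases "n = 1")
        case True
        thus ?thesis using pow_card[OF g0(1)] g0 by (simp add: n_def)
      qed (use n g0 in simp)
      thus ?thesis unfolding tr_def \<rho>_def by (intro sum.cong refl) (simp add: st)
    qed
    also have "\<dots> = of_nat (card {i \<in> carrier G. i \<otimes> g0 = h \<otimes> i})"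
      using fin by (simp add: sum.If_cases Int_def)
    finally show ?thesis .
  qed
  have aI: "a w \<in> integers" if "w \<in> \<Omega>" for w
    using that n unfolding a_def \<Omega>_def
    by (intro integers_mult integers_of_nat integers_power integers_root_of_unity[OF _ n]) simp
  show thesis
  proof (rule that[OF fin\<Omega> z])
    show "a w \<in> integers" if "w \<in> \<Omega>" for w using aI[OF that] .
    show "representation G (d w) (T w)" if "w \<in> \<Omega>" for w using dT(1)[OF that] .
    fix c' assume "c' \<in> conj_classes G"
    then obtain h where h: "h \<in> carrier G" "c' = conj_class G h" by (auto simp: conj_classes_def)
    show "(\<Sum>w\<in>\<Omega>. a w * the_elem (char_of G (d w) (T w) ` c')) = (if c' = c then of_nat z else 0)"
    proof (cases "c' = c")
      case True
      have "(\<Sum>w\<in>\<Omega>. a w * the_elem (char_of G (d w) (T w) ` c')) = (\<Sum>w\<in>\<Omega>. a w * char_of G (d w) (T w) g0)"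
        unfolding True g0(2) using char_class[OF dT(1) g0(1)] by (intro sum.cong refl) simp
      thus ?thesis using key[OF g0(1)] True by (simp add: z_def)
    next
      case False
      have e: "{i \<in> carrier G. i \<otimes> g0 = h \<otimes> i} = {}"
      proof (rule ccontr)
        assume "{i \<in> carrier G. i \<otimes> g0 = h \<otimes> i} \<noteq> {}"
        then obtain i where i: "i \<in> carrier G" "i \<otimes> g0 = h \<otimes> i" by blast
        have "h = h \<otimes> i \<otimes> inv i" using i h by (simp add: m_assoc)
        hence "h \<in> conj_class G g0" unfolding conj_class_def i(2)[symmetric] using i by blast
        hence "conj_class G h = conj_class G g0" by (rule conj_class_eq[OF g0(1)])
        thus False using False h(2) g0(2) by metis
      qed
      have "(\<Sum>w\<in>\<Omega>. a w * the_elem (char_of G (d w) (T w) ` c')) = (\<Sum>w\<in>\<Omega>. a w * char_of G (d w) (T w) h)"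
        unfolding h(2) using char_class[OF dT(1) h(1)] by (intro sum.cong refl) simp
      thus ?thesis using False unfolding key[OF h(1)] e by simp
    qed
  qed
qed

end

section \<open>The lift of Frobenius and the determinants of Galois conjugate representations\<close>

lemma comm_ring_hom_funpow:
  fixes \<sigma> :: "'k::comm_ring_1 \<Rightarrow> 'k"
  assumes "comm_ring_hom \<sigma>"
  shows "comm_ring_hom (\<sigma> ^^ n)"
proof -
  interpret \<sigma>: comm_ring_hom \<sigma> by (rule assms)
  show ?thesis
    by unfold_locales (induction n; simp add: \<sigma>.hom_add \<sigma>.hom_mult)+
qed

locale frobenius_group = padic_group p ty G
  for p and ty :: "'r::{idom, ring_char_0} itself" and G :: "('g, 'm) monoid_scheme" (structure) +
  fixes F :: "'r \<Rightarrow> 'r"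
  assumes F_add: "F (a + b) = F a + F b" and F_mult: "F (a * b) = F a * F b" and F_1: "F 1 = 1"
    and F_lift: "of_nat p dvd F r - r ^ p"
    and F_inj: "F r = 0 \<Longrightarrow> r = 0"
begin

lemma F_0: "F 0 = 0"
  using F_add[of 0 0] by simp

sublocale F: comm_ring_hom F
  by unfold_locales (simp_all add: F_add F_mult F_1 F_0)

lemma gunit_F: "gunit x \<Longrightarrow> gunit (\<lambda>g. F (x g))"
proof -
  assume "gunit x"
  then obtain x' where x': "\<forall>g\<in>carrier G. conv x x' g = (if g = \<one> then 1 else 0)" by (auto simp: gunit_def)
  have "conv (\<lambda>g. F (x g)) (\<lambda>g. F (x' g)) g = F (conv x x' g)" for g
    by (simp add: conv_def F.hom_sum F_mult)
  thus "gunit (\<lambda>g. F (x g))"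
    unfolding gunit_def using x' by (intro exI[of _ "\<lambda>g. F (x' g)"]) (simp add: F_0 F_1)
qed

lemma compl_F: "compl (\<lambda>g. F (x g)) = (\<lambda>g. F (compl x g))"
  by (auto simp: compl_def fun_eq_iff F.hom_minus F_1 F_0)

lemma prod_list_F: "prod_list (map (\<lambda>g. F (y g)) xs) = F (prod_list (map y xs))"
  by (induction xs) (simp_all add: F_1 F_mult)

text \<open>As \<open>F\<close> is injective, it extends to the field of fractions and then to the algebraic closure.\<close>

lemma frobenius_extension:
  obtains \<sigma> :: "'r fract alg_closure \<Rightarrow> 'r fract alg_closure" where "comm_ring_hom \<sigma>" "\<And>r. \<sigma> (to_Nc r) = to_Nc (F r)"
proof -
  define \<Gamma> where "\<Gamma> = {(to_Nc a / to_Nc b, to_Nc (F a) / to_Nc (F b)) | a b. b \<noteq> 0}"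
  have Fb: "F b \<noteq> 0" if "b \<noteq> 0" for b using F_inj that by blast
  have mem: "(to_Nc a / to_Nc b, to_Nc (F a) / to_Nc (F b)) \<in> \<Gamma>" if "b \<noteq> 0" for a b
    unfolding \<Gamma>_def using that by blast
  have graph: "subring_graph \<Gamma>"
    unfolding subring_graph_def
  proof (intro conjI allI impI)
    show "(1, 1) \<in> \<Gamma>" using mem[of 1 1] by (simp add: F_1)
    show "b = 0" if "(0, b) \<in> \<Gamma>" for b using that by (auto simp: \<Gamma>_def F_0)
    fix x y z w assume "(x, y) \<in> \<Gamma>" "(z, w) \<in> \<Gamma>"
    then obtain a b c d where abcd: "x = to_Nc a / to_Nc b" "y = to_Nc (F a) / to_Nc (F b)" "b \<noteq> 0"
      "z = to_Nc c / to_Nc d" "w = to_Nc (F c) / to_Nc (F d)" "d \<noteq> 0"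
      by (auto simp: \<Gamma>_def)
    show "(x + z, y + w) \<in> \<Gamma>"
      using mem[of "b * d" "a * d + c * b"] abcd Fb by (simp add: F_add F_mult add_frac_eq)
    show "(x - z, y - w) \<in> \<Gamma>"
      using mem[of "b * d" "a * d - c * b"] abcd Fb by (simp add: F.hom_minus F_mult diff_frac_eq)
    show "(x * z, y * w) \<in> \<Gamma>"
      using mem[of "b * d" "a * c"] abcd by (simp add: F_mult)
  qed
  interpret hom_graph \<Gamma>
  proof
    show "subring_graph \<Gamma>" by (rule graph)
    show "(inverse a, inverse b) \<in> \<Gamma>" if ab: "(a, b) \<in> \<Gamma>" "a \<noteq> 0" for a b
    proof -
      obtain c d where cd: "a = to_Nc c / to_Nc d" "b = to_Nc (F c) / to_Nc (F d)" "d \<noteq> 0"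
        using ab(1) by (auto simp: \<Gamma>_def)
      have "c \<noteq> 0" using ab(2) cd by auto
      thus ?thesis using mem[of c d] cd by simp
    qed
    show "\<exists>P. P \<noteq> 0 \<and> (\<forall>i. Polynomial.coeff P i \<in> Domain \<Gamma>) \<and> poly P x = 0" for x
    proof -
      obtain P where P: "P \<noteq> 0" "poly (map_poly to_ac P) x = 0" by (rule alg_closure_algebraic)
      have "to_ac z \<in> Domain \<Gamma>" for z :: "'r fract"
      proof (cases z)
        case (Fract a b)
        hence "to_ac z = to_Nc a / to_Nc b" by (simp add: Fract_conv_to_fract to_Nc_def)
        thus ?thesis using mem[of b a] Fract by auto
      qed
      moreover have "map_poly to_ac P \<noteq> 0" using P(1) by (metis map_poly_eq_0_iff to_ac_0 to_ac_eq_0_iff)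
      ultimately show ?thesis
        by (intro exI[of _ "map_poly to_ac P"]) (use P(2) in \<open>simp add: coeff_map_poly\<close>)
    qed
  qed
  obtain \<sigma> :: "'r fract alg_closure \<Rightarrow> 'r fract alg_closure" where \<sigma>: "\<sigma> 1 = 1" "\<forall>x y. \<sigma> (x + y) = \<sigma> x + \<sigma> y"
    "\<forall>x y. \<sigma> (x * y) = \<sigma> x * \<sigma> y" and "\<forall>(a, b)\<in>\<Gamma>. \<sigma> a = b"
    using hom_extension by blast
  hence ext: "\<sigma> a = b" if "(a, b) \<in> \<Gamma>" for a b using that by auto
  have "\<sigma> 0 = 0" using \<sigma>(2)[rule_format, of 0 0] by simp
  hence "comm_ring_hom \<sigma>" by unfold_locales (simp_all add: \<sigma>)
  moreover have "\<sigma> (to_Nc r) = to_Nc (F r)" for r using ext[OF mem[of 1 r]] by (simp add: F_1)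
  ultimately show thesis by (rule that)
qed

text \<open>The endomorphism is injective and permutes the finite set of \<open>n\<close>-th roots of unity.\<close>

lemma fixes_roots_of_unity:
  fixes \<sigma> :: "'r fract alg_closure \<Rightarrow> 'r fract alg_closure"
  assumes "comm_ring_hom \<sigma>" and n: "n > 0"
  obtains k where "\<And>w. w ^ n = 1 \<Longrightarrow> (\<sigma> ^^ Suc k) w = w"
proof -
  define \<Omega> where "\<Omega> = {w :: 'r fract alg_closure. w ^ n = 1}"
  have fin\<Omega>: "finite \<Omega>" unfolding \<Omega>_def by (rule card_roots_of_unity(2)[OF n])
  have h: "comm_ring_hom (\<sigma> ^^ i)" for i by (rule comm_ring_hom_funpow[OF assms(1)])
  have pw: "(\<sigma> ^^ i) (x ^ m) = (\<sigma> ^^ i) x ^ m" for i m x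
  proof -
    interpret s: comm_ring_hom "\<sigma> ^^ i" by (rule h)
    show ?thesis by (rule s.hom_power)
  qed
  have inj: "inj (\<sigma> ^^ i)" for i
  proof -
    interpret s: comm_ring_hom "\<sigma> ^^ i" by (rule h)
    have "x = 0" if "(\<sigma> ^^ i) x = 0" for x
    proof (rule ccontr)
      assume "x \<noteq> 0"
      hence "(\<sigma> ^^ i) (x * inverse x) = 1" by simp
      thus False using that by (simp add: s.hom_mult del: right_inverse)
    qed
    thus ?thesis unfolding inj_def by (metis s.hom_minus eq_iff_diff_eq_0)
  qed
  have one: "(\<sigma> ^^ i) 1 = 1" for i
  proof -
    interpret s: comm_ring_hom "\<sigma> ^^ i" by (rule h)
    show ?thesis by simp
  qed
  have stay: "(\<sigma> ^^ i) w \<in> \<Omega>" if "w \<in> \<Omega>" for i w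
  proof -
    have "(\<sigma> ^^ i) w ^ n = (\<sigma> ^^ i) 1" using that pw[of i w n] by (simp add: \<Omega>_def)
    thus ?thesis by (simp only: one \<Omega>_def mem_Collect_eq)
  qed
  have "\<exists>k>0. (\<sigma> ^^ k) w = w" if w: "w \<in> \<Omega>" for w
  proof -
    have "range (\<lambda>i. (\<sigma> ^^ i) w) \<subseteq> \<Omega>" using stay w by blast
    hence "finite (range (\<lambda>i. (\<sigma> ^^ i) w))" using fin\<Omega> finite_subset by blast
    hence "\<not> inj (\<lambda>i. (\<sigma> ^^ i) w)" using range_inj_infinite by blast
    then obtain i j where ij: "i \<noteq> j" "(\<sigma> ^^ i) w = (\<sigma> ^^ j) w" by (auto simp: inj_def)
    have *: "\<exists>k>0. (\<sigma> ^^ k) w = w" if "i < j" "(\<sigma> ^^ i) w = (\<sigma> ^^ j) w" for i j :: nat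
    proof -
      have "(\<sigma> ^^ (i + (j - i))) w = (\<sigma> ^^ i) w" using that by simp
      hence "(\<sigma> ^^ i) ((\<sigma> ^^ (j - i)) w) = (\<sigma> ^^ i) w" by (simp only: funpow_add o_def)
      hence "(\<sigma> ^^ (j - i)) w = w" using inj[of i] by (simp add: inj_def)
      thus ?thesis using that(1) by (intro exI[of _ "j - i"]) simp
    qed
    show ?thesis
    proof (cases "i < j")
      case True
      show ?thesis by (rule *[OF True ij(2)])
    next
      case False
      hence "j < i" using ij(1) by simp
      thus ?thesis by (rule *[OF _ ij(2)[symmetric]])
    qed
  qed
  then obtain m where m: "\<And>w. w \<in> \<Omega> \<Longrightarrow> m w > 0 \<and> (\<sigma> ^^ m w) w = w" by metis
  define K where "K = (\<Prod>w\<in>\<Omega>. m w)"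
  have "K \<noteq> 0" unfolding K_def using fin\<Omega> m by (simp add: prod_zero_iff)
  then obtain k where k: "K = Suc k" using not0_implies_Suc by blast
  have "(\<sigma> ^^ Suc k) w = w" if "w ^ n = 1" for w
  proof -
    have w: "w \<in> \<Omega>" using that by (simp add: \<Omega>_def)
    have "m w dvd K" unfolding K_def using fin\<Omega> w by (rule dvd_prodI)
    then obtain q where "K = m w * q" by blast
    thus ?thesis using funpow_fixed_mult[of "m w" \<sigma> w q] m[OF w] k by metis
  qed
  thus thesis by (rule that)
qed

lemma map_representation:
  fixes h :: "'r fract alg_closure \<Rightarrow> 'r fract alg_closure"
  assumes h: "comm_ring_hom h" and T: "representation G n T"
  shows "representation G n (\<lambda>g. map_mat h (T g))"
    "g \<in> carrier G \<Longrightarrow> char_of G n (\<lambda>g. map_mat h (T g)) g = h (char_of G n T g)"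
proof -
  interpret h: comm_ring_hom h by (rule h)
  have c: "T g \<in> carrier_mat n n" if "g \<in> carrier G" for g using T that by (simp add: representation_def)
  show "representation G n (\<lambda>g. map_mat h (T g))"
    unfolding representation_def
  proof (intro conjI ballI)
    show "map_mat h (T \<one>) = 1\<^sub>m n" using T h.mat_hom_one by (simp add: representation_def)
    fix a b assume ab: "a \<in> carrier G" "b \<in> carrier G"
    have "T (a \<otimes> b) = T a * T b" using T ab by (simp add: representation_def)
    thus "map_mat h (T (a \<otimes> b)) = map_mat h (T a) * map_mat h (T b)"
      using h.mat_hom_mult[OF c[OF ab(1)] c[OF ab(2)]] by simp
  qed (use c in simp)
  assume g: "g \<in> carrier G"
  thus "char_of G n (\<lambda>g. map_mat h (T g)) g = h (char_of G n T g)"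
    using c[OF g] by (simp add: char_of_def h.hom_sum)
qed

lemma rmat_F:
  fixes \<sigma> :: "'r fract alg_closure \<Rightarrow> 'r fract alg_closure"
  assumes \<sigma>: "comm_ring_hom \<sigma>" "\<And>r. \<sigma> (to_Nc r) = to_Nc (F r)" and T: "representation G n T"
  shows "rmat n (\<lambda>g. map_mat \<sigma> (T g)) (\<lambda>g. F (x g)) = map_mat \<sigma> (rmat n T x)"
proof (rule eq_matI)
  interpret \<sigma>: comm_ring_hom \<sigma> by (rule \<sigma>(1))
  fix i j assume "i < dim_row (map_mat \<sigma> (rmat n T x))" "j < dim_col (map_mat \<sigma> (rmat n T x))"
  hence ij: "i < n" "j < n" by (simp_all add: rep_ext_def)
  have c: "T g \<in> carrier_mat n n" if "g \<in> carrier G" for g using T that by (simp add: representation_def)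
  have "rmat n (\<lambda>g. map_mat \<sigma> (T g)) (\<lambda>g. F (x g)) $$ (i, j) = (\<Sum>g\<in>carrier G. \<sigma> (to_Nc (x g) * T g $$ (i, j)))"
    unfolding rmat_index[OF ij]
  proof (rule sum.cong[OF refl])
    fix g assume "g \<in> carrier G"
    from c[OF this] have "map_mat \<sigma> (T g) $$ (i, j) = \<sigma> (T g $$ (i, j))" using ij by simp
    thus "to_Nc (F (x g)) * map_mat \<sigma> (T g) $$ (i, j) = \<sigma> (to_Nc (x g) * T g $$ (i, j))"
      by (simp add: \<sigma>(2) \<sigma>.hom_mult)
  qed
  also have "\<dots> = \<sigma> (rmat n T x $$ (i, j))" unfolding rmat_index[OF ij] by (rule \<sigma>.hom_sum[symmetric])
  finally show "rmat n (\<lambda>g. map_mat \<sigma> (T g)) (\<lambda>g. F (x g)) $$ (i, j) = map_mat \<sigma> (rmat n T x) $$ (i, j)"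
    using ij by (simp add: rep_ext_def)
qed (simp_all add: rep_ext_def)

text \<open>Let \<open>\<sigma>\<close> extend \<open>F\<close> and let \<open>\<sigma>\<^bsup>k+1\<^esup>\<close> fix the roots of unity that occur in
  character values.  If \<open>S\<close> is obtained from \<open>T\<close> by applying \<open>\<sigma>\<^sup>k\<close> to the entries, then
  applying \<open>\<sigma>\<close> to the entries of \<open>S\<close> yields a representation with the character of \<open>T\<close>, hence
  with the same determinants, and \<open>\<sigma>\<close> commutes with \<open>det\<close>.\<close>

lemma det_F_conjugate:
  obtains \<sigma> :: "'r fract alg_closure \<Rightarrow> 'r fract alg_closure" where
    "\<And>n T. representation G n T \<Longrightarrow> \<exists>S. representation G n S \<and>
       (\<forall>x. gunit x \<longrightarrow> det (rmat n T (\<lambda>g. F (x g))) = \<sigma> (det (rmat n S x)))"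
proof -
  obtain \<sigma> :: "'r fract alg_closure \<Rightarrow> 'r fract alg_closure"
    where \<sigma>: "comm_ring_hom \<sigma>" "\<And>r. \<sigma> (to_Nc r) = to_Nc (F r)"
    using frobenius_extension by blast
  obtain k where k: "\<And>w. w ^ card (carrier G) = 1 \<Longrightarrow> (\<sigma> ^^ Suc k) w = w"
    using fixes_roots_of_unity[OF \<sigma>(1) card_pos] by blast
  show thesis
  proof (rule that[of \<sigma>])
    fix n and T :: "'g \<Rightarrow> 'r fract alg_closure mat" assume T: "representation G n T"
    define S where "S g = map_mat (\<sigma> ^^ k) (T g)" for g
    define T' where "T' g = map_mat \<sigma> (S g)" for g
    have hk: "comm_ring_hom (\<sigma> ^^ k)" by (rule comm_ring_hom_funpow[OF \<sigma>(1)])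
    have S: "representation G n S" unfolding S_def by (rule map_representation(1)[OF hk T])
    have T': "representation G n T'" unfolding T'_def by (rule map_representation(1)[OF \<sigma>(1) S])
    have eq: "char_of G n T' g = char_of G n T g" for g
    proof (cases "g \<in> carrier G")
      case True
      interpret s: comm_ring_hom "\<sigma> ^^ Suc k" by (rule comm_ring_hom_funpow[OF \<sigma>(1)])
      obtain es where es: "\<forall>c\<in>set es. c ^ card (carrier G) = 1" "char_of G n T g = sum_list es"
        using char_roots_of_unity[OF T True] by blast
      have fx: "(\<sigma> ^^ Suc k) (sum_list es) = sum_list es" using es(1)
      proof (induction es)
        case (Cons c es)
        have "(\<sigma> ^^ Suc k) (sum_list (c # es)) = (\<sigma> ^^ Suc k) c + (\<sigma> ^^ Suc k) (sum_list es)"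
          by (simp only: sum_list.Cons s.hom_add)
        also have "(\<sigma> ^^ Suc k) c = c" by (rule k) (use Cons.prems in simp)
        also have "(\<sigma> ^^ Suc k) (sum_list es) = sum_list es" by (rule Cons.IH) (use Cons.prems in simp)
        finally show ?case by simp
      qed (simp only: sum_list.Nil s.hom_zero)
      have "char_of G n T' g = (\<sigma> ^^ Suc k) (char_of G n T g)"
        using map_representation(2)[OF \<sigma>(1) S True] map_representation(2)[OF hk T True]
        unfolding T'_def S_def by simp
      thus ?thesis using fx es(2) by simp
    qed (simp add: char_of_def)
    show "\<exists>S. representation G n S \<and> (\<forall>x. gunit x \<longrightarrow> det (rmat n T (\<lambda>g. F (x g))) = \<sigma> (det (rmat n S x)))"
    proof (intro exI[of _ S] conjI allI impI S)
      fix x assume x: "gunit x"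
      interpret s: comm_ring_hom \<sigma> by (rule \<sigma>(1))
      have "char_of G n T' = char_of G n T" using eq by (rule ext)
      hence "det (rmat n T (\<lambda>g. F (x g))) = det (rmat n T' (\<lambda>g. F (x g)))"
        using Det_character(2)[OF T gunit_F[OF x]] Det_character(2)[OF T' gunit_F[OF x]] by simp
      also have "\<dots> = \<sigma> (det (rmat n S x))"
        unfolding T'_def rmat_F[OF \<sigma> S] by (rule s.hom_det)
      finally show "det (rmat n T (\<lambda>g. F (x g))) = \<sigma> (det (rmat n S x))" .
    qed
  qed
qed

text \<open>This makes \<open>Psi\<close> well defined on determinants: by the preceding lemma the determinants of \<open>F(x)\<close> are
  functions of the determinants of \<open>x\<close>.\<close>

lemma Det_F_cong:
  assumes x: "gunit x" and x': "gunit x'" and eq: "Det G x = Det G x'"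
  shows "Det G (\<lambda>g. F (x g)) = Det G (\<lambda>g. F (x' g))"
proof
  fix \<xi> :: "'g \<Rightarrow> 'r fract alg_closure"
  show "Det G (\<lambda>g. F (x g)) \<xi> = Det G (\<lambda>g. F (x' g)) \<xi>"
  proof (cases "\<xi> \<in> virtual_characters G")
    case False
    thus ?thesis by (simp add: Det_def)
  next
    case True
    then obtain n T n' T' where T: "representation G n T" "representation G n' T'"
      "\<xi> = (\<lambda>g. char_of G n T g - char_of G n' T' g)"
      by (auto simp: virtual_characters_def characters_def)
    obtain \<sigma> :: "'r fract alg_closure \<Rightarrow> 'r fract alg_closure" where
      \<sigma>: "\<And>n T. representation G n T \<Longrightarrow> \<exists>S. representation G n S \<and>
       (\<forall>x. gunit x \<longrightarrow> det (rmat n T (\<lambda>g. F (x g))) = \<sigma> (det (rmat n S x)))"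
      using det_F_conjugate by blast
    have d: "det (rmat n T (\<lambda>g. F (x g))) = det (rmat n T (\<lambda>g. F (x' g)))" if T: "representation G n T" for n T
    proof -
      obtain S where S: "representation G n S" "\<And>x. gunit x \<Longrightarrow> det (rmat n T (\<lambda>g. F (x g))) = \<sigma> (det (rmat n S x))"
        using \<sigma>[OF T] by blast
      have "det (rmat n S x) = det (rmat n S x')"
        using Det_character(2)[OF S(1) x] Det_character(2)[OF S(1) x'] eq by simp
      thus ?thesis using S(2)[OF x] S(2)[OF x'] by simp
    qed
    show ?thesis
      using Det_virtual(2)[OF T(1,2) gunit_F[OF x] T(3)] Det_virtual(2)[OF T(1,2) gunit_F[OF x'] T(3)]
        d[OF T(1)] d[OF T(2)] by simp
  qed
qed

lemma Psi_eq:
  assumes x: "x \<in> Units (monoid_ring (coeff_ring :: 'r ring) G)"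
  shows "Psi p F G (Det G x) = adams_Det p G (Det G (\<lambda>g. F (x g)))"
  unfolding Psi_def
proof (rule the_equality)
  show "\<exists>x'\<in>Units (monoid_ring coeff_ring G). Det G x = Det G x' \<and>
     adams_Det p G (Det G (\<lambda>g. F (x g))) = adams_Det p G (Det G (\<lambda>g. F (x' g)))" using x by blast
  fix h assume "\<exists>x'\<in>Units (monoid_ring coeff_ring G). Det G x = Det G x' \<and>
     h = adams_Det p G (Det G (\<lambda>g. F (x' g)))"
  then obtain x' where x': "x' \<in> Units (monoid_ring (coeff_ring :: 'r ring) G)" "Det G x = Det G x'"
    "h = adams_Det p G (Det G (\<lambda>g. F (x' g)))" by blast
  show "h = adams_Det p G (Det G (\<lambda>g. F (x g)))"
    using Det_F_cong[OF monoid_ring_unit(1)[OF x] monoid_ring_unit(1)[OF x'(1)] x'(2)] x'(3) by simp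
qed

lemma Psi_character:
  assumes x: "x \<in> Units (monoid_ring (coeff_ring :: 'r ring) G)" and T: "representation G n T"
    and T1: "representation G n1 T1" and T2: "representation G n2 T2"
    and adams: "\<And>g. g \<in> carrier G \<Longrightarrow> char_of G n1 T1 g - char_of G n2 T2 g = char_of G n T (g [^] p)"
  shows "Psi p F G (Det G x) (char_of G n T) =
    det (rmat n1 T1 (\<lambda>g. F (x g))) / det (rmat n2 T2 (\<lambda>g. F (x g)))"
proof -
  note gx = monoid_ring_unit(1)[OF x]
  have "adams p G (char_of G n T) = (\<lambda>g. char_of G n1 T1 g - char_of G n2 T2 g)"
    using adams by (auto simp: adams_def fun_eq_iff char_of_def)
  from Det_virtual(2)[OF T1 T2 gunit_F[OF gx] this] show ?thesis
    using Det_character(1)[OF T gx] by (simp add: Psi_eq[OF x] adams_Det_def)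
qed

section \<open>The group logarithm\<close>

text \<open>If \<open>N = p\<^sup>k m\<close> with \<open>m\<close> prime to \<open>p\<close>, then \<open>m\<close> is a unit and divisibility by \<open>p\<^sup>k\<close> is the
  congruence for class sums of powers.\<close>

lemma class_coefficient:
  assumes c: "c \<in> conj_classes G"
  shows "\<exists>r :: 'r. of_nat N * r = (if p dvd N then
       \<Sum>zs\<in>words (carrier G) (N div p). F (prod_list (map (compl x) zs)) * (if word_prod G zs [^] p \<in> c then 1 else 0) else 0) -
     (\<Sum>xs\<in>words (carrier G) N. prod_list (map (compl x) xs) * (if word_prod G xs \<in> c then 1 else 0)) \<or> N = 0"
proof (cases "N = 0")
  case False
  define S where "S N = (\<Sum>xs\<in>words (carrier G) N. prod_list (map (compl x) xs) * (if word_prod G xs \<in> c then 1 else 0))" for N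
  define S' where "S' N = (\<Sum>zs\<in>words (carrier G) N. F (prod_list (map (compl x) zs)) * (if word_prod G zs [^] p \<in> c then 1 else 0))" for N
  obtain k m where km: "N = p ^ k * m" "\<not> p dvd m"
    using False p by (metis multiplicity_decompose' not_prime_unit)
  have cop: "coprime m p" using prime_imp_coprime[OF p km(2)] by (simp add: coprime_commute)
  obtain u :: 'r where u: "1 = of_nat m * u" using coprime_unit[OF cop] by blast
  have "of_nat (p ^ k) dvd (if p dvd N then S' (N div p) else 0) - S N"
  proof (cases k)
    case (Suc l)
    interpret w: frobenius_lift_words G p F "compl x" "\<lambda>g. if g \<in> c then 1 else 0"
      by unfold_locales (auto simp: fin p F_lift F.hom_power class_swap[OF c])
    have "of_nat (p ^ k) dvd S (p ^ Suc l * m) - S' (p ^ l * m)"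
      using w.power_sum_congruence[of l m] by (simp only: Suc S_def S'_def w.wt_def)
    moreover have "N div p = p ^ l * m" "p dvd N" "N = p ^ Suc l * m" using km Suc p_pos by (simp_all add: mult.assoc)
    ultimately have "of_nat (p ^ k) dvd S N - (if p dvd N then S' (N div p) else 0)" by simp
    thus ?thesis by (metis dvd_minus_iff minus_diff_eq)
  qed simp
  then obtain D where D: "(if p dvd N then S' (N div p) else 0) - S N = of_nat (p ^ k) * D" by blast
  have "of_nat N * (u * D) = of_nat (p ^ k) * (of_nat m * u) * D" by (simp add: km(1) mult_ac)
  hence "of_nat N * (u * D) = (if p dvd N then S' (N div p) else 0) - S N" using u D by simp
  thus ?thesis unfolding S_def S'_def by blast
qed simp

lemma char_sum_words:
  fixes f :: "'g list \<Rightarrow> 'r"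
  assumes T: "representation G n T" and v: "\<And>xs. xs \<in> words (carrier G) m \<Longrightarrow> v xs \<in> carrier G"
  shows "(\<Sum>xs\<in>words (carrier G) m. to_Nc (f xs) * char_of G n T (v xs)) =
    (\<Sum>c\<in>conj_classes G. to_Nc (\<Sum>xs\<in>words (carrier G) m. f xs * (if v xs \<in> c then 1 else 0)) * the_elem (char_of G n T ` c))"
proof -
  have "(\<Sum>xs\<in>words (carrier G) m. to_Nc (f xs) * char_of G n T (v xs)) =
    (\<Sum>xs\<in>words (carrier G) m. \<Sum>c\<in>conj_classes G. to_Nc (f xs * (if v xs \<in> c then 1 else 0)) * the_elem (char_of G n T ` c))"
  proof (rule sum.cong[OF refl])
    fix xs assume "xs \<in> words (carrier G) m"
    from char_expand[OF T v[OF this]]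
    have "to_Nc (f xs) * char_of G n T (v xs) = (\<Sum>c\<in>conj_classes G. to_Nc (f xs) * ((if v xs \<in> c then 1 else 0) * the_elem (char_of G n T ` c)))"
      by (simp only: sum_distrib_left)
    also have "\<dots> = (\<Sum>c\<in>conj_classes G. to_Nc (f xs * (if v xs \<in> c then 1 else 0)) * the_elem (char_of G n T ` c))"
      by (intro sum.cong refl) simp
    finally show "to_Nc (f xs) * char_of G n T (v xs) = (\<Sum>c\<in>conj_classes G. to_Nc (f xs * (if v xs \<in> c then 1 else 0)) * the_elem (char_of G n T ` c))" .
  qed
  also have "\<dots> = (\<Sum>c\<in>conj_classes G. \<Sum>xs\<in>words (carrier G) m. to_Nc (f xs * (if v xs \<in> c then 1 else 0)) * the_elem (char_of G n T ` c))"
    by (rule sum.swap)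
  also have "\<dots> = (\<Sum>c\<in>conj_classes G. to_Nc (\<Sum>xs\<in>words (carrier G) m. f xs * (if v xs \<in> c then 1 else 0)) * the_elem (char_of G n T ` c))"
    by (simp only: to_Nc_hom.hom_sum sum_distrib_right)
  finally show ?thesis .
qed

text \<open>Put \<open>y = 1 - x\<close>, and let \<open>\<Phi>\<close> apply \<open>F\<close> to coefficients, raise group elements to the \<open>p\<close>-th power
  and map \<open>t\<close> to \<open>t\<^sup>p\<close>.  The left hand side is \<open>\<chi>\<close> applied to
  \<open>p log (1 - t y) - \<Phi> (log (1 - t y))\<close>.  On each conjugacy class \<open>c\<close> this has coefficients
  divisible by \<open>p\<close>, whose quotients by \<open>p\<close> are the \<open>r c N\<close>, independent of the representation.\<close>

lemma class_series:
  obtains r :: "'g set \<Rightarrow> nat \<Rightarrow> 'r" where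
    "\<And>n T n1 T1 n2 T2. representation G n T \<Longrightarrow>
       (\<And>g. g \<in> carrier G \<Longrightarrow> char_of G n1 T1 g - char_of G n2 T2 g = char_of G n T (g [^] p)) \<Longrightarrow>
       of_nat p * clog 1 x (char_of G n T) -
         (clog p (\<lambda>g. F (x g)) (char_of G n1 T1) - clog p (\<lambda>g. F (x g)) (char_of G n2 T2)) =
       (\<Sum>c\<in>conj_classes G. fps_const (the_elem (char_of G n T ` c)) * (fps_const (of_nat p) * Abs_fps (\<lambda>N. to_Nc (r c N))))"
proof -
  define S where "S c N = (\<Sum>xs\<in>words (carrier G) N. prod_list (map (compl x) xs) * (if word_prod G xs \<in> c then 1 else 0))" for c N
  define S' where "S' c N = (\<Sum>zs\<in>words (carrier G) N. F (prod_list (map (compl x) zs)) * (if word_prod G zs [^] p \<in> c then 1 else 0))" for c N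
  have "\<forall>c N. \<exists>r :: 'r. c \<in> conj_classes G \<longrightarrow> (N = 0 \<longrightarrow> r = 0) \<and>
     (N \<noteq> 0 \<longrightarrow> of_nat N * r = (if p dvd N then S' c (N div p) else 0) - S c N)"
  proof (intro allI)
    fix c N
    show "\<exists>r :: 'r. c \<in> conj_classes G \<longrightarrow> (N = 0 \<longrightarrow> r = 0) \<and>
       (N \<noteq> 0 \<longrightarrow> of_nat N * r = (if p dvd N then S' c (N div p) else 0) - S c N)"
      using class_coefficient[of c N x] unfolding S_def S'_def by (cases "N = 0") auto
  qed
  then obtain r :: "'g set \<Rightarrow> nat \<Rightarrow> 'r" where r: "\<And>c. c \<in> conj_classes G \<Longrightarrow> r c 0 = 0"
    "\<And>c N. c \<in> conj_classes G \<Longrightarrow> N \<noteq> 0 \<Longrightarrow> of_nat N * r c N = (if p dvd N then S' c (N div p) else 0) - S c N"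
    by metis
  show thesis
  proof (rule that[of r])
    fix n T n1 T1 n2 T2
    assume T: "representation G n (T :: 'g \<Rightarrow> 'r fract alg_closure mat)"
      and adams: "\<And>g. g \<in> carrier G \<Longrightarrow> char_of G n1 T1 g - char_of G n2 T2 g = char_of G n T (g [^] p)"
    let ?\<chi> = "\<lambda>c. the_elem (char_of G n T ` c)"
    have ad: "clog p (\<lambda>g. F (x g)) (char_of G n1 T1) - clog p (\<lambda>g. F (x g)) (char_of G n2 T2) =
        clog p (\<lambda>g. F (x g)) (\<lambda>g. char_of G n T (g [^] p))"
      unfolding clog_diff[symmetric] by (rule clog_cong) (rule adams)
    show "of_nat p * clog 1 x (char_of G n T) -
         (clog p (\<lambda>g. F (x g)) (char_of G n1 T1) - clog p (\<lambda>g. F (x g)) (char_of G n2 T2)) =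
       (\<Sum>c\<in>conj_classes G. fps_const (?\<chi> c) * (fps_const (of_nat p) * Abs_fps (\<lambda>N. to_Nc (r c N))))"
      unfolding ad
    proof (rule fps_ext)
      fix N
      have R: "fps_nth (\<Sum>c\<in>conj_classes G. fps_const (?\<chi> c) * (fps_const (of_nat p) * Abs_fps (\<lambda>N. to_Nc (r c N)))) N =
          (\<Sum>c\<in>conj_classes G. ?\<chi> c * (of_nat p * to_Nc (r c N)))"
        by (simp add: fps_sum_nth)
      have L: "fps_nth (of_nat p * clog 1 x (char_of G n T) - clog p (\<lambda>g. F (x g)) (\<lambda>g. char_of G n T (g [^] p))) N =
         of_nat p * fps_nth (clog 1 x (char_of G n T)) N - fps_nth (clog p (\<lambda>g. F (x g)) (\<lambda>g. char_of G n T (g [^] p))) N"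
        by (simp flip: fps_of_nat)
      have wp: "word_prod G xs \<in> carrier G" if "xs \<in> words (carrier G) m" for xs m
        using that by (intro word_prod_closed) (simp add: words_def)
      show "fps_nth (of_nat p * clog 1 x (char_of G n T) - clog p (\<lambda>g. F (x g)) (\<lambda>g. char_of G n T (g [^] p))) N =
        fps_nth (\<Sum>c\<in>conj_classes G. fps_const (?\<chi> c) * (fps_const (of_nat p) * Abs_fps (\<lambda>N. to_Nc (r c N)))) N"
      proof (cases "N = 0")
        case True
        thus ?thesis unfolding L R using r(1) by (simp add: clog_def)
      next
        case False
        have 1: "fps_nth (clog 1 x (char_of G n T)) N = - (\<Sum>c\<in>conj_classes G. to_Nc (S c N) * ?\<chi> c) / of_nat N"
          using False char_sum_words[where f = "\<lambda>xs. prod_list (map (compl x) xs)" and m = N and v = "word_prod G", OF T wp]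
          by (simp add: clog_def S_def)
        have 2: "fps_nth (clog p (\<lambda>g. F (x g)) (\<lambda>g. char_of G n T (g [^] p))) N =
          - of_nat p * (\<Sum>c\<in>conj_classes G. to_Nc (if p dvd N then S' c (N div p) else 0) * ?\<chi> c) / of_nat N"
        proof (cases "p dvd N")
          case True
          have "(\<Sum>xs\<in>words (carrier G) (N div p). to_Nc (F (prod_list (map (compl x) xs))) * char_of G n T (word_prod G xs [^] p)) =
              (\<Sum>c\<in>conj_classes G. to_Nc (S' c (N div p)) * ?\<chi> c)"
            unfolding S'_def by (rule char_sum_words[OF T]) (simp add: wp)
          hence "fps_nth (clog p (\<lambda>g. F (x g)) (\<lambda>g. char_of G n T (g [^] p))) N =
             - (\<Sum>c\<in>conj_classes G. to_Nc (S' c (N div p)) * ?\<chi> c) / of_nat (N div p)"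
            using False True by (simp add: clog_def compl_F prod_list_F)
          also have "(of_nat (N div p) :: 'r fract alg_closure) = of_nat N / of_nat p"
          proof -
            have "of_nat p * of_nat (N div p) = (of_nat N :: 'r fract alg_closure)"
              using True by (metis dvd_mult_div_cancel of_nat_mult)
            thus ?thesis using p_nonzero(2) by (metis nonzero_mult_div_cancel_left)
          qed
          finally show ?thesis using True by simp
        qed (simp add: clog_def)
        have "of_nat N * (\<Sum>c\<in>conj_classes G. ?\<chi> c * (of_nat p * to_Nc (r c N))) =
           of_nat p * (\<Sum>c\<in>conj_classes G. to_Nc (of_nat N * r c N) * ?\<chi> c)"
          by (simp add: sum_distrib_left mult_ac)
        also have "(\<Sum>c\<in>conj_classes G. to_Nc (of_nat N * r c N) * ?\<chi> c) =
           (\<Sum>c\<in>conj_classes G. to_Nc (if p dvd N then S' c (N div p) else 0) * ?\<chi> c) - (\<Sum>c\<in>conj_classes G. to_Nc (S c N) * ?\<chi> c)"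
          unfolding sum_subtractf[symmetric] using r(2)[OF _ False]
          by (intro sum.cong refl) (simp add: left_diff_distrib)
        finally have "(\<Sum>c\<in>conj_classes G. ?\<chi> c * (of_nat p * to_Nc (r c N))) =
           of_nat p * ((\<Sum>c\<in>conj_classes G. to_Nc (if p dvd N then S' c (N div p) else 0) * ?\<chi> c) - (\<Sum>c\<in>conj_classes G. to_Nc (S c N) * ?\<chi> c)) / of_nat N"
          using False by (simp add: field_simps)
        thus ?thesis unfolding L R 1 2 using False by (simp add: field_simps)
      qed
    qed
  qed
qed

text \<open>The class components of \<open>p log (1 - t y) - \<Phi> (log (1 - t y))\<close>, where \<open>y = 1 - x\<close>, have values in
  \<open>pR\<close> at \<open>t = 1\<close>.  For each character these values combine to the \<open>p\<close>-adic logarithm that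
  \<open>upsilon\<close> prescribes, and since characters separate classes nothing else can be \<open>upsilon\<close>.\<close>

theorem upsilon_integral:
  assumes x: "x \<in> Units (monoid_ring (coeff_ring :: 'r ring) G)"
  shows "upsilon p F G (Det G x) \<in> (\<lambda>v c. of_nat p * v c) ` class_module (range to_Nc) (conj_classes G)"
proof -
  note gx = monoid_ring_unit(1)[OF x]
  obtain r :: "'g set \<Rightarrow> nat \<Rightarrow> 'r" where r: "\<And>n T n1 T1 n2 T2. representation G n T \<Longrightarrow>
       (\<And>g. g \<in> carrier G \<Longrightarrow> char_of G n1 T1 g - char_of G n2 T2 g = char_of G n T (g [^] p)) \<Longrightarrow>
       of_nat p * clog 1 x (char_of G n T) -
         (clog p (\<lambda>g. F (x g)) (char_of G n1 T1) - clog p (\<lambda>g. F (x g)) (char_of G n2 T2)) =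
       (\<Sum>c\<in>conj_classes G. fps_const (the_elem (char_of G n T ` c)) * (fps_const (of_nat p) * Abs_fps (\<lambda>N. to_Nc (r c N))))"
    using class_series[of x] by blast
  define W where "W c = Abs_fps (\<lambda>N. to_Nc (r c N))" for c
  define V where "V c = fps_const (of_nat p) * W c" for c
  define q where "q \<chi> = Det G x \<chi> ^ p / Psi p F G (Det G x) \<chi>" for \<chi>
  have W: "integral_fps (W c)" for c by (simp add: W_def integral_fps_def)
  have series: "\<exists>u. fps_nth u 0 = 1 \<and> rational_at_1 u (q (char_of G n T)) \<and> fps_log u \<in> fps_mults 1 \<and>
      fps_log u = (\<Sum>c\<in>conj_classes G. fps_const (the_elem (char_of G n T ` c)) * V c)"
    if T: "representation G n T" for n and T :: "'g \<Rightarrow> 'r fract alg_closure mat"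
  proof -
    obtain n1 T1 n2 T2 where A: "representation G n1 T1" "representation G n2 T2"
      "\<And>g. g \<in> carrier G \<Longrightarrow> char_of G n1 T1 g - char_of G n2 T2 g = char_of G n T (g [^] p)"
      using adams_virtual[OF monoid_axioms T p] by blast
    note gF = gunit_F[OF gx]
    obtain f where f: "fps_nth f 0 = 1" "rational_at_1 f (det (rmat n T x))" "fps_log f = clog 1 x (char_of G n T)"
      using char_series[OF T gx, of 1] by auto
    obtain f1 where f1: "fps_nth f1 0 = 1" "rational_at_1 (inverse f1) (inverse (det (rmat n1 T1 (\<lambda>g. F (x g)))))"
      "fps_log f1 = clog p (\<lambda>g. F (x g)) (char_of G n1 T1)"
      using char_series[OF A(1) gF p_pos] by blast
    obtain f2 where f2: "fps_nth f2 0 = 1" "rational_at_1 f2 (det (rmat n2 T2 (\<lambda>g. F (x g))))"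
      "fps_log f2 = clog p (\<lambda>g. F (x g)) (char_of G n2 T2)"
      using char_series[OF A(2) gF p_pos] by blast
    \<comment> \<open>At \<open>t = 1\<close> this is \<open>Det(x)(\<chi>)\<^sup>p / Det(F(x))(\<psi>\<^sup>p \<chi>)\<close>.\<close>
    define u where "u = f ^ p * (inverse f1 * f2)"
    have fp0: "fps_nth (f ^ p) 0 = 1" using f(1) by (simp add: fps_power_zeroth)
    have i0: "fps_nth (inverse f1) 0 = 1" using f1(1) by simp
    have i20: "fps_nth (inverse f1 * f2) 0 = 1" using i0 f2(1) by simp
    have u0: "fps_nth u 0 = 1" using fp0 i20 by (simp add: u_def)
    have "rational_at_1 u (det (rmat n T x) ^ p * (inverse (det (rmat n1 T1 (\<lambda>g. F (x g)))) * det (rmat n2 T2 (\<lambda>g. F (x g)))))"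
      unfolding u_def by (intro rational_at_1_mult rational_at_1_power f f1 f2)
    moreover have "det (rmat n T x) ^ p * (inverse (det (rmat n1 T1 (\<lambda>g. F (x g)))) * det (rmat n2 T2 (\<lambda>g. F (x g)))) = q (char_of G n T)"
    proof -
      have "Psi p F G (Det G x) (char_of G n T) = det (rmat n1 T1 (\<lambda>g. F (x g))) / det (rmat n2 T2 (\<lambda>g. F (x g)))"
        by (rule Psi_character[OF x T A])
      thus ?thesis using Det_character(2)[OF T gx] by (simp add: q_def divide_inverse)
    qed
    ultimately have ru: "rational_at_1 u (q (char_of G n T))" by simp
    have "fps_log u = of_nat p * fps_log f + (- fps_log f1 + fps_log f2)"
      unfolding u_def fps_log_mult[OF fp0 i20] fps_log_mult[OF i0 f2(1)] fps_log_inverse[OF f1(1)] fps_log_power[OF f(1)] ..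
    also have "\<dots> = of_nat p * clog 1 x (char_of G n T) -
         (clog p (\<lambda>g. F (x g)) (char_of G n1 T1) - clog p (\<lambda>g. F (x g)) (char_of G n2 T2))"
      unfolding f(3) f1(3) f2(3) by (simp add: algebra_simps)
    also have "\<dots> = (\<Sum>c\<in>conj_classes G. fps_const (the_elem (char_of G n T ` c)) * V c)"
      unfolding V_def W_def by (rule r[OF T A(3)])
    finally have lu: "fps_log u = (\<Sum>c\<in>conj_classes G. fps_const (the_elem (char_of G n T ` c)) * V c)" .
    have \<chi>int: "the_elem (char_of G n T ` c) \<in> integers" if c: "c \<in> conj_classes G" for c
    proof -
      obtain g where "g \<in> carrier G" "c = conj_class G g" using c by (auto simp: conj_classes_def)
      thus ?thesis using char_class[OF T] char_integers[OF T] by simp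
    qed
    have "fps_log u \<in> fps_mults 1"
      unfolding fps_mults_iff
    proof
      fix N
      have "fps_nth (fps_log u) N = (\<Sum>c\<in>conj_classes G. the_elem (char_of G n T ` c) * (of_nat p * to_Nc (r c N)))"
        unfolding lu V_def W_def by (simp add: fps_sum_nth)
      also have "\<dots> \<in> mults 1"
        by (intro mults_sum mults_mult' \<chi>int multsI[OF integers_to_Nc]) auto
      finally show "fps_nth (fps_log u) N \<in> mults 1" .
    qed
    with u0 ru lu show ?thesis by blast
  qed
  \<comment> \<open>A multiple of each class component is a combination of logarithms of rational series, hence a limit
    of such series.\<close>
  have "\<exists>l. value_at_1 (W c) (to_Nc l)" if c: "c \<in> conj_classes G" for c
  proof (rule class_separation[OF c])
    fix \<Omega> :: "'r fract alg_closure set" and a :: "'r fract alg_closure \<Rightarrow> 'r fract alg_closure" and d T and z :: nat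
    assume sep: "finite \<Omega>" "z > 0" "\<And>w. w \<in> \<Omega> \<Longrightarrow> a w \<in> integers" "\<And>w. w \<in> \<Omega> \<Longrightarrow> representation G (d w) (T w)"
      "\<And>c'. c' \<in> conj_classes G \<Longrightarrow>
       (\<Sum>w\<in>\<Omega>. a w * the_elem (char_of G (d w) (T w) ` c')) = (if c' = c then of_nat z else 0)"
    have ex: "\<forall>w\<in>\<Omega>. \<exists>u. fps_nth u 0 = 1 \<and> rational_at_1 u (q (char_of G (d w) (T w))) \<and> fps_log u \<in> fps_mults 1 \<and>
      fps_log u = (\<Sum>c\<in>conj_classes G. fps_const (the_elem (char_of G (d w) (T w) ` c)) * V c)"
      using series[OF sep(4)] by blast
    obtain u where u0: "\<forall>w\<in>\<Omega>. fps_nth (u w) 0 = 1 \<and> rational_at_1 (u w) (q (char_of G (d w) (T w))) \<and> fps_log (u w) \<in> fps_mults 1 \<and>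
      fps_log (u w) = (\<Sum>c\<in>conj_classes G. fps_const (the_elem (char_of G (d w) (T w) ` c)) * V c)"
      using bchoice[OF ex] by blast
    have u: "\<And>w. w \<in> \<Omega> \<Longrightarrow> fps_nth (u w) 0 = 1"
      "\<And>w. w \<in> \<Omega> \<Longrightarrow> rational_at_1 (u w) (q (char_of G (d w) (T w)))"
      "\<And>w. w \<in> \<Omega> \<Longrightarrow> fps_log (u w) \<in> fps_mults 1"
      "\<And>w. w \<in> \<Omega> \<Longrightarrow> fps_log (u w) = (\<Sum>c\<in>conj_classes G. fps_const (the_elem (char_of G (d w) (T w) ` c)) * V c)"
      using u0 by blast+
    have sum: "(\<Sum>w\<in>\<Omega>. fps_const (a w) * fps_log (u w)) = fps_const (of_nat z) * V c"
    proof -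
      have "(\<Sum>w\<in>\<Omega>. fps_const (a w) * fps_log (u w)) =
         (\<Sum>w\<in>\<Omega>. \<Sum>c'\<in>conj_classes G. fps_const (a w * the_elem (char_of G (d w) (T w) ` c')) * V c')"
        by (intro sum.cong refl) (simp add: u(4) sum_distrib_left mult.assoc[symmetric])
      also have "\<dots> = (\<Sum>c'\<in>conj_classes G. (\<Sum>w\<in>\<Omega>. fps_const (a w * the_elem (char_of G (d w) (T w) ` c'))) * V c')"
        by (subst sum.swap) (simp add: sum_distrib_right)
      also have "\<dots> = (\<Sum>c'\<in>conj_classes G. fps_const (\<Sum>w\<in>\<Omega>. a w * the_elem (char_of G (d w) (T w) ` c')) * V c')"
      proof -
        have "(\<Sum>w\<in>\<Omega>. fps_const (g w)) = fps_const (\<Sum>w\<in>\<Omega>. g w)" for g :: "'r fract alg_closure \<Rightarrow> 'r fract alg_closure"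
          by (rule fps_ext) (simp add: fps_sum_nth)
        thus ?thesis by simp
      qed
      also have "\<dots> = (\<Sum>c'\<in>conj_classes G. if c' = c then fps_const (of_nat z) * V c else 0)"
        using sep(5) by (intro sum.cong refl) auto
      finally show ?thesis using c finite_conj_classes by simp
    qed
    have "\<exists>s w. rational_at_1 s w \<and> fps_const (of_nat (z * p)) * W c - s \<in> fps_mults k" for k
    proof -
      define s where "s = (\<Sum>w\<in>\<Omega>. fps_const (a w) * fps_log_partial (2 * k) (u w))"
      have "rational_at_1 s (\<Sum>w\<in>\<Omega>. a w * log_partial (2 * k) (q (char_of G (d w) (T w))))"
        unfolding s_def
        by (intro rational_at_1_sum rational_at_1_mult rational_at_1_const sep(3)
            log_partial_approx(1)[OF u(1) u(3) u(2)]) auto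
      moreover have "fps_const (of_nat (z * p)) * W c - s \<in> fps_mults k"
      proof -
        have "fps_const (of_nat (z * p)) * W c = fps_const (of_nat z) * V c"
          by (simp add: V_def mult.assoc[symmetric])
        also have "\<dots> - s = (\<Sum>w\<in>\<Omega>. fps_const (a w) * (fps_log (u w) - fps_log_partial (2 * k) (u w)))"
          unfolding s_def sum[symmetric] by (simp add: sum_subtractf right_diff_distrib)
        also have "\<dots> \<in> fps_mults k"
        proof -
          have t: "fps_const (a w) * (fps_log (u w) - fps_log_partial (2 * k) (u w)) \<in> fps_mults k" if "w \<in> \<Omega>" for w
            by (rule fps_mults_mult[OF integral_fps_const[OF sep(3)[OF that]] log_partial_approx(2)[OF u(1,3,2)[OF that]]]) simp
          show ?thesis using t by (auto simp: fps_mults_iff fps_sum_nth intro!: mults_sum)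
        qed
        finally show ?thesis .
      qed
      ultimately show ?thesis by blast
    qed
    hence "\<exists>s w. rational_at_1 s w \<and> W c - s \<in> fps_mults k" for k
      using approx_divide[OF W[of c], of "z * p" k] sep(2) p_pos by simp
    from value_at_1_descent[OF this[unfolded W_def]] show ?thesis unfolding W_def by blast
  qed
  then obtain l where l: "\<And>c. c \<in> conj_classes G \<Longrightarrow> value_at_1 (W c) (to_Nc (l c :: 'r))" by metis
  define v0 where "v0 c = (if c \<in> conj_classes G then to_Nc (l c) else 0)" for c
  define v where "v c = of_nat p * v0 c" for c
  have v0: "v0 \<in> class_module (range to_Nc) (conj_classes G)" by (auto simp: class_module_def v0_def)
  have log: "char_ext G \<chi> v = padic_log p (q \<chi>)" if "\<chi> \<in> characters G" for \<chi>
  proof -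
    obtain n T where T: "representation G n T" "\<chi> = char_of G n T"
      using \<open>\<chi> \<in> characters G\<close> unfolding characters_def by blast
    obtain u where u: "fps_nth u 0 = 1" "rational_at_1 u (q \<chi>)" "fps_log u \<in> fps_mults 1"
      "fps_log u = (\<Sum>c\<in>conj_classes G. fps_const (the_elem (\<chi> ` c)) * V c)"
      using series[OF T(1)] unfolding T(2) by blast
    have \<chi>int: "the_elem (\<chi> ` c) \<in> integers" if c: "c \<in> conj_classes G" for c
    proof -
      obtain g where "g \<in> carrier G" "c = conj_class G g" using c by (auto simp: conj_classes_def)
      thus ?thesis using char_class[OF T(1)] char_integers[OF T(1)] T(2) by simp
    qed
    have "value_at_1 (\<Sum>c\<in>conj_classes G. fps_const (the_elem (\<chi> ` c)) * V c) (\<Sum>c\<in>conj_classes G. the_elem (\<chi> ` c) * (of_nat p * to_Nc (l c)))"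
      unfolding V_def by (intro value_at_1_sum value_at_1_cmult l \<chi>int integers_of_nat)
    moreover have "(\<Sum>c\<in>conj_classes G. the_elem (\<chi> ` c) * (of_nat p * to_Nc (l c))) = char_ext G \<chi> v"
      unfolding char_ext_def by (intro sum.cong refl) (simp add: v_def v0_def mult_ac)
    ultimately have "value_at_1 (fps_log u) (char_ext G \<chi> v)" unfolding u(4) by simp
    from padic_log_eq[OF value_at_1_log[OF u(1,3,2) this]] show ?thesis by simp
  qed
  have "upsilon p F G (Det G x) = v"
    unfolding upsilon_def
  proof (rule the_equality)
    show "v \<in> class_module UNIV (conj_classes G) \<and>
      (\<forall>\<chi>\<in>characters G. char_ext G \<chi> v = padic_log p (Det G x \<chi> ^ p / Psi p F G (Det G x) \<chi>))"
      using log by (auto simp: class_module_def v_def v0_def q_def)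
    fix v' assume v': "v' \<in> class_module UNIV (conj_classes G) \<and>
      (\<forall>\<chi>\<in>characters G. char_ext G \<chi> v' = padic_log p (Det G x \<chi> ^ p / Psi p F G (Det G x) \<chi>))"
    show "v' = v"
    proof
      fix c
      show "v' c = v c"
      proof (cases "c \<in> conj_classes G")
        case False
        thus ?thesis using v' by (simp add: class_module_def v_def v0_def)
      next
        case True
        show ?thesis
        proof (rule class_separation[OF True])
          fix \<Omega> :: "'r fract alg_closure set" and a :: "'r fract alg_closure \<Rightarrow> 'r fract alg_closure" and d T and z :: nat
          assume sep0: "finite \<Omega>" "z > 0" "\<And>w. w \<in> \<Omega> \<Longrightarrow> a w \<in> integers" "\<And>w. w \<in> \<Omega> \<Longrightarrow> representation G (d w) (T w)"
            "\<And>c'. c' \<in> conj_classes G \<Longrightarrow>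
             (\<Sum>w\<in>\<Omega>. a w * the_elem (char_of G (d w) (T w) ` c')) = (if c' = c then of_nat z else 0)"
          note sep = sep0(1,2,4,5)
          have ext: "(\<Sum>w\<in>\<Omega>. a w * char_ext G (char_of G (d w) (T w)) y) = of_nat z * y c" for y
          proof -
            have "(\<Sum>w\<in>\<Omega>. a w * char_ext G (char_of G (d w) (T w)) y) =
               (\<Sum>w\<in>\<Omega>. \<Sum>c'\<in>conj_classes G. y c' * (a w * the_elem (char_of G (d w) (T w) ` c')))"
              by (simp add: char_ext_def sum_distrib_left mult_ac)
            also have "\<dots> = (\<Sum>c'\<in>conj_classes G. y c' * (\<Sum>w\<in>\<Omega>. a w * the_elem (char_of G (d w) (T w) ` c')))"
              by (subst sum.swap) (simp add: sum_distrib_left)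
            also have "\<dots> = (\<Sum>c'\<in>conj_classes G. if c' = c then of_nat z * y c else 0)"
              using sep(4) by (intro sum.cong refl) auto
            finally show ?thesis using True finite_conj_classes by simp
          qed
          have "char_ext G (char_of G (d w) (T w)) v' = char_ext G (char_of G (d w) (T w)) v" if "w \<in> \<Omega>" for w
          proof -
            have "char_of G (d w) (T w) \<in> characters G" using sep(3)[OF that] by (auto simp: characters_def)
            thus ?thesis using v' log by (simp add: q_def)
          qed
          hence "of_nat z * v' c = of_nat z * v c" unfolding ext[symmetric] by simp
          thus "v' c = v c" using sep(2) by simp
        qed
      qed
    qed
  qed
  moreover have "v = (\<lambda>c. of_nat p * v0 c)" by (simp add: v_def fun_eq_iff)
  ultimately show ?thesis using v0 by blast
qed

end

section \<open>The coefficient ring and its completion\<close>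

lemma coeff_ring_nat_pow: "a [^]\<^bsub>coeff_ring\<^esub> (n::nat) = (a :: 'r::comm_ring_1) ^ n"
proof -
  interpret R: cring "coeff_ring :: 'r ring" by (rule cring_from_type_algebra)
  show ?thesis by (induction n) (simp_all add: R.nat_pow_Suc mult.commute)
qed

lemma coeff_ring_PIdl: "PIdl\<^bsub>coeff_ring\<^esub> a = {z :: 'r::comm_ring_1. a dvd z}"
  by (auto simp: cgenideal_def dvd_def mult.commute)

lemma adic_coset: "PIdl\<^bsub>coeff_ring\<^esub> (a [^]\<^bsub>coeff_ring\<^esub> n) +>\<^bsub>coeff_ring\<^esub> r = {z :: 'r::comm_ring_1. a ^ n dvd z - r}"
proof -
  have "z \<in> (\<Union>h\<in>{z. a ^ n dvd z}. {h + r}) \<longleftrightarrow> a ^ n dvd z - r" for z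
    by (auto intro!: bexI[of _ "z - r"])
  thus ?thesis unfolding coeff_ring_PIdl coeff_ring_nat_pow a_r_coset_def' by auto
qed

lemma adic_completion_separated:
  fixes r :: "'r::comm_ring_1"
  assumes iso: "to_adic_completion coeff_ring a \<in> ring_iso coeff_ring (adic_completion coeff_ring a)"
    and r: "\<And>n. a ^ n dvd r"
  shows "r = 0"
proof -
  have "inj_on (to_adic_completion coeff_ring a) (carrier (coeff_ring :: 'r ring))"
    using iso by (simp add: ring_iso_def bij_betw_def)
  moreover have "to_adic_completion coeff_ring a r = to_adic_completion coeff_ring a 0"
  proof
    fix n
    have "a ^ n dvd z - r \<longleftrightarrow> a ^ n dvd z" for z
      using r[of n] dvd_add[of "a ^ n" "z - r" r] dvd_diff[of "a ^ n" z r] by auto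
    thus "to_adic_completion coeff_ring a r n = to_adic_completion coeff_ring a 0 n"
      by (simp add: to_adic_completion_def adic_coset)
  qed
  ultimately show ?thesis by (simp add: inj_on_def)
qed

lemma adic_completion_complete:
  fixes s :: "nat \<Rightarrow> 'r::comm_ring_1"
  assumes iso: "to_adic_completion coeff_ring a \<in> ring_iso coeff_ring (adic_completion coeff_ring a)"
    and s: "\<And>n. a ^ n dvd s (Suc n) - s n"
  shows "\<exists>l. \<forall>n. a ^ n dvd l - s n"
proof -
  define w where "w n = {z :: 'r. a ^ n dvd z - s n}" for n
  have "w n \<in> carrier (coeff_ring Quot (PIdl\<^bsub>coeff_ring\<^esub> (a [^]\<^bsub>coeff_ring\<^esub> n)))" for n
    unfolding FactRing_def A_RCOSETS_def' using adic_coset[of a n "s n"] by (auto simp: w_def)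
  moreover have "w (Suc n) \<subseteq> w n" for n
  proof
    fix z assume "z \<in> w (Suc n)"
    hence "a ^ n dvd z - s (Suc n)" unfolding w_def by (auto intro: dvd_mult_right)
    from dvd_add[OF this s[of n]] show "z \<in> w n" by (simp add: w_def)
  qed
  ultimately have "w \<in> carrier (adic_completion coeff_ring a)"
    by (simp add: adic_completion_def Let_def)
  moreover have "to_adic_completion coeff_ring a ` carrier coeff_ring = carrier (adic_completion coeff_ring a)"
    using iso by (simp add: ring_iso_def bij_betw_def)
  ultimately obtain l where l: "w = to_adic_completion coeff_ring a l" by blast
  have "a ^ n dvd l - s n" for n
  proof -
    have "l \<in> w n" unfolding l to_adic_completion_def adic_coset by simp
    thus ?thesis by (simp add: w_def)
  qed
  thus ?thesis by blast
qed

text \<open>If \<open>F r = 0\<close>, then \<open>p\<close> divides \<open>r\<^sup>p\<close>, hence it divides \<open>r\<close> because it generates a prime ideal, and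
  \<open>F\<close> also kills the quotient of \<open>r\<close> by \<open>p\<close>.  So \<open>r\<close> is divisible by all powers of \<open>p\<close>.\<close>

lemma lift_of_Frobenius_injective:
  fixes F :: "'r::comm_ring_1 \<Rightarrow> 'r"
  assumes F: "\<And>a b. F (a * b) = F a * F b" "F (of_nat p) = of_nat p" "\<And>r. of_nat p dvd F r - r ^ p"
    and dom: "\<And>r :: 'r. of_nat p * r = 0 \<Longrightarrow> r = 0"
    and prime: "primeideal (PIdl\<^bsub>coeff_ring\<^esub> (of_nat p :: 'r)) coeff_ring"
    and sep: "\<And>r :: 'r. (\<And>n. of_nat p ^ n dvd r) \<Longrightarrow> r = 0"
    and r: "F r = 0"
  shows "r = 0"
proof -
  interpret P: primeideal "PIdl\<^bsub>coeff_ring\<^esub> (of_nat p :: 'r)" coeff_ring by (rule prime)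
  have one: "\<not> of_nat p dvd (1 :: 'r)"
  proof
    assume "of_nat p dvd (1 :: 'r)"
    hence "PIdl\<^bsub>coeff_ring\<^esub> (of_nat p :: 'r) = carrier coeff_ring"
      unfolding coeff_ring_PIdl by (auto intro: dvd_trans)
    thus False using P.I_notcarr by simp
  qed
  have pw: "of_nat p dvd z" if "of_nat p dvd z ^ n" for z :: 'r and n
    using that
  proof (induction n)
    case 0
    thus ?case using one by simp
  next
    case (Suc n)
    have "of_nat p dvd z \<or> of_nat p dvd z ^ n"
      using P.I_prime[of z "z ^ n"] Suc.prems unfolding coeff_ring_PIdl by simp
    thus ?case using Suc.IH by blast
  qed
  have step: "\<exists>z'. z = of_nat p * z' \<and> F z' = 0" if z: "F z = 0" for z
  proof -
    have "of_nat p dvd z ^ p" using F(3)[of z] z by simp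
    then obtain z' where z': "z = of_nat p * z'" using pw by blast
    have "of_nat p * F z' = 0" using z unfolding z' F(1,2) .
    thus ?thesis using dom z' by blast
  qed
  have "\<exists>z. r = of_nat p ^ n * z \<and> F z = 0" for n
  proof (induction n)
    case 0
    show ?case using r by simp
  next
    case (Suc n)
    then obtain z where "r = of_nat p ^ n * z" "F z = 0" by blast
    moreover obtain z' where "z = of_nat p * z'" "F z' = 0" using step[OF \<open>F z = 0\<close>] by blast
    ultimately show ?case by (intro exI[of _ z']) (simp add: mult_ac)
  qed
  thus ?thesis by (intro sep) (metis dvd_triv_left)
qed

theorem theorem6p7:
  fixes p :: nat
    and F :: "'r::{idom, ring_char_0} \<Rightarrow> 'r"
    and G :: "('g, 'm) monoid_scheme"
  assumes "Factorial_Ring.prime p"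
    and "group G" and "finite (carrier G)"
    and "noetherian_domain (coeff_ring :: 'r ring)"
    and "krull_dim (coeff_ring :: 'r ring) < \<infinity>"
    and "normal_domain TYPE('r)"
    and "to_adic_completion coeff_ring (of_nat p :: 'r)
           \<in> ring_iso coeff_ring (adic_completion coeff_ring (of_nat p))"
    and "lift_of_Frobenius p F"
    and "coinvariants_torsion_free p F"
    and "primeideal (PIdl\<^bsub>coeff_ring\<^esub> (of_nat p :: 'r)) coeff_ring"
    and "\<And>L. finite_unramified_ext p L \<Longrightarrow>
           SK1 (R_ext p L :: 'r rext ring) = {\<one>\<^bsub>K1 (R_ext p L :: 'r rext ring)\<^esub>}"
    and "finitely_many_orthogonal_idempotents
           (residue_ring_closure p ::
             ('r set \<times> ((int set list \<times> nat) multiset \<Rightarrow> int set) \<Rightarrow> int) set ring)"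
    and "unit_cohomology_hyp p F"
  shows "upsilon p F G ` (Det G ` Units (monoid_ring (coeff_ring :: 'r ring) G))
           \<subseteq> (\<lambda>v c. of_nat p * v c) ` class_module (range to_Nc) (conj_classes G)"
proof -
  have hom: "F \<in> Ring.ring_hom coeff_ring coeff_ring" and lift: "\<And>r. of_nat p dvd F r - r ^ p"
    using assms(8) by (auto simp: lift_of_Frobenius_def)
  have F: "F (a + b) = F a + F b" "F (a * b) = F a * F b" "F 1 = 1" for a b
    using ring_hom_add[OF hom, of a b] ring_hom_mult[OF hom, of a b] ring_hom_one[OF hom] by simp_all
  have F0: "F 0 = 0" using F(1)[of 0 0] by simp
  have Fp: "F (of_nat n) = of_nat n" for n by (induction n) (simp_all add: F F0)
  have p0: "p > 0" using assms(1) by (rule prime_gt_0_nat)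
  note sep = adic_completion_separated[OF assms(7)]
  interpret frobenius_group p "TYPE('r)" G F
  proof (intro frobenius_group.intro padic_group.intro padic_normal.intro assms(1,2,6)
      padic_group_axioms.intro frobenius_group_axioms.intro assms(3) F lift)
    show "r = 0" if "\<And>n. of_nat p ^ n dvd r" for r :: 'r using that by (rule sep)
    show "\<exists>l. \<forall>n. of_nat p ^ n dvd l - a n" if "\<And>n. of_nat p ^ n dvd a (Suc n) - a n" for a :: "nat \<Rightarrow> 'r"
      by (rule adic_completion_complete[OF assms(7) that])
    show "r = 0" if "F r = 0" for r
      by (rule lift_of_Frobenius_injective[OF F(2) Fp lift _ assms(10) sep that]) (use p0 in auto)
  qed
  show ?thesis using upsilon_integral by blast
qed

end
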